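(* For $s\in\mathbb{C}$ with sufficiently large real part, $$\sum_{\substack{P\in T(\mathbb{Q})\\ P\ D_0\text{-integral}}}H(P,s)^{-1}=\left(1-\frac{1}{3^z}\right)^2\zeta_{\mathbb{Q}(\sqrt{-3})}(z)^2\prod_{q\equiv 2\ (\mathrm{mod}\ 3)}\left(1-\frac{1}{q^{2z}}\right)\prod_{p\equiv 1\ (\mathrm{mod}\ 3)}\left(1-\frac{3}{p^{2z}}+\frac{2}{p^{3z}}\right)$$ where $z=\tfrac{s}{2}$ and $\zeta_{\mathbb{Q}(\sqrt{-3})}$ is the Dedekind zeta function of $\mathbb{Q}(\sqrt{-3})$. This height zeta function can be meromorphically continued to the half-plane $\mathrm{Re}(s)>1$ and its only pole in this region is at $s=2$ with order $2$. If $n\in\mathbb{Z}_{\ge1}$ is not divisible by $3$, then the number of $D_0$-integral rational points on $T$ with toric height $\sqrt{n}$ is equal to $$\sum_{d\mid n}3^{\omega(P_1(d))}(-1)^{\Omega(P_2(d))}.$$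
   Context: Products over $p$, $q$ run over primes in the indicated residue classes. $P_j(d)$ is the largest divisor of $d$ only divisible by primes $\equiv j\pmod 3$; $\omega$ (resp. $\Omega$) counts prime factors without (resp. with) multiplicity. The surface and the torus. Let $C_3=\langle\sigma\rangle$ act on $\mathbb{P}_2=\mathrm{Proj}\,\mathbb{Q}[X,Y,Z]$ by cyclic permutation of the coordinates (the regular representation; $(X,Y,Z)$ corresponds to $Xe+Y\sigma+Z\sigma^2$ in the group algebra). Put $\varepsilon=X+Y+Z$, $\Delta=3XYZ-X^3-Y^3-Z^3$ (which is divisible by $\varepsilon$), $S=\mathbb{P}_2/C_3$, $\mathcal{G}=\mathbb{P}_2[\Delta^{-1}]$ (the torus of units of augmentation one in the group algebra of $C_3$), and $T=\mathcal{G}/C_3\subset S$, a rank-two algebraic torus over $\mathbb{Q}$; $S$ is a toric compactification of $T$. $D_0\subset S$ is the divisor $\{\varepsilon=0\}$. A rational point $P$ of $S-D_0$ is $D_0$-integral if every element of $\mathbb{Z}[X/\varepsilon,Y/\varepsilon]^{C_3}$ is $\mathbb{Z}$-valued on $P$ (here $Z/\varepsilon=1-X/\varepsilon-Y/\varepsilon$). Toric data. Let $\zeta$ be a primitive cube root of unity, $E=\mathbb{Q}(\zeta)=\mathbb{Q}(\sqrt{-3})$, $A=X+\zeta Y+\zeta^2Z$, $B=X+\zeta^2Y+\zeta Z$. The character lattice $M_E'$ of $\mathcal{G}_E$ has basis $v_1^\vee,v_2^\vee$ with associated characters $\chi^{v_1^\vee}=A/\varepsilon$, $\chi^{v_2^\vee}=B/\varepsilon$.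 Let $v_1,v_2$ be the dual basis of $N_E'=\mathrm{Hom}(M_E',\mathbb{Z})$ and $v_0=-v_1-v_2$. The cocharacter lattice of $T_E$ is $N_E=\mathbb{Z}\omega+\mathbb{Z}\,\gamma\omega$ with $\omega=\tfrac13(2v_1+v_2)$, $\gamma\omega=\tfrac13(v_1+2v_2)$, and its character lattice is the dual lattice $M_E=\mathbb{Z}a'+\mathbb{Z}b'$, $a'=2v_1^\vee-v_2^\vee$, $b'=2v_2^\vee-v_1^\vee$. The fan of $S_E$ in $N_{E,\mathbb{R}}$ is complete with rays spanned by $v_0,v_1,v_2$; $D_0$ is the torus-stable divisor attached to $v_0$. Toric height. For each place $w$ of $E$ let $|\cdot|_w$ be the normalized absolute value ($q_w^{-\mathrm{ord}_w(\cdot)}$ with $q_w$ the residue cardinality if $w$ is finite, the square of the usual absolute value if $w$ is infinite). For $P\in T(\mathbb{Q})$ let $\ell_w(P)\in N_{E,\mathbb{R}}$ be determined by $m(\ell_w(P))=-\log|\chi^m(P)|_w$ for all $m\in M_E$. For $s\in\mathbb{C}$ let $\varphi_s:N_{E,\mathbb{R}}\to\mathbb{C}$ be the continuous function, linear on each cone of the fan, with $\varphi_s(v_0)=-s$, $\varphi_s(v_1)=\varphi_s(v_2)=0$. Then $H(P,s)=\prod_w\exp(-\varphi_s(\ell_w(P)))^{1/2}$, the product being over all places $w$ of $E$. This is the toric height attached to $sD_0$, and it corresponds to the identification $\mathrm{Pic}(S)\otimes\mathbb{C}\cong\mathbb{C}$ in which the ample generator corresponds to $s=3$ and $D_0$ to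 $s=1$. The toric height of $P$ is $H(P,1)$. *)

theory Defs
  imports
    "HOL-Complex_Analysis.Complex_Analysis"
    "HOL-Computational_Algebra.Computational_Algebra"
    "HOL-Algebra.Ideal_Product"
    "HOL-Algebra.QuotRing"
begin

section \<open>Number fields inside the complex numbers\<close>

definition ring_of_integers :: "complex set \<Rightarrow> complex ring" where
  "ring_of_integers K =
     \<lparr>carrier = {x \<in> K. algebraic_int x}, mult = (*), one = 1, zero = 0, add = (+)\<rparr>"

definition nonzero_ideals :: "complex set \<Rightarrow> complex set set" where
  "nonzero_ideals K = {I. ideal I (ring_of_integers K) \<and> I \<noteq> {0}}"

definition ideal_norm :: "complex set \<Rightarrow> complex set \<Rightarrow> nat" where
  "ideal_norm K I = card (carrier (ring_of_integers K Quot I))"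

definition dedekind_zeta :: "complex set \<Rightarrow> complex \<Rightarrow> complex" where
  "dedekind_zeta K z = (\<Sum>\<^sub>\<infinity>I\<in>nonzero_ideals K. 1 / of_nat (ideal_norm K I) powr z)"

definition ideal_ord_int :: "complex set \<Rightarrow> complex set \<Rightarrow> complex \<Rightarrow> nat" where
  "ideal_ord_int K \<pp> a = Max {k. a \<in> \<pp> [^]\<^bsub>ideals_set (ring_of_integers K)\<^esub> k}"

text \<open>The order of a nonzero element of \<open>K\<close> at the prime \<open>\<pp>\<close>, written as a quotient of integers.\<close>

definition ideal_ord :: "complex set \<Rightarrow> complex set \<Rightarrow> complex \<Rightarrow> int" where
  "ideal_ord K \<pp> x =
     (THE n. \<exists>a \<in> carrier (ring_of_integers K) - {0}. \<exists>b \<in> carrier (ring_of_integers K) - {0}.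
        x = a / b \<and> n = int (ideal_ord_int K \<pp> a) - int (ideal_ord_int K \<pp> b))"


section \<open>The field \<open>E\<close>, its places and normalized absolute values\<close>

definition zeta3 :: complex where
  "zeta3 = cis (2 * pi / 3)"

definition E :: "complex set" where
  "E = {of_rat a + of_rat b * zeta3 | a b. True}"

datatype place = Infinite_Place | Finite_Place "complex set"

text \<open>\<open>E\<close> is imaginary quadratic, so it has exactly one infinite place, and this place is complex.\<close>

definition places :: "place set" where
  "places = insert Infinite_Place
     (Finite_Place ` {\<pp>. primeideal \<pp> (ring_of_integers E) \<and> \<pp> \<noteq> {0}})"

fun abs_place :: "place \<Rightarrow> complex \<Rightarrow> real" where
  "abs_place Infinite_Place x = (cmod x)\<^sup>2"
| "abs_place (Finite_Place \<pp>) x =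
     (if x = 0 then 0 else real (ideal_norm E \<pp>) powi (- ideal_ord E \<pp> x))"


section \<open>The rational points of \<open>T\<close>\<close>

text \<open>
  We work in the affine chart where \<open>\<epsilon>\<close> does not vanish, with the coordinates \<open>x = X/\<epsilon>\<close>, \<open>y = Y/\<epsilon>\<close>
  and \<open>z = Z/\<epsilon> = 1 - x - y\<close>. A bivariate polynomial is a polynomial in \<open>y\<close> whose coefficients are
  polynomials in \<open>x\<close>. The generator \<open>\<sigma>\<close> acts by \<open>x \<mapsto> y\<close>, \<open>y \<mapsto> z\<close> (and hence \<open>z \<mapsto> x\<close>).
\<close>

definition const2 :: "'a::comm_ring_1 \<Rightarrow> 'a poly poly" where
  "const2 c = [:[:c:]:]"

definition xx :: "'a::comm_ring_1 poly poly" where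
  "xx = [:[:0, 1:]:]"

definition yy :: "'a::comm_ring_1 poly poly" where
  "yy = [:0, 1:]"

definition zz :: "'a::comm_ring_1 poly poly" where
  "zz = 1 - xx - yy"

definition subst2 ::
    "'a::comm_ring_1 poly poly \<Rightarrow> 'a poly poly \<Rightarrow> 'a poly poly \<Rightarrow> 'a poly poly" where
  "subst2 f u v = poly (map_poly (\<lambda>c. poly (map_poly const2 c) u) f) v"

definition sigma_act :: "'a::comm_ring_1 poly poly \<Rightarrow> 'a poly poly" where
  "sigma_act f = subst2 f yy zz"

definition invariants :: "'a::comm_ring_1 poly poly set" where
  "invariants = {f. sigma_act f = f}"

text \<open>
  The image in \<open>S\<close> of the chart is \<open>S - D\<^sub>0\<close>, that is \<open>Spec\<close> of the ring of invariants of
  \<open>\<rat>[x, y]\<close>. Its rational points are the \<open>\<rat>\<close>-algebra homomorphisms from this ring to \<open>\<rat>\<close>.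
\<close>

definition points_S_minus_D0 :: "(rat poly poly \<Rightarrow> rat) set" where
  "points_S_minus_D0 = {P \<in> extensional invariants.
     (\<forall>c. P (const2 c) = c) \<and>
     (\<forall>f\<in>invariants. \<forall>g\<in>invariants. P (f + g) = P f + P g \<and> P (f * g) = P f * P g)}"

text \<open>
  Since \<open>\<epsilon>\<close> divides \<open>\<Delta>\<close>, the torus \<open>T\<close> lies in \<open>S - D\<^sub>0\<close>; there it is the open subscheme on
  which the invariant function \<open>\<Delta>/\<epsilon>\<^sup>3\<close> is invertible.
\<close>

definition delta :: "rat poly poly" where
  "delta = 3 * xx * yy * zz - xx ^ 3 - yy ^ 3 - zz ^ 3"

definition T_points :: "(rat poly poly \<Rightarrow> rat) set" where
  "T_points = {P \<in> points_S_minus_D0. P delta \<noteq> 0}"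

definition D0_integral :: "(rat poly poly \<Rightarrow> rat) \<Rightarrow> bool" where
  "D0_integral P \<longleftrightarrow>
     (\<forall>f\<in>invariants. (\<forall>i j. coeff (coeff f i) j \<in> \<int>) \<longrightarrow> P f \<in> \<int>)"


section \<open>Characters of \<open>T\<close> over \<open>E\<close>\<close>

text \<open>
  The \<open>E\<close>-linear extension of a rational point: an invariant with coefficients in \<open>E\<close> is
  uniquely \<open>f\<^sub>0 + \<zeta> f\<^sub>1\<close> with rational invariants \<open>f\<^sub>0\<close> and \<open>f\<^sub>1\<close>.
\<close>

definition eval_E :: "(rat poly poly \<Rightarrow> rat) \<Rightarrow> complex poly poly \<Rightarrow> complex" where
  "eval_E P f = (THE c. \<exists>f0\<in>invariants. \<exists>f1\<in>invariants.
     f = map_poly (map_poly of_rat) f0 + const2 zeta3 * map_poly (map_poly of_rat) f1 \<and>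
     c = of_rat (P f0) + zeta3 * of_rat (P f1))"

text \<open>The functions \<open>A/\<epsilon>\<close> and \<open>B/\<epsilon>\<close>, whose product is \<open>-\<Delta>/\<epsilon>\<^sup>3\<close>.\<close>

definition AA :: "complex poly poly" where
  "AA = xx + const2 zeta3 * yy + const2 (zeta3\<^sup>2) * zz"

definition BB :: "complex poly poly" where
  "BB = xx + const2 (zeta3\<^sup>2) * yy + const2 zeta3 * zz"

text \<open>
  Elements of \<open>M\<^sub>E'\<close> are given by their coordinates in the basis \<open>v\<^sub>1\<^sup>\<or>, v\<^sub>2\<^sup>\<or>\<close>, elements of
  \<open>N\<^sub>E\<^sub>,\<^sub>\<real>\<close> by their coordinates in the dual basis \<open>v\<^sub>1, v\<^sub>2\<close>. The sublattice \<open>M\<^sub>E\<close> is spanned by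
  \<open>a' = (2, -1)\<close> and \<open>b' = (-1, 2)\<close>.
\<close>

definition M_E :: "(int \<times> int) set" where
  "M_E = {(2 * r - t, 2 * t - r) | r t. True}"

definition pairing :: "int \<times> int \<Rightarrow> real \<times> real \<Rightarrow> real" where
  "pairing m l = of_int (fst m) * fst l + of_int (snd m) * snd l"

text \<open>
  The value at a point of \<open>T\<close> of the character \<open>(A/\<epsilon>)\<^sup>i (B/\<epsilon>)\<^sup>j\<close> with \<open>(i, j) \<in> M\<^sub>E\<close>, written with
  invariant polynomials as numerator and denominator.
\<close>

definition char_value :: "(rat poly poly \<Rightarrow> rat) \<Rightarrow> int \<times> int \<Rightarrow> complex" where
  "char_value P = (\<lambda>(i, j). let k = nat \<bar>i\<bar> + nat \<bar>j\<bar> in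
     eval_E P (AA ^ nat (i + int k) * BB ^ nat (j + int k)) / eval_E P (AA * BB) ^ k)"


section \<open>The toric height\<close>

definition v0 :: "real \<times> real" where "v0 = (-1, -1)"
definition v1 :: "real \<times> real" where "v1 = (1, 0)"
definition v2 :: "real \<times> real" where "v2 = (0, 1)"

definition fan_max_cones :: "(real \<times> real) set set" where
  "fan_max_cones =
     {convex_cone hull {v0, v1}, convex_cone hull {v1, v2}, convex_cone hull {v2, v0}}"

definition phi :: "complex \<Rightarrow> real \<times> real \<Rightarrow> complex" where
  "phi s = (THE f. continuous_on UNIV f \<and>
     (\<forall>C\<in>fan_max_cones. \<exists>g. linear g \<and> (\<forall>l\<in>C. f l = g l)) \<and>
     f v0 = - s \<and> f v1 = 0 \<and> f v2 = 0)"

definition log_point :: "place \<Rightarrow> (rat poly poly \<Rightarrow> rat) \<Rightarrow> real \<times> real" where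
  "log_point w P = (THE l. \<forall>m\<in>M_E. pairing m l = - ln (abs_place w (char_value P m)))"

text \<open>
  The power \<open>1/2\<close> of the local factor \<open>exp (- \<phi>\<^sub>s (\<ell>\<^sub>w(P)))\<close> is the branch holomorphic in \<open>s\<close> and
  positive for real \<open>s\<close>.
\<close>

definition local_height :: "place \<Rightarrow> (rat poly poly \<Rightarrow> rat) \<Rightarrow> complex \<Rightarrow> complex" where
  "local_height w P s = exp (- phi s (log_point w P) / 2)"

text \<open>All but finitely many local factors are 1, and the product is over the other ones.\<close>

definition height :: "(rat poly poly \<Rightarrow> rat) \<Rightarrow> complex \<Rightarrow> complex" where
  "height P s = (\<Prod>w\<in>{w\<in>places. local_height w P s \<noteq> 1}. local_height w P s)"

definition integral_points :: "(rat poly poly \<Rightarrow> rat) set" where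
  "integral_points = {P \<in> T_points. D0_integral P}"

definition height_zeta :: "complex \<Rightarrow> complex" where
  "height_zeta s = (\<Sum>\<^sub>\<infinity>P\<in>integral_points. inverse (height P s))"


section \<open>Arithmetic functions\<close>

definition residue_part :: "nat \<Rightarrow> nat \<Rightarrow> nat" where
  "residue_part j d = Max {e. e dvd d \<and> (\<forall>p. prime p \<longrightarrow> p dvd e \<longrightarrow> p mod 3 = j)}"

definition little_omega :: "nat \<Rightarrow> nat" where
  "little_omega n = card (prime_factors n)"

definition big_omega :: "nat \<Rightarrow> nat" where
  "big_omega n = size (prime_factorization n)"

definition factor_1 :: "complex \<Rightarrow> nat \<Rightarrow> complex" where
  "factor_1 z p = (if prime p \<and> p mod 3 = 1
     then 1 - 3 / of_nat p powr (2 * z) + 2 / of_nat p powr (3 * z) else 1)"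

definition factor_2 :: "complex \<Rightarrow> nat \<Rightarrow> complex" where
  "factor_2 z q = (if prime q \<and> q mod 3 = 2 then 1 - 1 / of_nat q powr (2 * z) else 1)"

end

theory Submission
  imports Defs "HOL-Number_Theory.Number_Theory"
begin

text \<open>
  Write \<open>x = X/\<epsilon>\<close>, \<open>y = Y/\<epsilon>\<close> and \<open>z = 1 - x - y\<close>. The group acts on \<open>A\<close> and \<open>B\<close> by cube roots of unity, so
  that over \<open>E\<close> the invariants are generated by \<open>A\<^sup>3\<close>, \<open>B\<^sup>3\<close> and \<open>A B\<close>. A rational point of \<open>T\<close> is therefore the
  same as an element \<open>\<alpha>\<close> of \<open>E\<close>, the value of \<open>A\<^sup>3\<close>, together with a nonzero rational number \<open>N\<close>, the value of \<open>A B\<close>,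
  such that the norm of \<open>\<alpha>\<close> is \<open>N\<^sup>3\<close>. The elementary symmetric functions of \<open>x, y, z\<close> and \<open>x\<^sup>2 y + y\<^sup>2 z + z\<^sup>2 x\<close>
  generate the rational invariants, and integrality at a point amounts to integrality of their values
  (\<open>D0_integral_iff\<close>). In terms of \<open>\<alpha>\<close> this means that \<open>\<alpha>\<close> lies in \<open>\<int>[\<zeta>]\<close> and is congruent to \<open>1\<close> modulo \<open>3\<close>; all further
  congruences follow from the equation for the norm (\<open>integral_points_fibre\<close>).

  As \<open>\<int>[\<zeta>]\<close> is Euclidean and each ideal prime to \<open>3\<close> has exactly one generator congruent to \<open>1\<close> modulo \<open>3\<close>, the integral
  points with \<open>A B = n\<close> correspond to the ideals of norm \<open>n\<^sup>3\<close>, for \<open>n\<close> prime to \<open>3\<close>. At a finite place both \<open>\<alpha>\<close> and its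
  conjugate have absolute value at most \<open>1\<close>, so that the point lies in the cone spanned by \<open>v\<^sub>1\<close> and \<open>v\<^sub>2\<close>, where
  \<open>\<phi>\<^sub>s\<close> vanishes. At the infinite place it lies on the ray of \<open>v\<^sub>0\<close>. This gives \<open>H(P, s) = n\<^bsup>s/2\<^esup>\<close> (\<open>height_eq\<close>), and the height
  zeta function is the Dirichlet series in \<open>s/2\<close> of the number of ideals of norm \<open>n\<^sup>3\<close>.

  Unique factorization makes the number of ideals of norm \<open>n\<close> multiplicative, with value at \<open>p\<^sup>k\<close> equal to \<open>k + 1\<close>
  if \<open>p \<equiv> 1\<close>, to \<open>1\<close> or \<open>0\<close> according to the parity of \<open>k\<close> if \<open>p \<equiv> 2\<close>, and to \<open>1\<close> if \<open>p = 3\<close>. Replacing \<open>k\<close> by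
  \<open>3 k\<close> gives the divisor sum for the number of points of given height (\<open>eis_count_cube_divisor_sum\<close>). It
  also gives the Euler factors of the height zeta function: with \<open>x = p\<^bsup>-z\<^esup>\<close>, the factor at \<open>p \<equiv> 1\<close> is the sum of
  the \<open>(3 k + 1) x\<^sup>k\<close>, which is \<open>(1 + 2 x)/(1 - x)\<^sup>2\<close>. Since \<open>1 - 3 x\<^sup>2 + 2 x\<^sup>3 = (1 - x)\<^sup>2 (1 + 2 x)\<close>, this is the
  square of the factor \<open>(1 - x)\<^bsup>-2\<^esup>\<close> of the Dedekind zeta function times the correction in the theorem
  (\<open>point_factor_eq\<close>, \<open>point_series_eq\<close>).

  The two correction products converge for \<open>Re z > 1/2\<close>. The Dedekind zeta function is the product of the Riemann zeta
  function and the \<open>L\<close>-series of the character modulo \<open>3\<close>. Comparing sums with integrals continues \<open>(z - 1) \<zeta>(z)\<close> and \<open>L(z)\<close>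
  to \<open>Re z > 0\<close>, with values \<open>1\<close> and a positive number at \<open>z = 1\<close>. The square of the zeta function thus
  produces a double pole at \<open>s = 2\<close>, and no other pole occurs for \<open>Re s > 1\<close> (\<open>point_series_continuation\<close>).
\<close>

section \<open>The ring of Eisenstein integers\<close>

text \<open>
  \<open>Eis a b\<close> stands for \<open>a + b \<zeta>\<close>. The formula for the product expresses \<open>\<zeta>\<^sup>2 = - 1 - \<zeta>\<close>, and the
  norm form below is \<open>(a + b \<zeta>) (a + b \<zeta>\<^sup>2)\<close>.
\<close>

datatype eis = Eis (eis_a: int) (eis_b: int)

lemma eis_eq_iff: "x = y \<longleftrightarrow> eis_a x = eis_a y \<and> eis_b x = eis_b y"
  by (cases x; cases y) auto

instantiation eis :: comm_ring_1
begin

definition "0 = Eis 0 0"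
definition "1 = Eis 1 0"
definition "x + y = Eis (eis_a x + eis_a y) (eis_b x + eis_b y)"
definition "- x = Eis (- eis_a x) (- eis_b x)"
definition "x - y = Eis (eis_a x - eis_a y) (eis_b x - eis_b y)"
definition "x * y = Eis (eis_a x * eis_a y - eis_b x * eis_b y)
  (eis_a x * eis_b y + eis_b x * eis_a y - eis_b x * eis_b y)"

instance
  by standard
    (auto simp: zero_eis_def one_eis_def plus_eis_def uminus_eis_def minus_eis_def
      times_eis_def algebra_simps)

end

lemma eis_sel [simp]:
  "eis_a 0 = 0" "eis_b 0 = 0" "eis_a 1 = 1" "eis_b 1 = 0"
  "eis_a (x + y) = eis_a x + eis_a y" "eis_b (x + y) = eis_b x + eis_b y"
  "eis_a (- x) = - eis_a x" "eis_b (- x) = - eis_b x"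
  "eis_a (x - y) = eis_a x - eis_a y" "eis_b (x - y) = eis_b x - eis_b y"
  "eis_a (x * y) = eis_a x * eis_a y - eis_b x * eis_b y"
  "eis_b (x * y) = eis_a x * eis_b y + eis_b x * eis_a y - eis_b x * eis_b y"
  by (auto simp: zero_eis_def one_eis_def plus_eis_def uminus_eis_def minus_eis_def
      times_eis_def)

lemma eis_of_nat [simp]: "eis_a (of_nat n) = int n" "eis_b (of_nat n) = 0"
  by (induction n) auto

lemma eis_of_int [simp]: "eis_a (of_int n) = n" "eis_b (of_int n) = 0"
  by (cases n; simp)+

lemma eis_numeral [simp]: "eis_a (numeral n) = numeral n" "eis_b (numeral n) = 0"
  using eis_of_nat[of "numeral n"] by simp_all

definition eis_norm :: "eis \<Rightarrow> int" where
  "eis_norm x = (eis_a x)\<^sup>2 - eis_a x * eis_b x + (eis_b x)\<^sup>2"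

definition eis_conj :: "eis \<Rightarrow> eis" where
  "eis_conj x = Eis (eis_a x - eis_b x) (- eis_b x)"

lemma eis_conj_sel [simp]: "eis_a (eis_conj x) = eis_a x - eis_b x" "eis_b (eis_conj x) = - eis_b x"
  by (auto simp: eis_conj_def)

lemma eis_conj_conj [simp]: "eis_conj (eis_conj x) = x"
  by (simp add: eis_eq_iff)

lemma eis_conj_mult: "eis_conj (x * y) = eis_conj x * eis_conj y"
  by (simp add: eis_eq_iff algebra_simps)

lemma eis_norm_mult: "eis_norm (x * y) = eis_norm x * eis_norm y"
  by (simp add: eis_norm_def algebra_simps power2_eq_square)

lemma eis_norm_conj [simp]: "eis_norm (eis_conj x) = eis_norm x"
  by (simp add: eis_norm_def algebra_simps power2_eq_square)

lemma eis_mult_conj: "x * eis_conj x = of_int (eis_norm x)"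
  by (simp add: eis_eq_iff eis_norm_def algebra_simps power2_eq_square)

lemma eis_norm_four: "4 * eis_norm x = (2 * eis_a x - eis_b x)\<^sup>2 + 3 * (eis_b x)\<^sup>2"
  by (simp add: eis_norm_def algebra_simps power2_eq_square)

lemma eis_norm_nonneg [simp]: "eis_norm x \<ge> 0"
  using eis_norm_four[of x] by (smt (verit) zero_le_power2)

lemma eis_norm_eq_0 [simp]: "eis_norm x = 0 \<longleftrightarrow> x = 0"
proof
  assume "eis_norm x = 0"
  then have "(2 * eis_a x - eis_b x)\<^sup>2 + 3 * (eis_b x)\<^sup>2 = 0"
    using eis_norm_four[of x] by simp
  then have "(2 * eis_a x - eis_b x)\<^sup>2 = 0" "(eis_b x)\<^sup>2 = 0"
    by (smt (verit) zero_le_power2)+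
  then show "x = 0" by (auto simp: eis_eq_iff)
qed (simp add: eis_norm_def)

lemma eis_norm_pos: "x \<noteq> 0 \<Longrightarrow> eis_norm x > 0"
  using eis_norm_nonneg[of x] eis_norm_eq_0[of x] by linarith

lemma eis_norm_zero [simp]: "eis_norm 0 = 0" by simp

lemma eis_norm_one [simp]: "eis_norm 1 = 1" by (simp add: eis_norm_def)

lemma eis_norm_of_int [simp]: "eis_norm (of_int n) = n\<^sup>2" by (simp add: eis_norm_def)
lemma eis_norm_of_nat [simp]: "eis_norm (of_nat n) = (int n)\<^sup>2" by (simp add: eis_norm_def)

instance eis :: idom
proof
  fix x y :: eis
  assume "x \<noteq> 0" "y \<noteq> 0"
  then have "eis_norm (x * y) \<noteq> 0" by (simp add: eis_norm_mult)
  then show "x * y \<noteq> 0" by auto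
qed

text \<open>
  Rounding both coordinates of a quotient moves each by at most \<open>1/2\<close>. The norm form is at most \<open>3/4\<close> on
  such a difference, which makes the ring Euclidean.
\<close>

definition round_div :: "int \<Rightarrow> int \<Rightarrow> int" where
  "round_div c n = (2 * c + n) div (2 * n)"

lemma round_div_bound:
  assumes "n > 0"
  shows "2 * \<bar>c - round_div c n * n\<bar> \<le> n"
proof -
  have *: "2 * c + n = 2 * n * round_div c n + (2 * c + n) mod (2 * n)"
    unfolding round_div_def by simp
  have "(2 * c + n) mod (2 * n) \<ge> 0" "(2 * c + n) mod (2 * n) < 2 * n"
    using assms by auto
  moreover have "2 * (c - round_div c n * n) = (2 * c + n) mod (2 * n) - n"
    using * by (simp add: algebra_simps)
  ultimately show ?thesis by linarith
qed

lemma round_div_exact: "n > 0 \<Longrightarrow> round_div (c * n) n = c"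
proof -
  assume n: "n > 0"
  have "2 * (c * n) + n = n + c * (2 * n)" by simp
  then show ?thesis unfolding round_div_def using n
    by (metis add.commute div_mult_self1 div_pos_pos_trivial add.right_neutral
        less_add_same_cancel1 mult_2 less_imp_le zero_less_mult_iff zero_less_numeral less_irrefl)
qed

instantiation eis :: idom_modulo
begin

definition divide_eis :: "eis \<Rightarrow> eis \<Rightarrow> eis" where
  "x div y = (if y = 0 then 0 else Eis (round_div (eis_a (x * eis_conj y)) (eis_norm y))
     (round_div (eis_b (x * eis_conj y)) (eis_norm y)))"

definition modulo_eis :: "eis \<Rightarrow> eis \<Rightarrow> eis" where
  "modulo_eis x y = x - x div y * y"

instance
proof
  fix x y :: eis
  show "x div 0 = 0" by (simp add: divide_eis_def)
  show "x * y div y = x" if "y \<noteq> 0"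
  proof -
    have *: "x * y * eis_conj y = x * of_int (eis_norm y)"
      by (simp add: mult.assoc eis_mult_conj)
    have "eis_a (x * y * eis_conj y) = eis_a x * eis_norm y"
      "eis_b (x * y * eis_conj y) = eis_b x * eis_norm y"
      unfolding * by simp_all
    then show ?thesis
      using that eis_norm_pos[OF that] round_div_exact
      by (simp add: divide_eis_def del: eis_sel(11,12))
  qed
  show "x div y * y + x mod y = x" by (simp add: modulo_eis_def)
qed

end

instantiation eis :: euclidean_ring
begin

definition euclidean_size_eis :: "eis \<Rightarrow> nat" where
  "euclidean_size x = nat (eis_norm x)"

instance
proof
  fix x y :: eis
  show "euclidean_size (0 :: eis) = 0" by (simp add: euclidean_size_eis_def)
  show "euclidean_size (x mod y) < euclidean_size y" if "y \<noteq> 0"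
  proof -
    \<comment> \<open>The remainder, multiplied by the conjugate of \<open>y\<close>, has coordinates at most half of the norm.\<close>
    define n where "n = eis_norm y"
    have n: "n > 0" unfolding n_def using eis_norm_pos[OF that] .
    define r where "r = x mod y"
    define e f where "e = eis_a (r * eis_conj y)" and "f = eis_b (r * eis_conj y)"
    have "r * eis_conj y = x * eis_conj y - x div y * (y * eis_conj y)"
      by (simp add: r_def modulo_eis_def algebra_simps)
    also have "\<dots> = x * eis_conj y - x div y * of_int n"
      by (simp add: eis_mult_conj n_def)
    finally have *: "r * eis_conj y = x * eis_conj y - x div y * of_int n" .
    have "e = eis_a (x * eis_conj y) - round_div (eis_a (x * eis_conj y)) n * n"
      "f = eis_b (x * eis_conj y) - round_div (eis_b (x * eis_conj y)) n * n"
      unfolding e_def f_def * using that by (simp_all add: divide_eis_def n_def)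
    then have ef: "2 * \<bar>e\<bar> \<le> n" "2 * \<bar>f\<bar> \<le> n"
      using round_div_bound[OF n] by auto
    have "(2 * \<bar>e\<bar>)\<^sup>2 \<le> n\<^sup>2" "(2 * \<bar>f\<bar>)\<^sup>2 \<le> n\<^sup>2"
      using ef by (intro power_mono; simp)+
    moreover have "(2 * \<bar>e\<bar>) * (2 * \<bar>f\<bar>) \<le> n * n"
      using ef n by (intro mult_mono) auto
    moreover have "- (e * f) \<le> \<bar>e\<bar> * \<bar>f\<bar>"
      by (metis abs_ge_minus_self abs_mult)
    ultimately have "4 * (e\<^sup>2 - e * f + f\<^sup>2) \<le> 3 * n\<^sup>2"
      by (simp add: power2_eq_square)
    also have "3 * n\<^sup>2 < 4 * (n * n)" using n by (simp add: power2_eq_square)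
    finally have "e\<^sup>2 - e * f + f\<^sup>2 < n * n" by simp
    moreover have "eis_norm r * n = e\<^sup>2 - e * f + f\<^sup>2"
      using eis_norm_mult[of r "eis_conj y"] eis_norm_def[of "r * eis_conj y"]
      unfolding e_def f_def n_def by (metis eis_norm_conj)
    ultimately have "eis_norm r < n" using n by (metis mult_less_cancel_right_pos)
    then show ?thesis using n by (simp add: euclidean_size_eis_def r_def n_def)
  qed
  show "euclidean_size x \<le> euclidean_size (x * y)" if "y \<noteq> 0"
  proof -
    have "eis_norm x * 1 \<le> eis_norm x * eis_norm y"
      using eis_norm_pos[OF that] by (intro mult_left_mono) auto
    then show ?thesis by (simp add: euclidean_size_eis_def eis_norm_mult)
  qed
qed

end

text \<open>
  Any choice of one representative in each class of associates, with \<open>1\<close> for the units, gives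
  normalized greatest common divisors and unique prime factorizations.
\<close>

instantiation eis :: normalization_euclidean_semiring
begin

definition normalize_eis :: "eis \<Rightarrow> eis" where
  "normalize_eis x = (if x dvd 1 then 1 else (SOME y. x dvd y \<and> y dvd x))"

definition unit_factor_eis :: "eis \<Rightarrow> eis" where
  "unit_factor_eis x = x div normalize x"

lemma eis_normalize_assoc: "x dvd normalize x \<and> normalize x dvd (x :: eis)"
proof (cases "x dvd 1")
  case True
  then show ?thesis by (simp add: normalize_eis_def)
next
  case False
  have "\<exists>y. x dvd y \<and> y dvd x" by (intro exI[of _ x]) auto
  then have "x dvd (SOME y. x dvd y \<and> y dvd x) \<and> (SOME y. x dvd y \<and> y dvd x) dvd x"
    by (rule someI_ex)
  then show ?thesis using False by (simp add: normalize_eis_def)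
qed

lemma eis_normalize_cong:
  assumes "x dvd y" "y dvd (x :: eis)"
  shows "normalize x = normalize y"
proof -
  have "(x dvd z \<and> z dvd x) = (y dvd z \<and> z dvd y)" for z
    using assms dvd_trans by blast
  moreover have "x dvd 1 \<longleftrightarrow> y dvd 1" using assms dvd_trans by blast
  ultimately show ?thesis by (simp add: normalize_eis_def)
qed

instance
proof
  fix x y :: eis
  show *: "unit_factor x * normalize x = x" for x :: eis
    using eis_normalize_assoc[of x] by (simp add: unit_factor_eis_def)
  show "normalize (0 :: eis) = 0" using eis_normalize_assoc[of 0] by simp
  show "unit_factor (0 :: eis) = 0" by (simp add: unit_factor_eis_def)
  show "unit_factor x = x" if "x dvd 1" using that by (simp add: unit_factor_eis_def normalize_eis_def)
  show "unit_factor x dvd 1" if "x \<noteq> 0"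
  proof -
    obtain z where z: "normalize x = x * z" using eis_normalize_assoc[of x] by auto
    have "x * (unit_factor x * z) = x * 1" using *[of x] z by (simp add: ac_simps)
    then have "unit_factor x * z = 1" using that by (metis mult_left_cancel)
    then show ?thesis by (metis dvd_triv_left)
  qed
  show "unit_factor (x * y) = x * unit_factor y" if "x dvd 1"
  proof -
    have "x * y dvd y" "y dvd x * y" using that by auto
    then have "normalize (x * y) = normalize y" by (rule eis_normalize_cong)
    moreover have "normalize y dvd y" using eis_normalize_assoc by blast
    ultimately show ?thesis by (simp add: unit_factor_eis_def div_mult_swap)
  qed
qed

end

instantiation eis :: euclidean_ring_gcd
begin

definition gcd_eis :: "eis \<Rightarrow> eis \<Rightarrow> eis" where "gcd_eis = Euclidean_Algorithm.gcd"
definition lcm_eis :: "eis \<Rightarrow> eis \<Rightarrow> eis" where "lcm_eis = Euclidean_Algorithm.lcm"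
definition Gcd_eis :: "eis set \<Rightarrow> eis" where "Gcd_eis = Euclidean_Algorithm.Gcd"
definition Lcm_eis :: "eis set \<Rightarrow> eis" where "Lcm_eis = Euclidean_Algorithm.Lcm"

instance by standard (simp_all add: gcd_eis_def lcm_eis_def Gcd_eis_def Lcm_eis_def)

end


section \<open>Counting Eisenstein integers of given norm\<close>

lemma eis_unit_iff: "(x :: eis) dvd 1 \<longleftrightarrow> eis_norm x = 1"
proof
  assume "x dvd 1"
  then obtain y where "1 = x * y" by (rule dvdE)
  then have "eis_norm x * eis_norm y = 1" by (metis eis_norm_mult eis_norm_one)
  then show "eis_norm x = 1" using eis_norm_nonneg[of x] by (metis abs_of_nonneg zmult_eq_1_iff one_neq_neg_one abs_minus_cancel abs_one)
next
  assume "eis_norm x = 1"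
  then have "x * eis_conj x = 1" by (simp add: eis_mult_conj)
  then show "x dvd 1" by (metis dvd_triv_left)
qed

lemma eis_dvd_norm: "(x :: eis) dvd of_int (eis_norm x)"
  by (metis dvd_triv_left eis_mult_conj)

lemma eis_norm_dvd: "(x :: eis) dvd y \<Longrightarrow> eis_norm x dvd eis_norm y"
  by (auto simp: eis_norm_mult)

lemma eis_conj_dvd: "(x :: eis) dvd y \<Longrightarrow> eis_conj x dvd eis_conj y"
  by (auto simp: eis_conj_mult)

lemma eis_norm_normalize [simp]: "eis_norm (normalize x) = eis_norm x"
  by (metis associated_iff_dvd eis_norm_dvd eis_norm_nonneg normalize_idem zdvd_antisym_nonneg)

lemma eis_of_int_dvd: "(of_int n :: eis) dvd x \<longleftrightarrow> n dvd eis_a x \<and> n dvd eis_b x"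
proof
  assume "of_int n dvd x"
  then show "n dvd eis_a x \<and> n dvd eis_b x" by auto
next
  assume *: "n dvd eis_a x \<and> n dvd eis_b x"
  then obtain c d where "eis_a x = n * c" "eis_b x = n * d" by (auto elim!: dvdE)
  then have "x = of_int n * Eis c d" by (simp add: eis_eq_iff)
  then show "of_int n dvd x" by simp
qed

text \<open>
  Completing the square in either variable, \<open>4 N(x) = (2 a - b)\<^sup>2 + 3 b\<^sup>2\<close>, bounds both coordinates. A
  polynomial bound on the number of elements of given norm is all that convergence for large \<open>Re s\<close> needs.
\<close>

lemma eis_coord_bound:
  assumes "eis_norm x = int n"
  shows "\<bar>eis_a x\<bar> \<le> 2 * int n" "\<bar>eis_b x\<bar> \<le> 2 * int n"
proof -
  have sq: "\<bar>c\<bar> \<le> c\<^sup>2" for c :: int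
  proof (cases "c = 0")
    case False
    then have "\<bar>c\<bar> * 1 \<le> \<bar>c\<bar> * \<bar>c\<bar>" by (intro mult_left_mono) auto
    then show ?thesis by (simp add: power2_eq_square)
  qed auto
  have "4 * int n = (2 * eis_a x - eis_b x)\<^sup>2 + 3 * (eis_b x)\<^sup>2"
    "4 * int n = (2 * eis_b x - eis_a x)\<^sup>2 + 3 * (eis_a x)\<^sup>2"
    using assms by (simp_all add: eis_norm_def algebra_simps power2_eq_square)
  then have "3 * (eis_a x)\<^sup>2 \<le> 4 * int n" "3 * (eis_b x)\<^sup>2 \<le> 4 * int n"
    by (smt (verit) zero_le_power2)+
  then show "\<bar>eis_a x\<bar> \<le> 2 * int n" "\<bar>eis_b x\<bar> \<le> 2 * int n"
    using sq[of "eis_a x"] sq[of "eis_b x"] by linarith+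
qed

lemma eis_norm_fibre_subset:
  "{x. eis_norm x = int n} \<subseteq> case_prod Eis ` ({- 2 * int n..2 * int n} \<times> {- 2 * int n..2 * int n})"
proof
  fix x assume "x \<in> {x. eis_norm x = int n}"
  then have "\<bar>eis_a x\<bar> \<le> 2 * int n" "\<bar>eis_b x\<bar> \<le> 2 * int n"
    using eis_coord_bound[of x n] by auto
  then have "(eis_a x, eis_b x) \<in> {- 2 * int n..2 * int n} \<times> {- 2 * int n..2 * int n}" by auto
  then show "x \<in> case_prod Eis ` ({- 2 * int n..2 * int n} \<times> {- 2 * int n..2 * int n})"
    by (rule rev_image_eqI) simp
qed

lemma finite_eis_norm_fibre: "finite {x. eis_norm x = int n}"
  by (rule finite_subset[OF eis_norm_fibre_subset]) auto

text \<open>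
  Normalized elements represent the classes of associates, that is, the nonzero ideals.
\<close>

definition eis_reps :: "nat \<Rightarrow> eis set" where
  "eis_reps n = {x. normalize x = x \<and> eis_norm x = int n}"

definition eis_count :: "nat \<Rightarrow> nat" where
  "eis_count n = card (eis_reps n)"

lemma finite_eis_reps: "finite (eis_reps n)"
  by (rule finite_subset[OF _ finite_eis_norm_fibre[of n]]) (auto simp: eis_reps_def)

lemma eis_count_bound: "eis_count n \<le> (4 * n + 1)\<^sup>2"
proof -
  have "eis_reps n \<subseteq> case_prod Eis ` ({- 2 * int n..2 * int n} \<times> {- 2 * int n..2 * int n})"
    using eis_norm_fibre_subset[of n] by (auto simp: eis_reps_def)
  then have "eis_count n \<le> card (case_prod Eis ` ({- 2 * int n..2 * int n} \<times> {- 2 * int n..2 * int n}))"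
    unfolding eis_count_def by (intro card_mono) auto
  also have "\<dots> \<le> card ({- 2 * int n..2 * int n} \<times> {- 2 * int n..2 * int n})"
    by (intro card_image_le) auto
  also have "\<dots> = card {- 2 * int n..2 * int n} * card {- 2 * int n..2 * int n}"
    by (rule card_cartesian_product)
  also have "card {- 2 * int n..2 * int n} = 4 * n + 1" by simp
  also have "(4 * n + 1) * (4 * n + 1) = (4 * n + 1)\<^sup>2" by (simp only: power2_eq_square)
  finally show ?thesis .
qed

lemma eis_reps_1: "eis_reps 1 = {1}"
proof -
  have "x = 1" if "normalize x = x" "eis_norm x = 1" for x
    using that eis_unit_iff[of x] is_unit_normalize[of x] by simp
  then show ?thesis by (auto simp: eis_reps_def)
qed

lemma eis_count_1 [simp]: "eis_count 1 = 1" "eis_count (Suc 0) = 1"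
  using eis_reps_1 by (simp_all add: eis_count_def)

text \<open>
  An element of norm \<open>m n\<close> with \<open>m\<close> and \<open>n\<close> coprime is, up to a unit, uniquely a product of
  elements of norm \<open>m\<close> and \<open>n\<close>: the factors are its greatest common divisors with \<open>m\<close> and \<open>n\<close>.
\<close>

lemma eis_count_mult:
  assumes "coprime m n" "m > 0" "n > 0"
  shows "eis_count (m * n) = eis_count m * eis_count n"
proof -
  have cop: "coprime x y" if "eis_norm x dvd int m ^ j" "eis_norm y dvd int n ^ k" for x y j k
  proof (rule coprimeI)
    fix d assume d: "d dvd x" "d dvd y"
    have "eis_norm d dvd int m ^ j" "eis_norm d dvd int n ^ k"
      using d that eis_norm_dvd dvd_trans by blast+
    moreover have "coprime (int m ^ j) (int n ^ k)" using assms by simp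
    ultimately have "eis_norm d dvd 1" using coprime_common_divisor by blast
    then show "d dvd 1" using eis_unit_iff[of d] eis_norm_nonneg[of d] by simp
  qed
  have gcd1: "gcd (normalize (x * y)) (of_nat m) = x"
    if "normalize x = x" "eis_norm x = int m" "eis_norm y = int n" for x y
  proof -
    have "x dvd of_nat m" using eis_dvd_norm[of x] that by simp
    moreover have "coprime y (of_nat m)"
      using cop[of "of_nat m" 2 y 1] that by (simp add: coprime_commute)
    ultimately have "gcd (x * y) (of_nat m) = normalize x"
      by (metis gcd_mult_right_right_cancel gcd.commute gcd_mult_left_right_cancel gcd_proj1_if_dvd coprime_commute)
    then show ?thesis using that by (simp add: gcd.commute)
  qed
  have gcd2: "gcd (normalize (x * y)) (of_nat n) = y"
    if "normalize y = y" "eis_norm x = int m" "eis_norm y = int n" for x y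
  proof -
    have "y dvd of_nat n" using eis_dvd_norm[of y] that by simp
    moreover have "coprime x (of_nat n)"
      using cop[of x 1 "of_nat n" 2] that by simp
    ultimately have "gcd (x * y) (of_nat n) = normalize y"
      by (metis gcd_mult_right_left_cancel gcd.commute gcd_mult_left_left_cancel gcd_proj1_if_dvd coprime_commute)
    then show ?thesis using that by (simp add: gcd.commute)
  qed
  have surj: "\<exists>x\<in>eis_reps m. \<exists>y\<in>eis_reps n. w = normalize (x * y)" if w: "w \<in> eis_reps (m * n)" for w
  proof -
    define x y where "x = gcd w (of_nat m)" and "y = gcd w (of_nat n)"
    have nx: "eis_norm x dvd int m ^ 2" and ny: "eis_norm y dvd int n ^ 2"
      unfolding x_def y_def by (metis eis_norm_dvd eis_norm_of_nat gcd_dvd2)+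
    have "coprime x y" using cop[OF nx ny] .
    then have dvd1: "x * y dvd w" unfolding x_def y_def by (intro divides_mult) auto
    have "w dvd of_nat m * of_nat n" using w eis_dvd_norm[of w] by (simp add: eis_reps_def)
    then obtain u v where "w = u * v" "u dvd of_nat m" "v dvd of_nat n"
      using division_decomp by blast
    then have dvd2: "w dvd x * y" by (simp add: x_def y_def mult_dvd_mono)
    have eq: "w = normalize (x * y)"
      using dvd1 dvd2 w by (metis (mono_tags, lifting) associatedI eis_reps_def mem_Collect_eq)
    then have prod: "eis_norm x * eis_norm y = int m * int n"
      using w by (simp add: eis_reps_def flip: eis_norm_mult)
    have "coprime (eis_norm x) (int n)"
    proof -
      have "coprime (int m ^ 2) (int n)" using assms by simp
      then show ?thesis using nx by (meson coprime_divisors dvd_refl)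
    qed
    then have 1: "eis_norm x dvd int m" using prod by (metis coprime_dvd_mult_left_iff dvd_triv_left)
    have "coprime (eis_norm y) (int m)"
    proof -
      have "coprime (int n ^ 2) (int m)" using assms by (simp add: coprime_commute)
      then show ?thesis using ny by (meson coprime_divisors dvd_refl)
    qed
    then have 2: "eis_norm y dvd int n" using prod
      by (metis coprime_dvd_mult_right_iff dvd_triv_right)
    have le: "eis_norm x \<le> int m" "eis_norm y \<le> int n"
      using 1 2 assms zdvd_imp_le by auto
    have pos: "eis_norm x > 0" "eis_norm y > 0"
      using prod assms by (smt (verit, best) eis_norm_nonneg mult_eq_0_iff of_nat_0_less_iff)+
    have "eis_norm x = int m"
    proof (rule ccontr)
      assume "eis_norm x \<noteq> int m"
      then have "eis_norm x * eis_norm y < int m * int n" using le pos assms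
        by (intro mult_less_le_imp_less) auto
      then show False using prod by simp
    qed
    moreover from this have "eis_norm y = int n" using prod assms by simp
    moreover have "normalize x = x" "normalize y = y" unfolding x_def y_def by simp_all
    ultimately have "x \<in> eis_reps m" "y \<in> eis_reps n" by (simp_all add: eis_reps_def)
    then show ?thesis using eq by blast
  qed
  have "bij_betw (\<lambda>(x, y). normalize (x * y)) (eis_reps m \<times> eis_reps n) (eis_reps (m * n))"
  proof (rule bij_betwI')
    fix p q assume pq: "p \<in> eis_reps m \<times> eis_reps n" "q \<in> eis_reps m \<times> eis_reps n"
    obtain x y x' y' where [simp]: "p = (x, y)" "q = (x', y')" by (cases p; cases q)
    have "p = q" if "normalize (x * y) = normalize (x' * y')"
    proof -
      have *: "normalize x = x \<and> eis_norm x = int m" "normalize x' = x' \<and> eis_norm x' = int m"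
        "normalize y = y \<and> eis_norm y = int n" "normalize y' = y' \<and> eis_norm y' = int n"
        using pq by (auto simp: eis_reps_def)
      have "x = x'" using gcd1[of x y] gcd1[of x' y'] * that by metis
      moreover have "y = y'" using gcd2[of y x] gcd2[of y' x'] * that by metis
      ultimately show ?thesis by simp
    qed
    then show "(case p of (x, y) \<Rightarrow> normalize (x * y)) = (case q of (x, y) \<Rightarrow> normalize (x * y)) \<longleftrightarrow> p = q"
      by auto
  next
    fix p assume "p \<in> eis_reps m \<times> eis_reps n"
    then show "(case p of (x, y) \<Rightarrow> normalize (x * y)) \<in> eis_reps (m * n)"
      by (auto simp: eis_reps_def eis_norm_mult)
  next
    fix w assume "w \<in> eis_reps (m * n)"
    then show "\<exists>p\<in>eis_reps m \<times> eis_reps n. w = (case p of (x, y) \<Rightarrow> normalize (x * y))"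
      using surj by force
  qed
  then show ?thesis unfolding eis_count_def by (metis bij_betw_same_card card_cartesian_product)
qed

subsection \<open>Prime powers\<close>

text \<open>Division by \<open>\<pi>\<close> is a bijection from the classes of norm \<open>n m\<close> to those of norm \<open>m\<close>.\<close>

lemma eis_count_divide:
  assumes norm: "eis_norm \<pi> = int n" and n: "n > 0"
    and dvd: "\<And>x. eis_norm x = int (n * m) \<Longrightarrow> \<pi> dvd x"
  shows "eis_count (n * m) = eis_count m"
proof -
  have [simp]: "\<pi> \<noteq> 0" using norm n by auto
  have inj: "normalize (\<pi> * x) = normalize (\<pi> * y) \<longleftrightarrow> x = y"
    if "normalize x = x" "normalize y = y" for x y
  proof
    assume "normalize (\<pi> * x) = normalize (\<pi> * y)"
    then have "x dvd y" "y dvd x"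
      by (metis \<open>\<pi> \<noteq> 0\<close> associated_iff_dvd dvd_mult_cancel_left)+
    then show "x = y" using that by (metis associatedI)
  qed auto
  have "bij_betw (\<lambda>x. normalize (\<pi> * x)) (eis_reps m) (eis_reps (n * m))"
  proof (rule bij_betwI')
    fix w assume w: "w \<in> eis_reps (n * m)"
    then obtain y where y: "w = \<pi> * y" using dvd[of w] by (auto simp: eis_reps_def)
    then have "normalize y \<in> eis_reps m"
      using w norm n by (auto simp: eis_reps_def eis_norm_mult)
    moreover have "w = normalize (\<pi> * normalize y)"
      using w y by (simp add: eis_reps_def)
    ultimately show "\<exists>x\<in>eis_reps m. w = normalize (\<pi> * x)" by blast
  qed (use inj norm in \<open>auto simp: eis_reps_def eis_norm_mult\<close>)
  then show ?thesis unfolding eis_count_def by (metis bij_betw_same_card)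
qed

text \<open>
  The prime \<open>3\<close> is ramified. Modulo \<open>3\<close> the norm form is \<open>(a + b)\<^sup>2\<close>, so that \<open>1 - \<zeta>\<close> divides every element whose
  norm is divisible by \<open>3\<close>.
\<close>

lemma eis_count_power_3: "eis_count (3 ^ k) = 1"
proof (induction k)
  case (Suc k)
  have "eis_count (3 * 3 ^ k) = eis_count (3 ^ k)"
  proof (rule eis_count_divide[where \<pi> = "Eis 1 (-1)"])
    show "eis_norm (Eis 1 (- 1)) = int 3" by (simp add: eis_norm_def)
    fix x assume "eis_norm x = int (3 * 3 ^ k)"
    then have "(3::int) dvd eis_norm x" by simp
    moreover have "eis_norm x = (eis_a x + eis_b x)\<^sup>2 - 3 * (eis_a x * eis_b x)"
      by (simp add: eis_norm_def power2_eq_square algebra_simps)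
    ultimately have "3 dvd (eis_a x + eis_b x)\<^sup>2"
      by (metis diff_add_cancel dvd_add dvd_triv_left)
    then have "3 dvd eis_a x + eis_b x"
      using prime_dvd_power[of "3::int"] by simp
    then obtain c where c: "eis_a x = 3 * c - eis_b x" by (metis add_diff_cancel_right' dvdE)
    have "x = Eis 1 (-1) * Eis (2 * c - eis_b x) c"
      by (simp add: eis_eq_iff c)
    then show "Eis 1 (- 1) dvd x" by (metis dvd_triv_left)
  qed auto
  then show ?case using Suc by simp
qed simp

lemma prime_not_dvd_3:
  assumes "prime p" "p mod 3 \<noteq> 0"
  shows "\<not> int p dvd 3"
proof
  assume "int p dvd 3"
  then have "p dvd 3" by presburger
  then have "p = 3" using assms(1) by (simp add: primes_dvd_imp_eq)
  then show False using assms by auto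
qed

lemma prime_square_not_dvd: "prime (p::nat) \<Longrightarrow> \<not> p\<^sup>2 dvd p"
  by (auto dest!: dvd_imp_le simp: power2_eq_square prime_gt_0_nat dest: prime_gt_1_nat)

text \<open>
  For \<open>p \<equiv> 2 (mod 3)\<close> the exponent \<open>3\<close> is prime to \<open>p - 1\<close>, so cubing is injective on the invertible residues. With
  \<open>p - 1 = 3 m + 1\<close>, Fermat's theorem recovers \<open>a\<close> from its cube.
\<close>

lemma cube_cancel_mod:
  fixes p :: nat and a b :: int
  assumes p: "prime p" "p mod 3 = 2" and cube: "[a ^ 3 = b ^ 3] (mod int p)"
    and nz: "\<not> int p dvd a"
  shows "[a = b] (mod int p)"
proof -
  obtain m where m: "p = 3 * m + 2" using p(2) by (metis div_mod_decomp mult.commute)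
  have nzb: "\<not> int p dvd b"
  proof
    assume "int p dvd b"
    then have "int p dvd b ^ 3" by (simp add: power3_eq_cube)
    then have "int p dvd a ^ 3" using cube by (meson cong_dvd_iff)
    then show False using nz p(1) prime_dvd_power[of "int p" a 3] by simp
  qed
  have fermat: "[c ^ (3 * m + 1) = 1] (mod int p)" if "\<not> int p dvd c" for c :: int
  proof -
    have "residues_prime p" by (simp add: residues_prime_def residues_prime.intro p(1))
    have "[(nat (c mod int p)) ^ (p - 1) = 1] (mod p)"
    proof (rule fermat_theorem[OF p(1)])
      have "int p > 0" using p(1) by (simp add: prime_gt_0_nat)
      then show "\<not> p dvd nat (c mod int p)"
        using that by (metis dvd_nat_abs_iff int_dvd_int_iff nat_dvd_iff dvd_mod_iff dvd_refl int_nat_eq pos_mod_sign abs_of_nonneg)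
    qed
    then have "[int (nat (c mod int p)) ^ (p - 1) = 1] (mod int p)"
      by (metis cong_int_iff of_nat_1 of_nat_power)
    moreover have "int (nat (c mod int p)) = c mod int p"
      using p(1) by (simp add: prime_gt_0_nat)
    moreover have "p - 1 = 3 * m + 1" using m by simp
    ultimately have "[(c mod int p) ^ (3 * m + 1) = 1] (mod int p)" by (simp only:)
    then show ?thesis unfolding cong_def power_mod .
  qed
  have "[a ^ (3 * m) = b ^ (3 * m)] (mod int p)"
    using cong_pow[OF cube, of m] by (simp add: power_mult)
  then have "[a ^ (3 * m) * b = b ^ (3 * m) * b] (mod int p)" by (rule cong_scalar_right)
  also have "b ^ (3 * m) * b = b ^ (3 * m + 1)" by simp
  also have "[b ^ (3 * m + 1) = 1] (mod int p)" using fermat nzb by blast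
  also have "[1 = a ^ (3 * m + 1)] (mod int p)" using fermat nz cong_sym by blast
  finally have "[a ^ (3 * m) * b = a ^ (3 * m) * a] (mod int p)" by (simp add: mult.commute)
  moreover have "coprime (a ^ (3 * m)) (int p)"
  proof -
    have "coprime (int p) a" using nz p(1) by (simp add: prime_imp_coprime)
    then show ?thesis by (simp add: coprime_commute)
  qed
  ultimately have "[b = a] (mod int p)" by (simp add: cong_mult_lcancel)
  then show ?thesis by (rule cong_sym)
qed

text \<open>
  A prime \<open>p \<equiv> 2 (mod 3)\<close> is inert: if it divides \<open>a\<^sup>2 - a b + b\<^sup>2\<close>, it divides \<open>a\<^sup>3 + b\<^sup>3\<close>, and
  cubing is injective modulo \<open>p\<close>.
\<close>

lemma eis_inert:
  assumes p: "prime p" "p mod 3 = 2" and dvd: "int p dvd eis_norm x"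
  shows "of_nat p dvd x"
proof -
  define a b where "a = eis_a x" and "b = eis_b x"
  have N: "int p dvd a\<^sup>2 - a * b + b\<^sup>2" using dvd by (simp add: eis_norm_def a_def b_def)
  have "a ^ 3 - (- b) ^ 3 = (a + b) * (a\<^sup>2 - a * b + b\<^sup>2)"
    by (simp add: power2_eq_square power3_eq_cube algebra_simps)
  then have cube: "[a ^ 3 = (- b) ^ 3] (mod int p)"
    using N by (simp add: cong_iff_dvd_diff)
  have p3: "\<not> int p dvd 3" using prime_not_dvd_3 p by simp
  have "int p dvd a"
  proof (rule ccontr)
    assume na: "\<not> int p dvd a"
    then have "[a = - b] (mod int p)" using cube_cancel_mod[OF p cube] by blast
    then have ab: "int p dvd a + b" by (simp add: cong_iff_dvd_diff)
    have "3 * a\<^sup>2 = (a\<^sup>2 - a * b + b\<^sup>2) - (a + b) * (b - 2 * a)"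
      by (simp add: power2_eq_square algebra_simps)
    then have "int p dvd 3 * a\<^sup>2" using N ab by (metis dvd_diff dvd_mult2)
    then have "int p dvd a\<^sup>2" using p3 p(1) by (simp add: prime_dvd_mult_iff)
    then show False using na p(1) prime_dvd_power[of "int p" a 2] by simp
  qed
  moreover from this have "int p dvd b"
  proof -
    have "b\<^sup>2 = (a\<^sup>2 - a * b + b\<^sup>2) - a * (a - b)" by (simp add: power2_eq_square algebra_simps)
    then have "int p dvd b\<^sup>2" using N \<open>int p dvd a\<close> by (metis dvd_diff dvd_mult2)
    then show ?thesis using p(1) prime_dvd_power[of "int p" b 2] by simp
  qed
  ultimately have "(of_int (int p) :: eis) dvd x" by (simp add: eis_of_int_dvd a_def b_def del: of_int_of_nat_eq)
  then show ?thesis by simp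
qed

text \<open>
  An inert prime can be divided out of any element whose norm it divides, and its own norm is \<open>p\<^sup>2\<close>.
\<close>

lemma eis_count_power_inert:
  assumes p: "prime p" "p mod 3 = 2"
  shows "eis_count (p ^ k) = (if even k then 1 else 0)"
proof (induction k rule: less_induct)
  case (less k)
  consider "k = 0" | "k = 1" | j where "k = Suc (Suc j)" by (metis One_nat_def not0_implies_Suc)
  then show ?case
  proof cases
    case 2
    have "eis_reps p = {}"
    proof (rule ccontr)
      assume "eis_reps p \<noteq> {}"
      then obtain x where x: "eis_norm x = int p" by (auto simp: eis_reps_def)
      then have "of_nat p dvd x" using eis_inert[OF p] by simp
      then have "eis_norm (of_nat p) dvd eis_norm x" by (rule eis_norm_dvd)
      then have "int p ^ 2 dvd int p" using x by simp
      then have "p ^ 2 dvd p" by (metis of_nat_dvd_iff of_nat_power)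
      then show False using prime_square_not_dvd[OF p(1)] by simp
    qed
    then show ?thesis using 2 by (simp add: eis_count_def)
  next
    case (3 j)
    have "eis_count (p ^ 2 * p ^ j) = eis_count (p ^ j)"
    proof (rule eis_count_divide[where \<pi> = "of_nat p"])
      show "p\<^sup>2 > 0" using p(1) by (simp add: prime_gt_0_nat)
      fix x assume "eis_norm x = int (p\<^sup>2 * p ^ j)"
      then show "of_nat p dvd x" by (intro eis_inert[OF p]) simp
    qed simp
    then show ?thesis using less[of j] 3 by (simp add: power2_eq_square mult.assoc)
  qed simp
qed

text \<open>A primitive root raised to the power \<open>(p - 1)/3\<close> is a primitive cube root of unity modulo \<open>p\<close>.\<close>

lemma cube_root_unity_mod:
  assumes p: "prime p" "p mod 3 = 1"
  obtains c :: int where "int p dvd c\<^sup>2 + c + 1"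
proof -
  have p1: "p > 1" using p(1) prime_gt_1_nat by blast
  obtain g where g: "residue_primroot p g" using prime_primitive_root_exists[OF p1 p(1)] by blast
  define m where "m = p div 3"
  have m: "p - 1 = 3 * m" unfolding m_def using p(2) by presburger
  have ord: "ord p g = p - 1" using g p(1) by (simp add: residue_primroot_def totient_prime)
  have cop: "coprime p g" using g by (simp add: residue_primroot_def)
  have m0: "m > 0" using m p1 by (cases m) auto
  define c where "c = int (g ^ m)"
  have "[g ^ (3 * m) = 1] (mod p)" using ord ord[symmetric] m by (metis ord_works)
  then have "[c ^ 3 = 1] (mod int p)"
    unfolding c_def by (metis cong_int_iff of_nat_1 of_nat_power power_mult mult.commute)
  then have "int p dvd c ^ 3 - 1" by (simp add: cong_iff_dvd_diff)
  also have "c ^ 3 - 1 = (c - 1) * (c\<^sup>2 + c + 1)"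
    by (simp add: power2_eq_square power3_eq_cube algebra_simps)
  finally have "int p dvd c - 1 \<or> int p dvd c\<^sup>2 + c + 1"
    using p(1) by (simp add: prime_dvd_mult_iff)
  moreover have "\<not> int p dvd c - 1"
  proof
    assume "int p dvd c - 1"
    then have "[c = 1] (mod int p)" by (simp add: cong_iff_dvd_diff)
    then have "[g ^ m = 1] (mod p)" unfolding c_def by (metis cong_int_iff of_nat_1)
    then have "ord p g dvd m" using ord_divides by blast
    then show False using ord m m0 by (auto dest!: dvd_imp_le)
  qed
  ultimately show ?thesis using that by blast
qed

text \<open>
  If \<open>p\<close> divides \<open>c\<^sup>2 + c + 1 = (c - \<zeta>) (c - \<zeta>\<^sup>2)\<close>, it divides neither factor. Hence the greatest common
  divisor of \<open>p\<close> and \<open>c - \<zeta>\<close> is a proper divisor of \<open>p\<close> and not a unit, which leaves only the norm \<open>p\<close>.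
\<close>

lemma eis_split:
  assumes p: "prime p" "p mod 3 = 1"
  obtains \<pi> where "eis_norm \<pi> = int p"
proof -
  obtain c where c: "int p dvd c\<^sup>2 + c + 1" using cube_root_unity_mod[OF p] .
  define x where "x = Eis c (- 1)"
  have nx: "eis_norm x = c\<^sup>2 + c + 1" by (simp add: x_def eis_norm_def)
  define \<pi> where "\<pi> = gcd x (of_nat p)"
  have "eis_norm \<pi> dvd int p ^ 2" unfolding \<pi>_def by (metis eis_norm_dvd eis_norm_of_nat gcd_dvd2)
  then obtain i where i: "i \<le> 2" "eis_norm \<pi> = int p ^ i"
  proof -
    have "nat (eis_norm \<pi>) dvd p ^ 2" using \<open>eis_norm \<pi> dvd int p ^ 2\<close>
      by (metis nat_dvd_iff of_nat_power int_nat_eq eis_norm_nonneg int_dvd_int_iff)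
    then obtain i where "i \<le> 2" "nat (eis_norm \<pi>) = p ^ i" using divides_primepow_nat[OF p(1)] by blast
    then show ?thesis using that by (metis eis_norm_nonneg int_nat_eq of_nat_power)
  qed
  have ndvd: "\<not> of_nat p dvd x" 
  proof
    assume "of_nat p dvd x"
    then have "(of_int (int p) :: eis) dvd x" by simp
    then have "int p dvd 1" by (simp only: eis_of_int_dvd) (simp add: x_def)
    then show False using p(1) prime_gt_1_nat[of p] by simp
  qed
  have "i \<noteq> 0"
  proof
    assume "i = 0"
    then have "coprime x (of_nat p)"
      using i eis_unit_iff[of \<pi>] by (simp add: \<pi>_def coprime_iff_gcd_eq_1 is_unit_gcd)
    moreover have "of_nat p dvd x * eis_conj x"
    proof -
      have "(of_int (int p) :: eis) dvd of_int (c\<^sup>2 + c + 1)" using c by (simp only: eis_of_int_dvd eis_of_int) simp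
      then show ?thesis by (simp only: eis_mult_conj nx of_int_of_nat_eq)
    qed
    ultimately have "of_nat p dvd eis_conj x"
      by (metis coprime_commute coprime_dvd_mult_right_iff)
    then have "eis_conj (of_nat p) dvd x" using eis_conj_dvd by fastforce
    moreover have "eis_conj (of_nat p) = of_nat p" by (simp add: eis_eq_iff)
    ultimately show False using ndvd by simp
  qed
  moreover have "i \<noteq> 2"
  proof
    assume "i = 2"
    obtain y where y: "of_nat p = \<pi> * y" unfolding \<pi>_def by (meson dvdE gcd_dvd2)
    then have "int p ^ 2 = int p ^ 2 * eis_norm y" using i \<open>i = 2\<close>
      by (metis eis_norm_mult eis_norm_of_nat)
    then have "eis_norm y = 1" using p(1) by (simp add: prime_gt_0_nat)
    then have "y dvd 1" by (simp add: eis_unit_iff)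
    then have "of_nat p dvd \<pi>" using y by simp
    then show False using ndvd unfolding \<pi>_def by simp
  qed
  ultimately have "i = 1" using i by linarith
  then show ?thesis using i that by simp
qed

lemma eis_prime_norm_prime:
  assumes "prime p" "eis_norm \<pi> = int p"
  shows "prime_elem \<pi>"
proof (rule irreducible_imp_prime_elem)
  show "irreducible \<pi>"
  proof (rule irreducibleI)
    show "\<pi> \<noteq> 0" using assms by (auto simp: prime_gt_0_nat)
    show "\<not> \<pi> dvd 1" using assms by (auto simp: eis_unit_iff)
    fix x y assume "\<pi> = x * y"
    then have "int p = eis_norm x * eis_norm y" using assms by (simp add: eis_norm_mult)
    moreover have "prime (int p)" using assms by simp
    ultimately have "eis_norm x = 1 \<or> eis_norm y = 1"
      by (metis eis_norm_nonneg prime_int_iff dvd_triv_left mult_cancel_left1 mult.right_neutral of_nat_0_eq_iff assms(1) not_prime_0)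
    then show "x dvd 1 \<or> y dvd 1" by (simp add: eis_unit_iff)
  qed
qed

text \<open>
  The two primes above \<open>p\<close> are not associated; hence the elements of norm \<open>p\<^sup>k\<close> are, up to units, the
  \<open>\<pi>\<^sup>i \<pi>'\<^sup>k\<^sup>-\<^sup>i\<close>.
\<close>

lemma eis_count_power_split:
  assumes p: "prime p" "p mod 3 = 1"
  shows "eis_count (p ^ k) = k + 1"
proof -
  obtain \<pi> where n\<pi>: "eis_norm \<pi> = int p" using eis_split[OF p] .
  define \<rho> where "\<rho> = eis_conj \<pi>"
  have n\<rho>: "eis_norm \<rho> = int p" by (simp add: \<rho>_def n\<pi>)
  have p\<pi>: "prime_elem \<pi>" and p\<rho>: "prime_elem \<rho>"
    using eis_prime_norm_prime p(1) n\<pi> n\<rho> by blast+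
  have [simp]: "\<pi> \<noteq> 0" "\<rho> \<noteq> 0" using p\<pi> p\<rho> by auto
  have \<pi>\<rho>: "\<pi> * \<rho> = of_nat p" using eis_mult_conj[of \<pi>] by (simp add: \<rho>_def n\<pi>)
  have ndvd: "\<not> \<pi> dvd \<rho>"
  proof
    assume "\<pi> dvd \<rho>"
    then have "\<pi> dvd \<pi> + \<rho>" by simp
    also have "\<pi> + \<rho> = of_int (2 * eis_a \<pi> - eis_b \<pi>)" by (simp add: \<rho>_def eis_eq_iff)
    finally have "int p dvd (2 * eis_a \<pi> - eis_b \<pi>)\<^sup>2"
      by (metis eis_norm_dvd eis_norm_of_int n\<pi>)
    then have 1: "int p dvd 2 * eis_a \<pi> - eis_b \<pi>"
      using p(1) prime_dvd_power by (metis prime_nat_int_transfer)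
    have four: "4 * int p = (2 * eis_a \<pi> - eis_b \<pi>)\<^sup>2 + 3 * (eis_b \<pi>)\<^sup>2"
      using eis_norm_four[of \<pi>] n\<pi> by simp
    have "int p dvd 3 * (eis_b \<pi>)\<^sup>2"
      using four \<open>int p dvd (2 * eis_a \<pi> - eis_b \<pi>)\<^sup>2\<close>
      by (metis dvd_add_right_iff dvd_triv_right)
    moreover have "\<not> int p dvd 3" using prime_not_dvd_3 p by simp
    ultimately have "int p dvd eis_b \<pi>"
      using p(1) by (metis prime_dvd_mult_iff prime_dvd_power prime_nat_int_transfer)
    moreover from this have "int p dvd eis_a \<pi>"
    proof -
      have "eis_norm \<pi> = eis_a \<pi> * eis_a \<pi> + eis_b \<pi> * (eis_b \<pi> - eis_a \<pi>)"
        by (simp add: eis_norm_def power2_eq_square algebra_simps)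
      then have "int p dvd eis_a \<pi> * eis_a \<pi>"
        using n\<pi> \<open>int p dvd eis_b \<pi>\<close> by (metis dvd_add_left_iff dvd_mult2 dvd_refl)
      then show ?thesis using p(1) by (metis prime_dvd_mult_iff prime_nat_int_transfer)
    qed
    ultimately have "(of_int (int p) :: eis) dvd \<pi>" by (simp only: eis_of_int_dvd)
    then have "int p ^ 2 dvd int p" using eis_norm_dvd n\<pi> by (metis eis_norm_of_int)
    then have "p ^ 2 dvd p" by (metis of_nat_dvd_iff of_nat_power)
    then show False using prime_square_not_dvd[OF p(1)] by simp
  qed
  define f where "f k i = normalize (\<pi> ^ i * \<rho> ^ (k - i))" for k i
  have surj: "\<exists>i\<le>k. normalize x = f k i" if "eis_norm x = int p ^ k" for x k
    using that
  proof (induction k arbitrary: x)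
    case 0
    then have "x dvd 1" by (simp add: eis_unit_iff)
    then show ?case by (intro exI[of _ 0]) (simp add: f_def is_unit_normalize)
  next
    case (Suc k)
    have "\<pi> dvd of_int (eis_norm x)" using Suc.prems eis_dvd_norm[of \<pi>] n\<pi> by (simp add: dvd_mult2)
    then have "\<pi> dvd x * eis_conj x" by (simp add: eis_mult_conj)
    then consider "\<pi> dvd x" | "\<pi> dvd eis_conj x" using p\<pi> by (auto simp: prime_elem_dvd_mult_iff)
    then show ?case
    proof cases
      case 1
      then obtain y where y: "x = \<pi> * y" by (rule dvdE)
      then have "eis_norm y = int p ^ k" using Suc.prems n\<pi> p(1) by (simp add: eis_norm_mult)
      then obtain i where i: "i \<le> k" "normalize y = f k i" using Suc.IH by blast
      have "normalize x = normalize (\<pi> * normalize y)" by (simp add: y)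
      also have "\<dots> = f (Suc k) (Suc i)" using i by (simp add: f_def mult.assoc)
      finally show ?thesis using i by (intro exI[of _ "Suc i"]) auto
    next
      case 2
      then have "\<rho> dvd x" using eis_conj_dvd unfolding \<rho>_def by fastforce
      then obtain y where y: "x = \<rho> * y" by (rule dvdE)
      then have "eis_norm y = int p ^ k" using Suc.prems n\<rho> p(1) by (simp add: eis_norm_mult)
      then obtain i where i: "i \<le> k" "normalize y = f k i" using Suc.IH by blast
      have "normalize x = normalize (\<rho> * normalize y)" by (simp add: y)
      also have "\<dots> = f (Suc k) i" using i by (simp add: f_def Suc_diff_le ac_simps)
      finally show ?thesis using i by (intro exI[of _ i]) auto
    qed
  qed
  have lt: False if "i < j" "j \<le> k" "f k i = f k j" for i j
  proof -
    have "\<pi> ^ j * \<rho> ^ (k - j) dvd \<pi> ^ i * \<rho> ^ (k - i)"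
      using that unfolding f_def by (metis associatedD2 dvd_refl)
    then have "\<pi> ^ (i + (j - i)) dvd \<pi> ^ i * \<rho> ^ (k - i)" using that
      by (metis dvd_mult_left le_add_diff_inverse less_imp_le)
    then have "\<pi> ^ (j - i) dvd \<rho> ^ (k - i)" by (simp add: power_add)
    moreover have "\<pi> dvd \<pi> ^ (j - i)" using that by (simp add: dvd_power)
    ultimately have "\<pi> dvd \<rho> ^ (k - i)" by (rule dvd_trans[rotated])
    then show False using ndvd p\<pi> by (meson prime_elem_dvd_power)
  qed
  have "bij_betw (f k) {..k} (eis_reps (p ^ k))"
  proof (rule bij_betwI')
    fix i j assume "i \<in> {..k}" "j \<in> {..k}"
    then show "f k i = f k j \<longleftrightarrow> i = j" using lt[of i j] lt[of j i] by (metis atMost_iff linorder_less_linear)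
  next
    fix i assume "i \<in> {..k}"
    have pw: "eis_norm (x ^ m) = eis_norm x ^ m" for x m by (induction m) (auto simp: eis_norm_mult)
    show "f k i \<in> eis_reps (p ^ k)" using \<open>i \<in> {..k}\<close>
      by (simp add: eis_reps_def f_def eis_norm_mult pw n\<pi> n\<rho> flip: power_add)
  next
    fix w assume "w \<in> eis_reps (p ^ k)"
    then show "\<exists>i\<in>{..k}. w = f k i" using surj[of w k] by (auto simp: eis_reps_def)
  qed
  then show ?thesis unfolding eis_count_def by (metis bij_betw_same_card card_atMost Suc_eq_plus1)
qed

subsection \<open>Primary elements\<close>

text \<open>
  The six units represent the six invertible residues modulo \<open>3\<close>, so that each element of norm prime to \<open>3\<close>
  has exactly one associate congruent to \<open>1\<close> modulo \<open>3\<close>.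
\<close>

definition eis_primary :: "eis \<Rightarrow> bool" where
  "eis_primary x \<longleftrightarrow> eis_a x mod 3 = 1 \<and> eis_b x mod 3 = 0"

lemma eis_unit_cases:
  assumes "eis_norm u = 1"
  shows "u \<in> {Eis 1 0, Eis (-1) 0, Eis 0 1, Eis 0 (-1), Eis 1 1, Eis (-1) (-1)}"
proof -
  have "4 * 1 = (2 * eis_a u - eis_b u)\<^sup>2 + 3 * (eis_b u)\<^sup>2"
    "4 * 1 = (2 * eis_b u - eis_a u)\<^sup>2 + 3 * (eis_a u)\<^sup>2"
    using assms by (simp_all add: eis_norm_def algebra_simps power2_eq_square)
  then have "(eis_a u)\<^sup>2 \<le> 1" "(eis_b u)\<^sup>2 \<le> 1" by (smt (verit) zero_le_power2)+
  then have "\<bar>eis_a u\<bar> \<le> 1" "\<bar>eis_b u\<bar> \<le> 1" by (simp_all add: abs_square_le_1)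
  then have "eis_a u \<in> {-1, 0, 1}" "eis_b u \<in> {-1, 0, 1}" by auto
  then show ?thesis using assms by (auto simp: eis_eq_iff eis_norm_def)
qed

lemma eis_primary_unique:
  assumes "eis_primary x" "eis_primary (u * x)" "eis_norm u = 1"
  shows "u = 1"
proof -
  show ?thesis using eis_unit_cases[OF assms(3)] assms(1,2)
    by (auto simp: eis_primary_def one_eis_def) presburger+
qed

lemma eis_primary_exists:
  assumes "\<not> 3 dvd eis_norm x"
  shows "\<exists>u. eis_norm u = 1 \<and> eis_primary (u * x)"
proof -
  define a b where "a = eis_a x" and "b = eis_b x"
  have "eis_norm x = (a + b)\<^sup>2 - 3 * (a * b)"
    by (simp add: eis_norm_def power2_eq_square algebra_simps a_def b_def)
  then have "\<not> 3 dvd a + b" using assms by (auto simp: power2_eq_square)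
  then have "(a mod 3 = 1 \<and> b mod 3 = 0) \<or> (a mod 3 = 2 \<and> b mod 3 = 0) \<or> (a mod 3 = 0 \<and> b mod 3 = 1) \<or>
     (a mod 3 = 0 \<and> b mod 3 = 2) \<or> (a mod 3 = 1 \<and> b mod 3 = 1) \<or> (a mod 3 = 2 \<and> b mod 3 = 2)"
    by presburger
  moreover have "eis_primary (Eis 1 0 * x)" if "a mod 3 = 1 \<and> b mod 3 = 0"
    using that by (simp add: eis_primary_def a_def b_def)
  moreover have "eis_primary (Eis (-1) 0 * x)" if "a mod 3 = 2 \<and> b mod 3 = 0"
    using that unfolding eis_primary_def eis_sel eis.sel a_def[symmetric] b_def[symmetric] by presburger
  moreover have "eis_primary (Eis (-1) (-1) * x)" if "a mod 3 = 0 \<and> b mod 3 = 1"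
    using that unfolding eis_primary_def eis_sel eis.sel a_def[symmetric] b_def[symmetric] by presburger
  moreover have "eis_primary (Eis 1 1 * x)" if "a mod 3 = 0 \<and> b mod 3 = 2"
    using that unfolding eis_primary_def eis_sel eis.sel a_def[symmetric] b_def[symmetric] by presburger
  moreover have "eis_primary (Eis 0 (-1) * x)" if "a mod 3 = 1 \<and> b mod 3 = 1"
    using that unfolding eis_primary_def eis_sel eis.sel a_def[symmetric] b_def[symmetric] by presburger
  moreover have "eis_primary (Eis 0 1 * x)" if "a mod 3 = 2 \<and> b mod 3 = 2"
    using that unfolding eis_primary_def eis_sel eis.sel a_def[symmetric] b_def[symmetric] by presburger
  moreover have "eis_norm (Eis 1 0) = 1" "eis_norm (Eis (-1) 0) = 1" "eis_norm (Eis (-1) (-1)) = 1"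
    "eis_norm (Eis 1 1) = 1" "eis_norm (Eis 0 (-1)) = 1" "eis_norm (Eis 0 1) = 1"
    by (simp_all add: eis_norm_def)
  ultimately show ?thesis by (elim disjE) blast+
qed

text \<open>
  Thus the primary elements of norm \<open>n\<close> are another set of representatives of the ideals of norm \<open>n\<close>.
\<close>

lemma bij_betw_normalize_primary:
  assumes "\<not> 3 dvd n"
  shows "bij_betw normalize {x. eis_primary x \<and> eis_norm x = int n} (eis_reps n)"
proof (rule bij_betwI')
  fix x y assume x: "x \<in> {x. eis_primary x \<and> eis_norm x = int n}"
    and y: "y \<in> {x. eis_primary x \<and> eis_norm x = int n}"
  show "normalize x = normalize y \<longleftrightarrow> x = y"
  proof
    assume "normalize x = normalize y"
    then obtain u where u: "u dvd 1" "x = u * y" by (metis associated_iff_dvd mult.commute associatedE1)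
    then have "u = 1" using x y eis_primary_unique[of y u] by (auto simp: eis_unit_iff)
    then show "x = y" using u by simp
  qed auto
next
  fix x assume "x \<in> {x. eis_primary x \<and> eis_norm x = int n}"
  then show "normalize x \<in> eis_reps n" by (auto simp: eis_reps_def)
next
  fix w assume w: "w \<in> eis_reps n"
  then have "\<not> 3 dvd eis_norm w" using assms by (auto simp: eis_reps_def) presburger
  then obtain u where u: "eis_norm u = 1" "eis_primary (u * w)" using eis_primary_exists by blast
  then have "u dvd 1" by (simp add: eis_unit_iff)
  then have "normalize (u * w) = normalize w" by (simp add: normalize_mult_unit_left)
  then show "\<exists>x\<in>{x. eis_primary x \<and> eis_norm x = int n}. w = normalize x"
    using u w by (intro bexI[of _ "u * w"]) (auto simp: eis_reps_def eis_norm_mult)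
qed


section \<open>The Eisenstein integers as the ring of integers of \<open>E\<close>\<close>

lemma zeta3_eq: "zeta3 = Complex (- 1 / 2) (sqrt 3 / 2)"
  by (simp add: zeta3_def complex_eq_iff cos_120 sin_120)

lemma zeta3_square: "zeta3 * zeta3 = - 1 - zeta3"
  by (simp add: zeta3_eq complex_eq_iff)

lemma cnj_zeta3: "cnj zeta3 = - 1 - zeta3"
  by (simp add: zeta3_eq complex_eq_iff)

definition ec :: "eis \<Rightarrow> complex" where
  "ec x = of_int (eis_a x) + of_int (eis_b x) * zeta3"

lemma ec_simps [simp]:
  "ec 0 = 0" "ec 1 = 1" "ec (x + y) = ec x + ec y" "ec (- x) = - ec x" "ec (x - y) = ec x - ec y"
  by (simp_all add: ec_def algebra_simps)

lemma ec_mult [simp]: "ec (x * y) = ec x * ec y"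
proof -
  have "ec x * ec y = of_int (eis_a x) * of_int (eis_a y) + of_int (eis_b x) * of_int (eis_b y) * (zeta3 * zeta3)
     + (of_int (eis_a x) * of_int (eis_b y) + of_int (eis_b x) * of_int (eis_a y)) * zeta3"
    by (simp add: ec_def algebra_simps)
  then show ?thesis by (simp add: ec_def zeta3_square algebra_simps)
qed

lemma ec_power [simp]: "ec (x ^ n) = ec x ^ n"
  by (induction n) auto

lemma ec_of_int [simp]: "ec (of_int n) = of_int n"
  by (simp add: ec_def)

lemma ec_of_nat [simp]: "ec (of_nat n) = of_nat n"
  by (simp add: ec_def)

lemma ec_sum: "ec (sum f A) = (\<Sum>i\<in>A. ec (f i))"
  by (induction A rule: infinite_finite_induct) auto

lemma ec_inj_iff [simp]: "ec x = ec y \<longleftrightarrow> x = y"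
proof
  assume *: "ec x = ec y"
  have "Im (ec x) = of_int (eis_b x) * (sqrt 3 / 2)" "Im (ec y) = of_int (eis_b y) * (sqrt 3 / 2)"
    by (simp_all add: ec_def zeta3_eq)
  then have b: "eis_b x = eis_b y" using * by simp
  then show "x = y" using * by (simp add: ec_def eis_eq_iff)
qed auto

lemma inj_ec: "inj ec" by (rule injI) simp

lemma ec_eq_0_iff [simp]: "ec x = 0 \<longleftrightarrow> x = 0"
  using ec_inj_iff[of x 0] by simp

lemma ec_conj: "ec (eis_conj x) = cnj (ec x)"
  by (simp add: ec_def cnj_zeta3 algebra_simps)

lemma cmod_ec: "(cmod (ec x))\<^sup>2 = of_int (eis_norm x)"
proof -
  have "complex_of_real ((cmod (ec x))\<^sup>2) = ec (x * eis_conj x)"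
    by (simp only: complex_norm_square ec_mult ec_conj)
  also have "\<dots> = of_real (of_int (eis_norm x))"
    by (simp only: eis_mult_conj ec_of_int of_real_of_int_eq)
  finally show ?thesis by (simp only: of_real_eq_iff)
qed

lemma ec_in_E: "ec x \<in> E"
  unfolding E_def mem_Collect_eq
  by (rule exI[of _ "of_int (eis_a x)"], rule exI[of _ "of_int (eis_b x)"]) (simp add: ec_def)

lemma E_cases:
  assumes "x \<in> E"
  obtains u v where "v \<noteq> 0" "x = ec u / ec v"
proof -
  obtain r s where x: "x = of_rat r + of_rat s * zeta3" using assms by (auto simp: E_def)
  obtain a b where r: "r = Rat.Fract a b" "b > 0" by (cases r) auto
  obtain c d where s: "s = Rat.Fract c d" "d > 0" by (cases s) auto
  have "of_rat r = (of_int a / of_int b :: complex)" "of_rat s = (of_int c / of_int d :: complex)"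
    using r s by (simp_all add: Fract_of_int_quotient of_rat_divide)
  then have "x = ec (Eis (a * d) (c * b)) / ec (of_int (b * d))"
    using r s by (simp add: x ec_def field_simps)
  moreover have "(of_int (b * d) :: eis) \<noteq> 0" using r s by (simp add: eis_eq_iff)
  ultimately show ?thesis using that by blast
qed

lemma quotient_in_E: "ec u / ec v \<in> E"
proof (cases "v = 0")
  case False
  define n where "n = eis_norm v"
  have n: "n \<noteq> 0" using False by (simp add: n_def)
  have "ec v * ec (eis_conj v) = of_int n" by (metis ec_mult ec_of_int eis_mult_conj n_def)
  then have "ec u / ec v = ec (u * eis_conj v) / of_int n"
    using False n by (simp add: field_simps)
  also have "\<dots> = of_rat (of_int (eis_a (u * eis_conj v)) / of_int n) + of_rat (of_int (eis_b (u * eis_conj v)) / of_int n) * zeta3"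
    by (simp add: ec_def of_rat_divide add_divide_distrib del: eis_sel)
  finally show ?thesis unfolding E_def by blast
qed (use ec_in_E[of 0] in simp)

text \<open>
  The inclusion of the algebraic integers of \<open>E\<close> in \<open>\<int>[\<zeta>]\<close> is the rational root argument: a reduced denominator
  divides a power of the numerator.
\<close>

lemma carrier_ring_of_integers_E: "carrier (ring_of_integers E) = range ec"
proof
  show "range ec \<subseteq> carrier (ring_of_integers E)"
  proof
    fix z assume "z \<in> range ec"
    then obtain x where z: "z = ec x" by auto
    define p :: "complex poly" where "p = [:of_int (eis_norm x), - of_int (2 * eis_a x - eis_b x), 1:]"
    have "x * x - of_int (2 * eis_a x - eis_b x) * x + of_int (eis_norm x) = 0"
      by (simp add: eis_eq_iff eis_norm_def power2_eq_square algebra_simps)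
    then have "ec (x * x - of_int (2 * eis_a x - eis_b x) * x + of_int (eis_norm x)) = ec 0" by (simp only:)
    then have "ec x * ec x - of_int (2 * eis_a x - eis_b x) * ec x + of_int (eis_norm x) = 0"
      by (simp only: ec_simps ec_mult ec_of_int)
    then have "poly p z = 0" by (simp add: p_def z algebra_simps)
    moreover have "lead_coeff p = 1" by (simp add: p_def)
    moreover have "\<forall>i. Polynomial.coeff p i \<in> \<int>" by (simp add: p_def coeff_pCons split: nat.split)
    ultimately have "algebraic_int z" by (intro algebraic_int.intros)
    then show "z \<in> carrier (ring_of_integers E)" using z ec_in_E by (simp add: ring_of_integers_def)
  qed
  show "carrier (ring_of_integers E) \<subseteq> range ec"
  proof
    fix z assume "z \<in> carrier (ring_of_integers E)"
    then have z: "z \<in> E" "algebraic_int z" by (auto simp: ring_of_integers_def)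
    obtain u0 v0 where uv0: "v0 \<noteq> 0" "z = ec u0 / ec v0" using z(1) by (rule E_cases)
    define g where "g = gcd u0 v0"
    have g: "g \<noteq> 0" using uv0 by (simp add: g_def)
    obtain u v where uv: "u0 = g * u" "v0 = g * v" "coprime u v"
    proof -
      have "u0 = g * (u0 div g)" "v0 = g * (v0 div g)" "coprime (u0 div g) (v0 div g)"
        using uv0 div_gcd_coprime[of u0 v0] by (auto simp: g_def)
      then show ?thesis using that by blast
    qed
    have v: "v \<noteq> 0" and zuv: "z * ec v = ec u" using uv uv0 g by (auto simp: field_simps)
    obtain p where p: "poly (map_poly of_int p) z = 0" "lead_coeff p = 1"
      using z(2) by (auto simp: algebraic_int_altdef_ipoly)
    define n where "n = degree p"
    have n0: "n \<noteq> 0"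
    proof
      assume "n = 0"
      then have "p = [:1:]" using p(2) unfolding n_def by (metis degree_0_id lead_coeff_pCons(2) degree_eq_zeroE pCons_0_0 coeff_pCons_0)
      then show False using p(1) by (simp add: map_poly_pCons one_pCons)
    qed
    have "(\<Sum>i\<le>n. of_int (Polynomial.coeff p i) * z ^ i) = 0"
      using p(1) by (simp add: poly_altdef n_def coeff_map_poly degree_map_poly)
    then have "(\<Sum>i\<le>n. of_int (Polynomial.coeff p i) * z ^ i) * ec v ^ n = 0" by simp
    also have "(\<Sum>i\<le>n. of_int (Polynomial.coeff p i) * z ^ i) * ec v ^ n = (\<Sum>i\<le>n. ec (of_int (Polynomial.coeff p i) * u ^ i * v ^ (n - i)))"
      unfolding sum_distrib_right
    proof (intro sum.cong refl)
      fix i assume "i \<in> {..n}"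
      then have "ec v ^ n = ec v ^ i * ec v ^ (n - i)" by (simp flip: power_add)
      then have "of_int (Polynomial.coeff p i) * z ^ i * ec v ^ n = of_int (Polynomial.coeff p i) * (z * ec v) ^ i * ec v ^ (n - i)"
        by (simp add: power_mult_distrib)
      then show "of_int (Polynomial.coeff p i) * z ^ i * ec v ^ n = ec (of_int (Polynomial.coeff p i) * u ^ i * v ^ (n - i))"
        by (simp add: zuv)
    qed
    finally have "(\<Sum>i\<le>n. of_int (Polynomial.coeff p i) * u ^ i * v ^ (n - i)) = 0"
      by (simp only: ec_sum[symmetric] ec_eq_0_iff)
    moreover define S where "S = (\<Sum>i<n. of_int (Polynomial.coeff p i) * u ^ i * v ^ (n - i))"
    moreover have "(\<Sum>i\<le>n. of_int (Polynomial.coeff p i) * u ^ i * v ^ (n - i)) = u ^ n + S"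
      using p(2) by (simp add: lessThan_Suc_atMost[symmetric] n_def S_def)
    ultimately have "u ^ n = - S" by (simp add: eq_neg_iff_add_eq_0)
    moreover have "v dvd S"
      unfolding S_def by (intro dvd_sum dvd_mult) (simp add: dvd_power)
    ultimately have "v dvd u ^ n" by simp
    moreover have "coprime (u ^ n) v" using uv(3) by simp
    ultimately have "v dvd 1" by (metis coprime_absorb_right is_unit_gcd_iff gcd.commute coprime_common_divisor dvd_refl)
    then obtain w where "1 = v * w" by (rule dvdE)
    then have "z = ec (u * w)" using zuv by (metis ec_mult ec_simps(2) mult.assoc mult.right_neutral)
    then show "z \<in> range ec" by blast
  qed
qed

lemma ring_of_integers_sel [simp]:
  "mult (ring_of_integers K) = (*)" "one (ring_of_integers K) = 1"
  "add (ring_of_integers K) = (+)" "zero (ring_of_integers K) = 0"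
  by (simp_all add: ring_of_integers_def)

lemma ec_range_closed [simp]:
  "ec x \<in> range ec" "0 \<in> range ec" "1 \<in> range ec" "- ec x \<in> range ec"
  "ec x + ec y \<in> range ec" "ec x * ec y \<in> range ec"
  using rangeI[of ec 0] rangeI[of ec 1] rangeI[of ec "- x"] rangeI[of ec "x + y"] rangeI[of ec "x * y"]
  by auto

lemma cring_ring_of_integers_E: "cring (ring_of_integers E)"
proof (rule cringI)
  show "abelian_group (ring_of_integers E)"
  proof (rule abelian_groupI)
    fix x assume "x \<in> carrier (ring_of_integers E)"
    then obtain y where "x = ec y" unfolding carrier_ring_of_integers_E by auto
    then show "\<exists>y\<in>carrier (ring_of_integers E). y \<oplus>\<^bsub>ring_of_integers E\<^esub> x = \<zero>\<^bsub>ring_of_integers E\<^esub>"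
      by (intro bexI[of _ "- x"]) (auto simp: carrier_ring_of_integers_E)
  qed (auto simp: carrier_ring_of_integers_E)
  show "comm_monoid (ring_of_integers E)"
    by (rule comm_monoidI) (auto simp: carrier_ring_of_integers_E)
qed (auto simp: algebra_simps)

subsection \<open>Ideals\<close>

text \<open>
  Principal ideals of \<open>\<int>[\<zeta>]\<close>, as sets of complex numbers.
\<close>

definition pid :: "eis \<Rightarrow> complex set" where
  "pid g = ec ` {x. g dvd x}"

lemma ec_in_pid [simp]: "ec x \<in> pid g \<longleftrightarrow> g dvd x"
  by (auto simp: pid_def)

lemma pid_cong: "pid g = pid h \<longleftrightarrow> g dvd h \<and> h dvd g"
proof
  assume "pid g = pid h"
  then show "g dvd h \<and> h dvd g" by (metis dvd_refl ec_in_pid)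
next
  assume "g dvd h \<and> h dvd g"
  then have "{x. g dvd x} = {x. h dvd x}" using dvd_trans by blast
  then show "pid g = pid h" by (simp add: pid_def)
qed

lemma pid_normalize [simp]: "pid (normalize g) = pid g"
  by (simp add: pid_cong)

lemma pid_eq_zero_iff: "pid g = {0} \<longleftrightarrow> g = 0"
proof -
  have "pid 0 = {0}" by (auto simp: pid_def)
  then show ?thesis using pid_cong[of g 0] by auto
qed

lemma ideal_pid: "ideal (pid g) (ring_of_integers E)"
proof (rule idealI)
  interpret cring "ring_of_integers E" by (rule cring_ring_of_integers_E)
  show "ring (ring_of_integers E)" by (rule ring_axioms)
  show "subgroup (pid g) (add_monoid (ring_of_integers E))"
  proof (rule add.subgroupI)
    show "pid g \<subseteq> carrier (ring_of_integers E)" by (auto simp: pid_def carrier_ring_of_integers_E)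
    show "pid g \<noteq> {}" using ec_in_pid[of 0 g] by auto
    fix a assume "a \<in> pid g"
    then obtain x where x: "a = ec x" "g dvd x" by (auto simp: pid_def)
    have "\<ominus>\<^bsub>ring_of_integers E\<^esub> a = ec (- x)"
      by (rule minus_equality) (auto simp: x carrier_ring_of_integers_E)
    then show "\<ominus>\<^bsub>ring_of_integers E\<^esub> a \<in> pid g" using x by (simp del: ec_simps)
  next
    fix a b assume "a \<in> pid g" "b \<in> pid g"
    then obtain x y where "a = ec x" "g dvd x" "b = ec y" "g dvd y" by (auto simp: pid_def)
    then show "a \<oplus>\<^bsub>ring_of_integers E\<^esub> b \<in> pid g" using ec_in_pid[of "x + y" g] by simp
  qed
next
  fix a x assume "a \<in> pid g" "x \<in> carrier (ring_of_integers E)"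
  then obtain b y where *: "a = ec b" "g dvd b" "x = ec y" by (auto simp: pid_def carrier_ring_of_integers_E)
  show "x \<otimes>\<^bsub>ring_of_integers E\<^esub> a \<in> pid g" using * ec_in_pid[of "y * b" g] by simp
  show "a \<otimes>\<^bsub>ring_of_integers E\<^esub> x \<in> pid g" using * ec_in_pid[of "b * y" g] by simp
qed

text \<open>
  By division with remainder, a nonzero element of least norm generates the ideal.
\<close>

lemma ideal_imp_pid:
  assumes "ideal I (ring_of_integers E)"
  shows "\<exists>g. I = pid g"
proof -
  interpret ideal I "ring_of_integers E" by (rule assms)
  define J where "J = {x. ec x \<in> I}"
  have I: "I = ec ` J" using a_subset by (auto simp: J_def carrier_ring_of_integers_E)
  have J0: "0 \<in> J" using additive_subgroup.zero_closed[OF ideal.axioms(1)[OF assms]] by (simp add: J_def)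
  have Jadd: "x + y \<in> J" if "x \<in> J" "y \<in> J" for x y 
    using additive_subgroup.a_closed[OF ideal.axioms(1)[OF assms], of "ec x" "ec y"] that by (simp add: J_def)
  have Jmult: "y * x \<in> J" if "x \<in> J" for x y
    using I_l_closed[of "ec x" "ec y"] that by (simp add: J_def carrier_ring_of_integers_E)
  have Jdiff: "x - y \<in> J" if "x \<in> J" "y \<in> J" for x y
    using Jadd[OF that(1) Jmult[OF that(2), of "- 1"]] by simp
  show ?thesis
  proof (cases "J = {0}")
    case True
    then show ?thesis using I pid_eq_zero_iff[of 0] by (intro exI[of _ 0]) auto
  next
    case False
    then obtain x0 where x0: "x0 \<in> J - {0}" using J0 by auto
    obtain g where g: "g \<in> J - {0}" "\<And>y. y \<in> J - {0} \<Longrightarrow> euclidean_size g \<le> euclidean_size y"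
      using ex_has_least_nat[of "\<lambda>x. x \<in> J - {0}" x0 euclidean_size] x0 by blast
    have "g dvd x" if "x \<in> J" for x
    proof (rule ccontr)
      assume "\<not> g dvd x"
      then have "x mod g \<noteq> 0" by (simp add: dvd_eq_mod_eq_0)
      moreover have "x mod g \<in> J"
        using Jdiff[OF that Jmult[of g "x div g"]] g(1) by (simp add: minus_div_mult_eq_mod)
      ultimately have "euclidean_size g \<le> euclidean_size (x mod g)" using g(2) by simp
      moreover have "euclidean_size (x mod g) < euclidean_size g" using g(1) by (intro mod_size_less) auto
      ultimately show False by simp
    qed
    moreover have "x \<in> J" if "g dvd x" for x
      using that Jmult[of g] g(1) by (auto elim!: dvdE simp: mult.commute)
    ultimately have "J = {x. g dvd x}" by blast
    then show ?thesis using I by (auto simp: pid_def)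
  qed
qed

lemma bij_betw_pid: "bij_betw pid {g. normalize g = g \<and> g \<noteq> 0} (nonzero_ideals E)"
proof (rule bij_betwI')
  fix x y :: eis assume "x \<in> {g. normalize g = g \<and> g \<noteq> 0}" "y \<in> {g. normalize g = g \<and> g \<noteq> 0}"
  then show "pid x = pid y \<longleftrightarrow> x = y" by (auto simp: pid_cong intro: associatedI associated_eqI)
next
  fix x :: eis assume "x \<in> {g. normalize g = g \<and> g \<noteq> 0}"
  then show "pid x \<in> nonzero_ideals E" by (auto simp: nonzero_ideals_def ideal_pid pid_eq_zero_iff)
next
  fix I assume I: "I \<in> nonzero_ideals E"
  then obtain g where g: "I = pid g" using ideal_imp_pid by (auto simp: nonzero_ideals_def)
  then have "g \<noteq> 0" using I by (auto simp: nonzero_ideals_def pid_eq_zero_iff)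
  then show "\<exists>x\<in>{g. normalize g = g \<and> g \<noteq> 0}. I = pid x"
    using g by (intro bexI[of _ "normalize g"]) auto
qed

subsection \<open>The norm of an ideal\<close>

definition eis_coset :: "eis \<Rightarrow> eis \<Rightarrow> eis set" where
  "eis_coset g a = {x. g dvd x - a}"

lemma eis_coset_eq_iff: "eis_coset g a = eis_coset g b \<longleftrightarrow> g dvd a - b"
proof
  assume "eis_coset g a = eis_coset g b"
  moreover have "a \<in> eis_coset g a" by (simp add: eis_coset_def)
  ultimately have "a \<in> eis_coset g b" by simp
  then show "g dvd a - b" by (simp add: eis_coset_def)
next
  assume *: "g dvd a - b"
  have "g dvd x - a \<longleftrightarrow> g dvd x - b" for x
    using dvd_add_left_iff[OF *, of "x - a"] by simp
  then show "eis_coset g a = eis_coset g b" by (simp add: eis_coset_def)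
qed

definition eis_index :: "eis \<Rightarrow> nat" where
  "eis_index g = card (range (eis_coset g))"

text \<open>
  A residue modulo \<open>g h\<close> is \<open>c + g d\<close> with \<open>c\<close> determined modulo \<open>g\<close> and then \<open>d\<close> modulo \<open>h\<close>. The
  bijection uses a chosen representative in each coset.
\<close>

lemma eis_index_mult:
  assumes "g \<noteq> 0"
  shows "eis_index (g * h) = eis_index g * eis_index h"
proof -
  define r where "r k C = (SOME a. C = eis_coset k a)" for k C
  have r: "eis_coset k (r k C) = C" if "C \<in> range (eis_coset k)" for k C
  proof -
    have "\<exists>a. C = eis_coset k a" using that by auto
    then show ?thesis unfolding r_def by (metis (mono_tags, lifting) someI)
  qed
  have "bij_betw (\<lambda>(C, D). eis_coset (g * h) (r g C + g * r h D))
    (range (eis_coset g) \<times> range (eis_coset h)) (range (eis_coset (g * h)))"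
  proof (rule bij_betwI')
    fix p q assume p: "p \<in> range (eis_coset g) \<times> range (eis_coset h)" and q: "q \<in> range (eis_coset g) \<times> range (eis_coset h)"
    obtain C D C' D' where [simp]: "p = (C, D)" "q = (C', D')" by (cases p; cases q)
    have mem: "C \<in> range (eis_coset g)" "C' \<in> range (eis_coset g)" "D \<in> range (eis_coset h)" "D' \<in> range (eis_coset h)"
      using p q by auto
    have "p = q" if eq: "eis_coset (g * h) (r g C + g * r h D) = eis_coset (g * h) (r g C' + g * r h D')"
    proof -
      have *: "g * h dvd (r g C - r g C') + g * (r h D - r h D')"
        using eq unfolding eis_coset_eq_iff by (simp add: algebra_simps)
      then have "g dvd (r g C - r g C') + g * (r h D - r h D')" by (rule dvd_mult_left)
      then have "g dvd r g C - r g C'" by (simp add: dvd_add_left_iff)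
      then have "C = C'" using r mem by (metis eis_coset_eq_iff)
      then have "h dvd r h D - r h D'" using * assms by simp
      then have "D = D'" using r mem by (metis eis_coset_eq_iff)
      then show ?thesis using \<open>C = C'\<close> by simp
    qed
    then show "(case p of (C, D) \<Rightarrow> eis_coset (g * h) (r g C + g * r h D)) =
        (case q of (C, D) \<Rightarrow> eis_coset (g * h) (r g C + g * r h D)) \<longleftrightarrow> p = q" by auto
  next
    fix C assume "C \<in> range (eis_coset (g * h))"
    then obtain a where a: "C = eis_coset (g * h) a" by auto
    define c where "c = r g (eis_coset g a)"
    have "eis_coset g c = eis_coset g a" unfolding c_def by (intro r) auto
    then have "g dvd a - c" by (metis eis_coset_eq_iff)
    then obtain b where b: "a - c = g * b" by (rule dvdE)
    define d where "d = r h (eis_coset h b)"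
    have "eis_coset h d = eis_coset h b" unfolding d_def by (intro r) auto
    then have "h dvd b - d" by (metis eis_coset_eq_iff)
    then have "g * h dvd g * (b - d)" by simp
    also have "g * (b - d) = a - (c + g * d)" using b by (simp add: algebra_simps)
    finally have "C = eis_coset (g * h) (c + g * d)" using a eis_coset_eq_iff by blast
    then show "\<exists>p\<in>range (eis_coset g) \<times> range (eis_coset h). C = (case p of (C, D) \<Rightarrow> eis_coset (g * h) (r g C + g * r h D))"
      by (intro bexI[of _ "(eis_coset g a, eis_coset h b)"]) (auto simp: c_def d_def)
  qed auto
  then show ?thesis unfolding eis_index_def by (metis bij_betw_same_card card_cartesian_product)
qed

lemma eis_index_of_int:
  assumes "n > 0"
  shows "eis_index (of_int n) = (nat n)\<^sup>2"
proof -
  have dvd_iff: "(of_int n :: eis) dvd Eis i j - Eis i' j' \<longleftrightarrow> i mod n = i' mod n \<and> j mod n = j' mod n" for i j i' j'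
    by (simp add: eis_of_int_dvd mod_eq_dvd_iff)
  have "bij_betw (\<lambda>(i, j). eis_coset (of_int n) (Eis i j)) ({0..<n} \<times> {0..<n}) (range (eis_coset (of_int n)))"
  proof (rule bij_betwI')
    fix p q assume "p \<in> {0..<n} \<times> {0..<n}" "q \<in> {0..<n} \<times> {0..<n}"
    then show "(case p of (i, j) \<Rightarrow> eis_coset (of_int n) (Eis i j)) = (case q of (i, j) \<Rightarrow> eis_coset (of_int n) (Eis i j)) \<longleftrightarrow> p = q"
      by (auto simp: eis_coset_eq_iff dvd_iff)
  next
    fix C :: "eis set" assume "C \<in> range (eis_coset (of_int n))"
    then obtain i j where "C = eis_coset (of_int n) (Eis i j)" by (metis eis.exhaust rangeE)
    then have "C = eis_coset (of_int n) (Eis (i mod n) (j mod n))"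
      by (simp add: eis_coset_eq_iff dvd_iff)
    then show "\<exists>p\<in>{0..<n} \<times> {0..<n}. C = (case p of (i, j) \<Rightarrow> eis_coset (of_int n) (Eis i j))"
      using assms by (intro bexI[of _ "(i mod n, j mod n)"]) auto
  qed auto
  then have "eis_index (of_int n) = card ({0..<n} \<times> {0..<n})"
    unfolding eis_index_def by (metis bij_betw_same_card)
  also have "\<dots> = (nat n)\<^sup>2" by (simp add: card_cartesian_product power2_eq_square)
  finally show ?thesis .
qed

lemma eis_index_conj: "eis_index (eis_conj g) = eis_index g"
proof -
  have diff: "eis_conj (x - y) = eis_conj x - eis_conj y" for x y by (simp add: eis_eq_iff)
  have coset: "eis_conj ` eis_coset g a = eis_coset (eis_conj g) (eis_conj a)" for g a
  proof -
    have "x \<in> eis_coset (eis_conj g) (eis_conj a) \<longleftrightarrow> eis_conj x \<in> eis_coset g a" for x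
      using eis_conj_dvd[of g "eis_conj x - a"] eis_conj_dvd[of "eis_conj g" "x - eis_conj a"]
      by (auto simp: eis_coset_def diff)
    then show ?thesis by (force simp: image_iff) 
  qed
  have "range (eis_coset (eis_conj g)) = (`) eis_conj ` range (eis_coset g)"
    by (auto simp: coset image_image) (metis coset eis_conj_conj rangeI)
  moreover have "inj_on ((`) eis_conj) (range (eis_coset g))"
    by (intro inj_on_image) (metis eis_conj_conj inj_on_def)
  ultimately show ?thesis unfolding eis_index_def by (metis card_image)
qed

text \<open>
  The index of \<open>g\<close> equals that of its conjugate, and the product of the two is the index of the integer
  \<open>g g' = N(g)\<close>, which is \<open>N(g)\<^sup>2\<close>.
\<close>

lemma eis_index_eq_norm:
  assumes "g \<noteq> 0"
  shows "int (eis_index g) = eis_norm g"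
proof -
  have "eis_index (g * eis_conj g) = eis_index g * eis_index g"
    by (simp only: eis_index_mult[OF assms] eis_index_conj)
  moreover have "eis_index (g * eis_conj g) = (nat (eis_norm g))\<^sup>2"
    unfolding eis_mult_conj using eis_norm_pos[OF assms] by (rule eis_index_of_int)
  ultimately have "(eis_index g)\<^sup>2 = (nat (eis_norm g))\<^sup>2" by (simp add: power2_eq_square)
  then have "eis_index g = nat (eis_norm g)" by simp
  then show ?thesis by simp
qed

lemma ideal_norm_pid:
  assumes "g \<noteq> 0"
  shows "ideal_norm E (pid g) = nat (eis_norm g)"
proof -
  have coset: "pid g +>\<^bsub>ring_of_integers E\<^esub> ec a = ec ` eis_coset g a" for a
  proof -
    have "pid g +>\<^bsub>ring_of_integers E\<^esub> ec a = (\<lambda>x. ec (x + a)) ` {x. g dvd x}"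
      by (auto simp: a_r_coset_def' pid_def)
    also have "\<dots> = ec ` ((\<lambda>x. x + a) ` {x. g dvd x})" by (simp only: image_image)
    also have "(\<lambda>x. x + a) ` {x. g dvd x} = eis_coset g a"
      by (force simp: eis_coset_def image_iff intro: exI[of _ "x - a" for x])
    finally show ?thesis .
  qed
  have "carrier (ring_of_integers E Quot pid g) = (\<lambda>a. ec ` eis_coset g a) ` UNIV"
    by (auto simp: FactRing_def A_RCOSETS_def' carrier_ring_of_integers_E coset)
  also have "\<dots> = (`) ec ` range (eis_coset g)" by auto
  finally have "ideal_norm E (pid g) = card ((`) ec ` range (eis_coset g))" by (simp add: ideal_norm_def)
  also have "\<dots> = eis_index g" unfolding eis_index_def
    by (intro card_image inj_on_image) (auto intro: inj_on_subset[OF inj_ec])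
  finally show ?thesis using eis_index_eq_norm[OF assms] by simp
qed

subsection \<open>Places\<close>

lemma prime_ideal_imp_pid:
  assumes "primeideal \<pp> (ring_of_integers E)" "\<pp> \<noteq> {0}"
  obtains \<pi> where "\<pp> = pid \<pi>" "prime_elem \<pi>"
proof -
  interpret primeideal \<pp> "ring_of_integers E" by (rule assms)
  obtain \<pi> where \<pi>: "\<pp> = pid \<pi>" using ideal_imp_pid[OF is_ideal] by blast
  have "prime_elem \<pi>"
  proof (rule prime_elemI)
    show "\<pi> \<noteq> 0" using assms(2) \<pi> by (auto simp: pid_eq_zero_iff)
    show "\<not> \<pi> dvd 1"
    proof
      assume "\<pi> dvd 1"
      then have "{x. \<pi> dvd x} = UNIV" using dvd_trans one_dvd by blast
      then have "\<pp> = range ec" by (simp add: \<pi> pid_def)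
      then show False using I_notcarr by (simp add: carrier_ring_of_integers_E)
    qed
    fix a b assume "\<pi> dvd a * b"
    then have "ec a * ec b \<in> \<pp>" using ec_in_pid[of "a * b" \<pi>] \<pi> by simp
    then have "ec a \<in> \<pp> \<or> ec b \<in> \<pp>" using I_prime[of "ec a" "ec b"] by (simp add: carrier_ring_of_integers_E)
    then show "\<pi> dvd a \<or> \<pi> dvd b" by (simp add: \<pi>)
  qed
  then show ?thesis using \<pi> that by blast
qed

lemma ideal_prod_pid: "ideal_prod (ring_of_integers E) (pid g) (pid h) = pid (g * h)"
proof
  show "ideal_prod (ring_of_integers E) (pid g) (pid h) \<subseteq> pid (g * h)"
  proof
    fix z assume "z \<in> ideal_prod (ring_of_integers E) (pid g) (pid h)"
    then show "z \<in> pid (g * h)"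
    proof induction
      case (prod i j)
      then obtain x y where "i = ec x" "g dvd x" "j = ec y" "h dvd y" by (auto simp: pid_def)
      then show ?case using ec_in_pid[of "x * y" "g * h"] by (simp add: mult_dvd_mono)
    next
      case (sum s1 s2)
      then obtain x y where "s1 = ec x" "g * h dvd x" "s2 = ec y" "g * h dvd y" by (auto simp: pid_def)
      then show ?case using ec_in_pid[of "x + y" "g * h"] by simp
    qed
  qed
  show "pid (g * h) \<subseteq> ideal_prod (ring_of_integers E) (pid g) (pid h)"
  proof
    fix z assume "z \<in> pid (g * h)"
    then obtain x where x: "z = ec x" "g * h dvd x" by (auto simp: pid_def)
    obtain c where "x = g * h * c" using x(2) by (rule dvdE)
    then have "z = ec (g * h * c)" using x by simp
    then have "z = ec g \<otimes>\<^bsub>ring_of_integers E\<^esub> ec (h * c)" by simp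
    also have "\<dots> \<in> ideal_prod (ring_of_integers E) (pid g) (pid h)"
      by (rule ideal_prod.prod) (auto simp del: ec_mult)
    finally show "z \<in> ideal_prod (ring_of_integers E) (pid g) (pid h)" .
  qed
qed

lemma ideal_power_pid: "pid g [^]\<^bsub>ideals_set (ring_of_integers E)\<^esub> (k :: nat) = pid (g ^ k)"
proof (induction k)
  case 0
  have "pid 1 = range ec" by (simp add: pid_def)
  then show ?case by (simp add: nat_pow_def ideals_set_def carrier_ring_of_integers_E)
next
  case (Suc k)
  have "pid g [^]\<^bsub>ideals_set (ring_of_integers E)\<^esub> Suc k =
      ideal_prod (ring_of_integers E) (pid g [^]\<^bsub>ideals_set (ring_of_integers E)\<^esub> k) (pid g)"
    by (simp add: nat_pow_def ideals_set_def)
  then show ?case by (simp add: Suc ideal_prod_pid mult.commute)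
qed

lemma ideal_ord_int_pid:
  assumes "prime_elem \<pi>" "x \<noteq> 0"
  shows "ideal_ord_int E (pid \<pi>) (ec x) = multiplicity \<pi> x"
proof -
  have "{k. ec x \<in> pid \<pi> [^]\<^bsub>ideals_set (ring_of_integers E)\<^esub> k} = {..multiplicity \<pi> x}"
    using assms by (auto simp: ideal_power_pid power_dvd_iff_le_multiplicity)
  then show ?thesis by (auto simp: ideal_ord_int_def intro!: Max_eqI)
qed

text \<open>
  Multiplicities are additive, so the difference does not depend on the way of writing an element of \<open>E\<close> as a
  quotient of integers, and the definite description has a value.
\<close>

lemma ideal_ord_pid:
  assumes \<pi>: "prime_elem \<pi>" and "u \<noteq> 0" "v \<noteq> 0"
  shows "ideal_ord E (pid \<pi>) (ec u / ec v) = int (multiplicity \<pi> u) - int (multiplicity \<pi> v)"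
  unfolding ideal_ord_def
proof (rule the_equality)
  show "\<exists>a\<in>carrier (ring_of_integers E) - {0}. \<exists>b\<in>carrier (ring_of_integers E) - {0}. ec u / ec v = a / b \<and>
      int (multiplicity \<pi> u) - int (multiplicity \<pi> v) = int (ideal_ord_int E (pid \<pi>) a) - int (ideal_ord_int E (pid \<pi>) b)"
    by (rule bexI[of _ "ec u"], rule bexI[of _ "ec v"])
      (use assms in \<open>auto simp: carrier_ring_of_integers_E ideal_ord_int_pid\<close>)
next
  fix n assume "\<exists>a\<in>carrier (ring_of_integers E) - {0}. \<exists>b\<in>carrier (ring_of_integers E) - {0}. ec u / ec v = a / b \<and>
      n = int (ideal_ord_int E (pid \<pi>) a) - int (ideal_ord_int E (pid \<pi>) b)"
  then obtain a' b' where "a' \<in> range ec - {0}" "b' \<in> range ec - {0}" "ec u / ec v = a' / b'"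
    "n = int (ideal_ord_int E (pid \<pi>) a') - int (ideal_ord_int E (pid \<pi>) b')"
    unfolding carrier_ring_of_integers_E by blast
  then obtain a b where ab: "a \<noteq> 0" "b \<noteq> 0" "ec u / ec v = ec a / ec b"
    "n = int (ideal_ord_int E (pid \<pi>) (ec a)) - int (ideal_ord_int E (pid \<pi>) (ec b))"
    by auto
  then have "ec (u * b) = ec (a * v)" using assms by (simp add: field_simps)
  then have "u * b = a * v" by (simp only: ec_inj_iff)
  then have "multiplicity \<pi> (u * b) = multiplicity \<pi> (a * v)" by simp
  then have "multiplicity \<pi> u + multiplicity \<pi> b = multiplicity \<pi> a + multiplicity \<pi> v"
    using assms ab by (simp add: prime_elem_multiplicity_mult_distrib)
  then show "n = int (multiplicity \<pi> u) - int (multiplicity \<pi> v)"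
    using ab assms by (simp add: ideal_ord_int_pid)
qed

lemma E_mult: "x \<in> E \<Longrightarrow> y \<in> E \<Longrightarrow> x * y \<in> E"
  by (elim E_cases) (use quotient_in_E[of "_ * _" "_ * _"] in simp)

lemma E_inverse: "x \<in> E \<Longrightarrow> inverse x \<in> E"
  by (elim E_cases) (use quotient_in_E in simp)

lemma abs_place_pos:
  assumes "w \<in> places" "x \<in> E" "x \<noteq> 0"
  shows "abs_place w x > 0"
proof (cases w)
  case (Finite_Place \<pp>)
  then have "primeideal \<pp> (ring_of_integers E)" "\<pp> \<noteq> {0}" using assms(1) by (auto simp: places_def)
  then obtain \<pi> where \<pi>: "\<pp> = pid \<pi>" "prime_elem \<pi>" by (rule prime_ideal_imp_pid)
  have "ideal_norm E \<pp> > 0" using \<pi> eis_norm_pos[of \<pi>] by (auto simp: ideal_norm_pid prime_elem_not_zeroI)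
  then show ?thesis using Finite_Place assms by simp
qed (use assms in auto)

lemma abs_place_mult:
  assumes "w \<in> places" "x \<in> E" "y \<in> E"
  shows "abs_place w (x * y) = abs_place w x * abs_place w y"
proof (cases w)
  case Infinite_Place
  then show ?thesis by (simp add: norm_mult power_mult_distrib)
next
  case (Finite_Place \<pp>)
  then have "primeideal \<pp> (ring_of_integers E)" "\<pp> \<noteq> {0}" using assms(1) by (auto simp: places_def)
  then obtain \<pi> where \<pi>: "\<pp> = pid \<pi>" "prime_elem \<pi>" by (rule prime_ideal_imp_pid)
  have q: "ideal_norm E \<pp> > 0" using \<pi> eis_norm_pos[of \<pi>] by (auto simp: ideal_norm_pid prime_elem_not_zeroI)
  show ?thesis
  proof (cases "x = 0 \<or> y = 0")
    case False
    obtain a b where ab: "b \<noteq> 0" "x = ec a / ec b" using assms(2) by (rule E_cases)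
    obtain c d where cd: "d \<noteq> 0" "y = ec c / ec d" using assms(3) by (rule E_cases)
    have ac: "a \<noteq> 0" "c \<noteq> 0" using False ab cd by auto
    have xy: "x * y = ec (a * c) / ec (b * d)" by (simp add: ab cd)
    have "ideal_ord E \<pp> (x * y) = ideal_ord E \<pp> x + ideal_ord E \<pp> y"
      unfolding xy unfolding ab(2) cd(2) \<pi>(1) using ab(1) cd(1) ac \<pi>(2)
      by (simp add: ideal_ord_pid prime_elem_multiplicity_mult_distrib del: ec_mult)
    then show ?thesis using Finite_Place False q by (simp add: power_int_diff power_int_minus field_simps)
  qed (use Finite_Place in auto)
qed

lemma abs_place_integer_le_1:
  assumes "w \<in> places" "w \<noteq> Infinite_Place"
  shows "abs_place w (ec a) \<le> 1"
proof (cases w)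
  case (Finite_Place \<pp>)
  then have "primeideal \<pp> (ring_of_integers E)" "\<pp> \<noteq> {0}" using assms(1) by (auto simp: places_def)
  then obtain \<pi> where \<pi>: "\<pp> = pid \<pi>" "prime_elem \<pi>" by (rule prime_ideal_imp_pid)
  have q: "ideal_norm E \<pp> \<ge> 1" using \<pi> eis_norm_pos[of \<pi>] by (auto simp: ideal_norm_pid prime_elem_not_zeroI)
  have "real (ideal_norm E \<pp>) powi (- ideal_ord E \<pp> (ec a)) \<le> 1" if "a \<noteq> 0"
  proof -
    have "ideal_ord E \<pp> (ec a) = int (multiplicity \<pi> a)"
      using ideal_ord_pid[OF \<pi>(2) that, of 1] \<pi> by simp
    then show ?thesis using q by (simp add: power_int_minus inverse_le_1_iff)
  qed
  then show ?thesis using Finite_Place by auto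
qed (use assms in auto)


section \<open>Dirichlet series and Euler products\<close>

text \<open>
  Grouping the terms by the value of \<open>\<nu>\<close> turns sums over ideals or over points into Dirichlet series.
\<close>

lemma infsum_fibres:
  fixes g :: "nat \<Rightarrow> complex" and \<nu> :: "'a \<Rightarrow> nat"
  assumes fin: "\<And>n. finite {x \<in> S. \<nu> x = n}"
    and summ: "(\<lambda>n. of_nat (card {x \<in> S. \<nu> x = n}) * g n) summable_on UNIV"
  shows "(\<lambda>x. g (\<nu> x)) summable_on S"
    and "infsum (\<lambda>x. g (\<nu> x)) S = infsum (\<lambda>n. of_nat (card {x \<in> S. \<nu> x = n}) * g n) UNIV"
proof -
  define T where "T = Sigma UNIV (\<lambda>n. {x \<in> S. \<nu> x = n})"
  have bij: "bij_betw snd T S"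
    by (rule bij_betwI'[where f = snd]) (auto simp: T_def)
  have norm: "(\<Sum>\<^sub>\<infinity>y\<in>{x \<in> S. \<nu> x = n}. norm (g n)) = norm (of_nat (card {x \<in> S. \<nu> x = n}) * g n)" for n
    using fin[of n] by (simp add: norm_mult)
  have "(\<lambda>p. norm (case p of (n, x) \<Rightarrow> g n)) summable_on T"
    unfolding T_def Infinite_Sum.abs_summable_on_Sigma_iff
  proof (intro conjI ballI)
    fix n show "(\<lambda>y. norm (case (n, y) of (n, x) \<Rightarrow> g n)) summable_on {x \<in> S. \<nu> x = n}"
      using fin[of n] by (intro summable_on_finite)
  next
    have "(\<lambda>n. norm (of_nat (card {x \<in> S. \<nu> x = n}) * g n)) summable_on UNIV"
      by (rule iffD1[OF summable_on_iff_abs_summable_on_complex summ])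
    then show "(\<lambda>n. norm (\<Sum>\<^sub>\<infinity>y\<in>{x \<in> S. \<nu> x = n}. norm (case (n, y) of (n, x) \<Rightarrow> g n))) summable_on UNIV"
      unfolding prod.case norm by simp
  qed
  then have sT: "(\<lambda>(n, x). g n) summable_on T" by (rule abs_summable_summable)
  have "((\<lambda>x. g (\<nu> x)) has_sum s) S \<longleftrightarrow> ((\<lambda>(n, x). g n) has_sum s) T" for s
  proof -
    have "((\<lambda>x. g (\<nu> x)) has_sum s) S \<longleftrightarrow> ((\<lambda>p. g (\<nu> (snd p))) has_sum s) T"
      using has_sum_reindex_bij_betw[OF bij, of "\<lambda>x. g (\<nu> x)" s] by simp
    also have "\<dots> \<longleftrightarrow> ((\<lambda>(n, x). g n) has_sum s) T"
      by (intro has_sum_cong) (auto simp: T_def)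
    finally show ?thesis .
  qed
  then have *: "((\<lambda>x. g (\<nu> x)) has_sum infsum (\<lambda>(n, x). g n) T) S" using sT by (simp add: has_sum_infsum)
  then show "(\<lambda>x. g (\<nu> x)) summable_on S" by (auto simp: summable_on_def)
  have "infsum (\<lambda>x. g (\<nu> x)) S = infsum (\<lambda>(n, x). g n) T" using * by (rule infsumI)
  also have "\<dots> = (\<Sum>\<^sub>\<infinity>n. \<Sum>\<^sub>\<infinity>x\<in>{x \<in> S. \<nu> x = n}. g n)"
    using infsum_Sigma_banach[OF sT[unfolded T_def]] by (simp add: T_def)
  also have "\<dots> = infsum (\<lambda>n. of_nat (card {x \<in> S. \<nu> x = n}) * g n) UNIV"
    using fin by (intro infsum_cong) simp
  finally show "infsum (\<lambda>x. g (\<nu> x)) S = infsum (\<lambda>n. of_nat (card {x \<in> S. \<nu> x = n}) * g n) UNIV" .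
qed

lemma has_sum_mult_complex:
  fixes f :: "'a \<Rightarrow> complex" and g :: "'b \<Rightarrow> complex"
  assumes f: "(f has_sum s) A" and g: "(g has_sum t) B"
    and summ: "(\<lambda>(x, y). f x * g y) summable_on A \<times> B"
  shows "((\<lambda>(x, y). f x * g y) has_sum s * t) (A \<times> B)"
proof (rule has_sum_SigmaI[where g = "\<lambda>x. f x * t"])
  show "((\<lambda>y. case (x, y) of (x, y) \<Rightarrow> f x * g y) has_sum f x * t) B" for x
    using has_sum_cmult_right[OF g, of "f x"] by simp
  show "((\<lambda>x. f x * t) has_sum s * t) A" using has_sum_cmult_left[OF f, of t] by simp
qed (rule summ)

definition smooth_numbers :: "nat set \<Rightarrow> nat set" where
  "smooth_numbers S = {n. n > 0 \<and> prime_factors n \<subseteq> S}"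

lemma bij_betw_smooth_insert:
  assumes "prime p" "p \<notin> S"
  shows "bij_betw (\<lambda>(m, k). m * p ^ k) (smooth_numbers S \<times> UNIV) (smooth_numbers (insert p S))"
proof -
  have p0: "p > 0" using assms(1) by (simp add: prime_gt_0_nat)
  have mult: "multiplicity p (m * p ^ k) = k" if "m \<in> smooth_numbers S" for m k
  proof -
    have "\<not> p dvd m" "m > 0" using that assms by (auto simp: smooth_numbers_def in_prime_factors_iff)
    then have "multiplicity p m = 0" by (simp add: not_dvd_imp_multiplicity_0)
    moreover have "multiplicity p (p ^ k) = k" using assms(1) p0 by (intro multiplicity_same_power) auto
    moreover have "multiplicity p (m * p ^ k) = multiplicity p m + multiplicity p (p ^ k)"
      using assms(1) \<open>m > 0\<close> p0 by (intro prime_elem_multiplicity_mult_distrib) auto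
    ultimately show ?thesis by simp
  qed
  show ?thesis
  proof (rule bij_betwI')
    fix x y assume xy: "x \<in> smooth_numbers S \<times> (UNIV :: nat set)" "y \<in> smooth_numbers S \<times> (UNIV :: nat set)"
    obtain m k m' k' where [simp]: "x = (m, k)" "y = (m', k')" by (cases x; cases y)
    have "x = y" if eq: "m * p ^ k = m' * p ^ k'"
    proof -
      have "k = k'" using mult[of m k] mult[of m' k'] xy eq by auto
      then show ?thesis using eq p0 by simp
    qed
    then show "(case x of (m, k) \<Rightarrow> m * p ^ k) = (case y of (m, k) \<Rightarrow> m * p ^ k) \<longleftrightarrow> x = y" by auto
  next
    fix x assume x: "x \<in> smooth_numbers S \<times> (UNIV :: nat set)"
    obtain m k where [simp]: "x = (m, k)" by (cases x)
    have "q = p \<or> q \<in> S" if "prime q" "q dvd m * p ^ k" for q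
    proof -
      have "q dvd m \<or> q dvd p" using that by (auto simp: prime_dvd_mult_iff dest: prime_dvd_power)
      then show ?thesis using x that assms(1)
        by (auto simp: smooth_numbers_def in_prime_factors_iff primes_dvd_imp_eq)
    qed
    then show "(case x of (m, k) \<Rightarrow> m * p ^ k) \<in> smooth_numbers (insert p S)"
      using x p0 by (auto simp: smooth_numbers_def in_prime_factors_iff)
  next
    fix n assume n: "n \<in> smooth_numbers (insert p S)"
    have n0: "n > 0" using n by (simp add: smooth_numbers_def)
    obtain m where nm: "n = p ^ multiplicity p n * m" "\<not> p dvd m"
      using multiplicity_decompose'[of n p] n0 assms(1) by (metis not_prime_unit less_irrefl)
    have "m > 0" using nm n0 by (metis gr0I mult_0_right less_irrefl)
    moreover have "q \<in> S" if "prime q" "q dvd m" for q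
    proof -
      have "q dvd n" using that nm by (metis dvd_mult)
      then show ?thesis using that n n0 nm by (auto simp: smooth_numbers_def in_prime_factors_iff)
    qed
    ultimately have "m \<in> smooth_numbers S" by (auto simp: smooth_numbers_def in_prime_factors_iff)
    then show "\<exists>x\<in>smooth_numbers S \<times> UNIV. n = (case x of (m, k) \<Rightarrow> m * p ^ k)"
      using nm by (intro bexI[of _ "(m, multiplicity p n)"]) (auto simp: mult.commute)
  qed
qed

text \<open>
  Each integer with all prime factors in \<open>S \<union> {p}\<close> is uniquely \<open>m p\<^sup>k\<close> with the prime factors of \<open>m\<close> in \<open>S\<close>. By
  multiplicativity, adding \<open>p\<close> to \<open>S\<close> multiplies the sum by the Euler factor at \<open>p\<close>.
\<close>

lemma has_sum_smooth:
  fixes F :: "nat \<Rightarrow> complex"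
  assumes mult: "\<And>m n. coprime m n \<Longrightarrow> m > 0 \<Longrightarrow> n > 0 \<Longrightarrow> F (m * n) = F m * F n"
    and F1: "F 1 = 1" and summ: "F summable_on UNIV"
    and S: "finite S" "\<And>p. p \<in> S \<Longrightarrow> prime p"
  shows "(F has_sum (\<Prod>p\<in>S. \<Sum>\<^sub>\<infinity>k. F (p ^ k))) (smooth_numbers S)"
  using S
proof (induction S)
  case empty
  have "smooth_numbers {} = {1}" by (auto simp: smooth_numbers_def prime_factorization_empty_iff)
  then show ?case using has_sum_finite[of "{1::nat}" F] F1 by simp
next
  case (insert p S)
  have p: "prime p" "p \<notin> S" using insert by auto
  note bij = bij_betw_smooth_insert[OF p]
  have eq: "F (m * p ^ k) = F m * F (p ^ k)" if "m \<in> smooth_numbers S" for m k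
  proof (rule mult)
    have "\<not> p dvd m" using that p by (auto simp: smooth_numbers_def in_prime_factors_iff)
    then have "coprime p m" using p(1) prime_imp_coprime by blast
    then show "coprime m (p ^ k)" by (simp add: coprime_commute)
  qed (use that p in \<open>auto simp: smooth_numbers_def prime_gt_0_nat\<close>)
  have cong: "((\<lambda>(m, k). F m * F (p ^ k)) has_sum s) (smooth_numbers S \<times> UNIV) \<longleftrightarrow>
      (F has_sum s) (smooth_numbers (insert p S))" for s
  proof -
    have "((\<lambda>(m, k). F m * F (p ^ k)) has_sum s) (smooth_numbers S \<times> UNIV) \<longleftrightarrow>
        ((\<lambda>x. F (case x of (m, k) \<Rightarrow> m * p ^ k)) has_sum s) (smooth_numbers S \<times> UNIV)"
      by (intro has_sum_cong) (auto simp: eq)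
    also have "\<dots> \<longleftrightarrow> (F has_sum s) (smooth_numbers (insert p S))"
      by (rule has_sum_reindex_bij_betw[OF bij])
    finally show ?thesis .
  qed
  have "F summable_on smooth_numbers (insert p S)" using summ by (rule summable_on_subset_banach) auto
  then have summ2: "(\<lambda>(m, k). F m * F (p ^ k)) summable_on smooth_numbers S \<times> UNIV"
    using cong by (auto simp: summable_on_def)
  have "inj (\<lambda>k. p ^ k)" using prime_gt_1_nat[OF p(1)] by (auto simp: inj_def)
  moreover have "F summable_on range (\<lambda>k. p ^ k)" using summ by (rule summable_on_subset_banach) auto
  ultimately have "(\<lambda>k. F (p ^ k)) summable_on UNIV" by (simp add: summable_on_reindex o_def)
  then have "((\<lambda>k. F (p ^ k)) has_sum (\<Sum>\<^sub>\<infinity>k. F (p ^ k))) UNIV" by (rule has_sum_infsum)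
  moreover have "(F has_sum (\<Prod>p\<in>S. \<Sum>\<^sub>\<infinity>k. F (p ^ k))) (smooth_numbers S)" using insert by auto
  ultimately have "((\<lambda>(m, k). F m * F (p ^ k)) has_sum (\<Prod>p\<in>S. \<Sum>\<^sub>\<infinity>k. F (p ^ k)) * (\<Sum>\<^sub>\<infinity>k. F (p ^ k))) (smooth_numbers S \<times> UNIV)"
    using summ2 by (intro has_sum_mult_complex)
  then show ?case unfolding cong using insert by (simp add: mult.commute)
qed

text \<open>
  The Euler product as a limit of finite products: the product over the primes up to \<open>N\<close> is the sum over all
  integers without a larger prime factor, and these include \<open>1, \<dots>, N\<close>.
\<close>

theorem euler_product:
  fixes F :: "nat \<Rightarrow> complex"
  assumes mult: "\<And>m n. coprime m n \<Longrightarrow> m > 0 \<Longrightarrow> n > 0 \<Longrightarrow> F (m * n) = F m * F n"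
    and F1: "F 1 = 1" and F0: "F 0 = 0" and summ: "F summable_on UNIV"
  shows "(\<lambda>N. \<Prod>p | prime p \<and> p \<le> N. \<Sum>\<^sub>\<infinity>k. F (p ^ k)) \<longlonglongrightarrow> infsum F UNIV"
proof -
  define A where "A N = smooth_numbers {p. prime p \<and> p \<le> N}" for N
  have prod: "(\<Prod>p | prime p \<and> p \<le> N. \<Sum>\<^sub>\<infinity>k. F (p ^ k)) = infsum F (A N)" for N
    unfolding A_def by (rule infsumI[symmetric], rule has_sum_smooth[OF mult F1 summ]) auto
  have abs: "(\<lambda>n. norm (F n)) summable_on B" for B
    by (rule summable_on_subset_banach[of _ UNIV]) (use summ summable_on_iff_abs_summable_on_complex in auto)
  have Fs: "F summable_on B" for B using summ by (rule summable_on_subset_banach) auto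
  have bound: "norm (infsum F UNIV - infsum F (A N)) \<le> infsum (\<lambda>n. norm (F n)) UNIV - (\<Sum>n<Suc N. norm (F n))" for N
  proof -
    have "A N \<inter> - A N = {}" "A N \<union> - A N = UNIV" by auto
    then have "infsum F UNIV = infsum F (A N) + infsum F (- A N)"
      using infsum_Un_disjoint[OF Fs Fs, of "A N" "- A N"] by simp
    then have "norm (infsum F UNIV - infsum F (A N)) = norm (infsum F (- A N))" by simp
    also have "\<dots> \<le> infsum (\<lambda>n. norm (F n)) (- A N)" by (rule norm_infsum_bound) (rule abs)
    also have "\<dots> \<le> infsum (\<lambda>n. norm (F n)) (- {1..N})"
    proof -
      have "{1..N} \<subseteq> A N"
      proof
        fix n assume n: "n \<in> {1..N}"
        then have "q \<le> N" if "q dvd n" for q using dvd_imp_le[OF that] by auto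
        then show "n \<in> A N" using n by (auto simp: A_def smooth_numbers_def in_prime_factors_iff)
      qed
      then show ?thesis by (intro infsum_mono_neutral abs) auto
    qed
    also have "\<dots> = infsum (\<lambda>n. norm (F n)) UNIV - infsum (\<lambda>n. norm (F n)) {1..N}"
    proof -
      have "{1..N} \<inter> - {1..N} = {}" "{1..N} \<union> - {1..N} = UNIV" by auto
      then show ?thesis using infsum_Un_disjoint[OF abs abs, of "{1..N}" "- {1..N}"] by simp
    qed
    also have "infsum (\<lambda>n. norm (F n)) {1..N} = (\<Sum>n<Suc N. norm (F n))"
    proof -
      have "{..<Suc N} = insert 0 {1..N}" by auto
      then show ?thesis using F0 by simp
    qed
    finally show ?thesis .
  qed
  have "(\<lambda>n. norm (F n)) sums infsum (\<lambda>n. norm (F n)) UNIV"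
    by (intro has_sum_imp_sums has_sum_infsum abs)
  then have "(\<lambda>N. \<Sum>n<Suc N. norm (F n)) \<longlonglongrightarrow> infsum (\<lambda>n. norm (F n)) UNIV"
    unfolding sums_def by (rule LIMSEQ_Suc)
  then have "(\<lambda>N. infsum (\<lambda>n. norm (F n)) UNIV - (\<Sum>n<Suc N. norm (F n))) \<longlonglongrightarrow>
      infsum (\<lambda>n. norm (F n)) UNIV - infsum (\<lambda>n. norm (F n)) UNIV"
    by (intro tendsto_diff tendsto_const)
  then have "(\<lambda>N. infsum (\<lambda>n. norm (F n)) UNIV - (\<Sum>n<Suc N. norm (F n))) \<longlonglongrightarrow> 0" by simp
  then have "(\<lambda>N. infsum F UNIV - infsum F (A N)) \<longlonglongrightarrow> 0"
    by (rule Lim_null_comparison[rotated]) (use bound in auto)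
  then have "(\<lambda>N. infsum F UNIV - (infsum F UNIV - infsum F (A N))) \<longlonglongrightarrow> infsum F UNIV - 0"
    by (intro tendsto_intros)
  then show ?thesis by (simp add: prod)
qed

subsection \<open>Powers of integers\<close>

definition npow :: "complex \<Rightarrow> nat \<Rightarrow> complex" where
  "npow z n = 1 / of_nat n powr z"

lemma npow_0 [simp]: "npow z 0 = 0" and npow_1 [simp]: "npow z (Suc 0) = 1"
  by (simp_all add: npow_def)

lemma npow_mult: "npow z (m * n) = npow z m * npow z n"
  by (simp add: npow_def powr_times_real)

lemma npow_power: "npow z (n ^ k) = npow z n ^ k"
  by (induction k) (simp_all add: npow_mult)

lemma powr_of_nat_mult: "x \<noteq> 0 \<Longrightarrow> x powr (of_nat k * z) = (x powr z :: complex) ^ k"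
  by (simp add: powr_def mult.assoc flip: exp_of_nat_mult)

lemma norm_npow: "norm (npow z n) = real n powr (- Re z)"
  by (simp add: npow_def norm_divide norm_powr_real_powr powr_minus_divide)

lemma norm_npow_less_1: "prime p \<Longrightarrow> Re z > 0 \<Longrightarrow> norm (npow z p) < 1"
  using powr_less_mono[of "- Re z" 0 "real p"] prime_gt_1_nat[of p] by (simp add: norm_npow)

lemma summable_npow_bound:
  fixes f :: "nat \<Rightarrow> nat"
  assumes "\<And>n. n \<ge> 1 \<Longrightarrow> real (f n) \<le> C * real n ^ d" and "Re z > real d + 1"
  shows "(\<lambda>n. of_nat (f n) * npow z n) summable_on UNIV"
proof -
  have "summable (\<lambda>n. real n powr (real d - Re z))"
    using assms(2) by (simp add: summable_real_powr_iff)
  then have "summable (\<lambda>n. C * real n powr (real d - Re z))" by (rule summable_mult)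
  then have "summable (\<lambda>n. norm (of_nat (f n) * npow z n))"
  proof (rule summable_comparison_test[rotated], intro exI[of _ 1] allI impI)
    fix n :: nat assume "1 \<le> n"
    then have n: "real n > 0" and n1: "n \<ge> 1" by simp_all
    have "norm (norm (of_nat (f n) * npow z n)) = real (f n) * real n powr (- Re z)"
      by (simp add: norm_mult norm_npow)
    also have "\<dots> \<le> (C * real n ^ d) * real n powr (- Re z)"
      using assms(1)[OF n1] by (intro mult_right_mono) auto
    also have "\<dots> = C * real n powr (real d - Re z)"
      using n by (simp add: powr_realpow[symmetric] mult.assoc flip: powr_add)
    finally show "norm (norm (of_nat (f n) * npow z n)) \<le> C * real n powr (real d - Re z)" .
  qed
  then show ?thesis by (rule norm_summable_imp_summable_on)
qed

lemma infsum_prime_powers: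
  fixes F :: "nat \<Rightarrow> complex"
  assumes "F summable_on UNIV" "prime (p :: nat)" "(\<lambda>k. F (p ^ k)) sums s"
  shows "(\<Sum>\<^sub>\<infinity>k. F (p ^ k)) = s"
proof -
  have "inj (\<lambda>k. p ^ k)" using prime_gt_1_nat[OF assms(2)] by (auto simp: inj_def)
  moreover have "F summable_on range (\<lambda>k. p ^ k)" using assms(1) by (rule summable_on_subset_banach) auto
  ultimately have "(\<lambda>k. F (p ^ k)) summable_on UNIV" by (simp add: summable_on_reindex o_def)
  then have "(\<lambda>k. F (p ^ k)) sums (\<Sum>\<^sub>\<infinity>k. F (p ^ k))" by (intro has_sum_imp_sums has_sum_infsum)
  then show ?thesis using assms(3) sums_unique2 by blast
qed

subsection \<open>The four Dirichlet series\<close>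

definition chi3 :: "nat \<Rightarrow> complex" where
  "chi3 n = (if n mod 3 = 1 then 1 else if n mod 3 = 2 then - 1 else 0)"

lemma chi3_mult: "chi3 (m * n) = chi3 m * chi3 n"
proof -
  have "(m * n) mod 3 = ((m mod 3) * (n mod 3)) mod 3" by (simp add: mod_mult_eq)
  moreover have "m mod 3 = 0 \<or> m mod 3 = 1 \<or> m mod 3 = 2" "n mod 3 = 0 \<or> n mod 3 = 1 \<or> n mod 3 = 2" by auto
  ultimately show ?thesis unfolding chi3_def by (elim disjE) simp_all
qed

lemma chi3_1 [simp]: "chi3 (Suc 0) = 1" "chi3 0 = 0" by (simp_all add: chi3_def)

lemma chi3_power: "chi3 (n ^ k) = chi3 n ^ k"
  by (induction k) (simp_all add: chi3_mult)

lemma norm_chi3_le: "norm (chi3 n) \<le> 1" by (simp add: chi3_def)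

text \<open>
  The number of ideals of norm \<open>n\<^sup>3\<close> that are prime to \<open>3\<close>. It will turn out to be the number of
  integral points of height \<open>\<surd>n\<close>.
\<close>

definition point_count :: "nat \<Rightarrow> nat" where
  "point_count n = (if 3 dvd n then 0 else eis_count (n ^ 3))"

lemma point_count_1 [simp]: "point_count (Suc 0) = 1" by (simp add: point_count_def)

lemma point_count_mult:
  assumes "coprime m n" "m > 0" "n > 0"
  shows "point_count (m * n) = point_count m * point_count n"
proof -
  have "3 dvd m * n \<longleftrightarrow> 3 dvd m \<or> 3 dvd n" by (simp add: prime_dvd_mult_iff)
  then show ?thesis using assms by (simp add: point_count_def power_mult_distrib eis_count_mult)
qed

lemma prime_mod_3_cases:
  fixes p :: nat
  assumes "prime p"
  obtains "p = 3" | "p mod 3 = 1" "p \<noteq> 3" | "p mod 3 = 2" "p \<noteq> 3"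
proof -
  have "p mod 3 = 0 \<or> p mod 3 = 1 \<or> p mod 3 = 2" by auto
  moreover have "p = 3" if "p mod 3 = 0"
    using that assms primes_dvd_imp_eq[of 3 p] by (auto simp: mod_eq_0_iff_dvd)
  ultimately show ?thesis using that by auto
qed

lemma point_count_prime_power:
  assumes "prime p"
  shows "point_count (p ^ k) = (if p = 3 then (if k = 0 then 1 else 0) else if p mod 3 = 1 then 3 * k + 1
     else if even k then 1 else 0)"
  using assms
proof (cases rule: prime_mod_3_cases)
  case 1
  then show ?thesis by (cases "k = 0") (auto simp: point_count_def)
next
  case 2
  then have "\<not> 3 dvd p" by (auto simp: mod_eq_0_iff_dvd)
  then have "\<not> 3 dvd p ^ k" using prime_dvd_power[of "3::nat" p k] by auto
  then have "point_count (p ^ k) = eis_count (p ^ (k * 3))" by (simp add: point_count_def power_mult)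
  then show ?thesis using 2 assms by (simp add: eis_count_power_split)
next
  case 3
  then have "\<not> 3 dvd p" by (auto simp: mod_eq_0_iff_dvd)
  then have "\<not> 3 dvd p ^ k" using prime_dvd_power[of "3::nat" p k] by auto
  then have "point_count (p ^ k) = eis_count (p ^ (k * 3))" by (simp add: point_count_def power_mult)
  then show ?thesis using 3 assms by (simp add: eis_count_power_inert)
qed

lemma sums_even_geometric:
  fixes x :: complex
  assumes "norm x < 1"
  shows "(\<lambda>k. (if even k then 1 else 0) * x ^ k) sums (1 / (1 - x\<^sup>2))"
proof -
  have "(\<lambda>k. (x ^ k + (- x) ^ k) / 2) sums ((1 / (1 - x) + 1 / (1 - - x)) / 2)"
    using assms by (intro sums_divide sums_add geometric_sums) auto
  also have "(\<lambda>k. (x ^ k + (- x) ^ k) / 2) = (\<lambda>k. (if even k then 1 else 0) * x ^ k)"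
    by (auto simp: power_minus_odd)
  also have "(1 / (1 - x) + 1 / (1 - - x)) / 2 = 1 / (1 - x\<^sup>2)"
  proof -
    have "x \<noteq> 1" "x \<noteq> - 1" using assms by auto
    then have nz: "1 - x \<noteq> 0" "1 + x \<noteq> 0" by (auto simp: add_eq_0_iff)
    have eq: "1 - x\<^sup>2 = (1 - x) * (1 + x)" by (simp add: power2_eq_square algebra_simps)
    have "1 / (1 - x) + 1 / (1 + x) = 2 / (1 - x\<^sup>2)"
      unfolding eq using nz by (simp add: add_frac_eq)
    then have "(1 / (1 - x) + 1 / (1 + x)) / 2 = (2 / (1 - x\<^sup>2)) / 2" by (simp only:)
    also have "\<dots> = 1 / (1 - x\<^sup>2)" using nz eq by (simp add: divide_simps)
    finally have "(1 / (1 - x) + 1 / (1 + x)) / 2 = 1 / (1 - x\<^sup>2)" .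
    then show ?thesis by (simp only: diff_minus_eq_add)
  qed
  finally show ?thesis .
qed

text \<open>
  The generating functions in \<open>x = p\<^bsup>-z\<^esup>\<close> of the numbers of ideals of norm \<open>p\<^sup>k\<close>, and of ideals of norm \<open>p\<^sup>3\<^sup>k\<close>
  that are prime to \<open>3\<close>.
\<close>

definition ideal_factor :: "nat \<Rightarrow> complex \<Rightarrow> complex" where
  "ideal_factor p x = (if p = 3 then 1 / (1 - x) else if p mod 3 = 1 then 1 / (1 - x)\<^sup>2 else 1 / (1 - x\<^sup>2))"

definition point_factor :: "nat \<Rightarrow> complex \<Rightarrow> complex" where
  "point_factor p x = (if p = 3 then 1 else if p mod 3 = 1 then (1 + 2 * x) / (1 - x)\<^sup>2 else 1 / (1 - x\<^sup>2))"

lemma sums_ideal_factor: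
  assumes p: "prime p" and x: "norm x < 1"
  shows "(\<lambda>k. of_nat (eis_count (p ^ k)) * x ^ k) sums ideal_factor p x"
  using p
proof (cases rule: prime_mod_3_cases)
  case 1
  then show ?thesis using geometric_sums[OF x] by (simp add: ideal_factor_def eis_count_power_3)
next
  case 2
  then show ?thesis using geometric_deriv_sums[OF x] p by (simp add: ideal_factor_def eis_count_power_split)
next
  case 3
  then have "(\<lambda>k. of_nat (eis_count (p ^ k)) * x ^ k) = (\<lambda>k. (if even k then 1 else 0) * x ^ k)"
    using p by (intro ext) (simp add: eis_count_power_inert)
  then show ?thesis using sums_even_geometric[OF x] 3 by (simp add: ideal_factor_def)
qed

lemma sums_point_factor:
  assumes p: "prime p" and x: "norm x < 1"
  shows "(\<lambda>k. of_nat (point_count (p ^ k)) * x ^ k) sums point_factor p x"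
  using p
proof (cases rule: prime_mod_3_cases)
  case 1
  then have "(\<lambda>k. of_nat (point_count (p ^ k)) * x ^ k) = (\<lambda>k. if k = 0 then 1 else 0)"
    using p by (intro ext) (simp add: point_count_prime_power)
  then show ?thesis using 1 sums_single[of 0 "\<lambda>_. 1 :: complex"] by (simp add: point_factor_def)
next
  case 2
  have x1: "1 - x \<noteq> 0" using x by auto
  have "(\<lambda>k. 3 * (of_nat (Suc k) * x ^ k) - 2 * x ^ k) sums (3 * (1 / (1 - x)\<^sup>2) - 2 * (1 / (1 - x)))"
    using x by (intro sums_diff sums_mult geometric_sums geometric_deriv_sums)
  also have "(\<lambda>k. 3 * (of_nat (Suc k) * x ^ k) - 2 * x ^ k) = (\<lambda>k. of_nat (point_count (p ^ k)) * x ^ k)"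
    using p 2 by (intro ext) (simp add: point_count_prime_power algebra_simps)
  also have "3 * (1 / (1 - x)\<^sup>2) - 2 * (1 / (1 - x)) = point_factor p x"
    using 2 x1 by (simp add: point_factor_def divide_simps power2_eq_square) (simp add: algebra_simps)
  finally show ?thesis .
next
  case 3
  then have "(\<lambda>k. of_nat (point_count (p ^ k)) * x ^ k) = (\<lambda>k. (if even k then 1 else 0) * x ^ k)"
    using p by (intro ext) (simp add: point_count_prime_power)
  then show ?thesis using sums_even_geometric[OF x] 3 by (simp add: point_factor_def)
qed

lemma summable_eis_count:
  assumes "Re z > 10"
  shows "(\<lambda>n. of_nat (eis_count n) * npow z n) summable_on UNIV"
proof (rule summable_npow_bound[where C = 25 and d = 2])
  fix n :: nat assume n: "n \<ge> 1"
  have "eis_count n \<le> (4 * n + 1)\<^sup>2" by (rule eis_count_bound)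
  also have "\<dots> \<le> (5 * n)\<^sup>2" using n by (intro power_mono) auto
  finally have "eis_count n \<le> 25 * n\<^sup>2" by (simp add: power_mult_distrib)
  then have "real (eis_count n) \<le> real (25 * n\<^sup>2)" by (simp only: of_nat_le_iff)
  then show "real (eis_count n) \<le> 25 * real n ^ 2" by simp
qed (use assms in auto)

lemma summable_point_count:
  assumes "Re z > 10"
  shows "(\<lambda>n. of_nat (point_count n) * npow z n) summable_on UNIV"
proof (rule summable_npow_bound[where C = 25 and d = 6])
  fix n :: nat assume n: "n \<ge> 1"
  have "point_count n \<le> eis_count (n ^ 3)" by (simp add: point_count_def)
  also have "\<dots> \<le> (4 * n ^ 3 + 1)\<^sup>2" by (rule eis_count_bound)
  also have "\<dots> \<le> (5 * n ^ 3)\<^sup>2" using n by (intro power_mono) auto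
  finally have "point_count n \<le> 25 * n ^ 6" by (simp add: power_mult_distrib flip: power_mult)
  then have "real (point_count n) \<le> real (25 * n ^ 6)" by (simp only: of_nat_le_iff)
  then show "real (point_count n) \<le> 25 * real n ^ 6" by simp
qed (use assms in auto)


subsection \<open>Comparison of Euler factors\<close>

lemma npow_multiple:
  assumes "n > 0"
  shows "1 / of_nat n powr (of_nat k * z) = npow z n ^ k"
  using assms by (simp add: npow_def powr_of_nat_mult power_one_over)

lemma factor_1_eq: "factor_1 z p = (if prime p \<and> p mod 3 = 1 then 1 - 3 * npow z p ^ 2 + 2 * npow z p ^ 3 else 1)"
  using npow_multiple[of p 2 z] npow_multiple[of p 3 z]
  by (auto simp: factor_1_def prime_gt_0_nat field_simps)

lemma factor_2_eq: "factor_2 z q = (if prime q \<and> q mod 3 = 2 then 1 - npow z q ^ 2 else 1)"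
  using npow_multiple[of q 2 z] by (auto simp: factor_2_def prime_gt_0_nat)

lemma norm_npow_le_1: "Re z \<ge> 0 \<Longrightarrow> norm (npow z n) \<le> 1"
  by (cases "n = 0") (auto simp: norm_npow powr_minus divide_simps ge_one_powr_ge_zero)

lemma norm_npow_square: "norm (npow z n) ^ 2 = real n powr (- 2 * Re z)"
  by (cases "n = 0") (simp_all add: norm_npow powr_powr mult.commute flip: powr_numeral)

text \<open>
  Both corrections are \<open>1 + O(p\<^bsup>-2z\<^esup>)\<close>; this is why their products make sense for \<open>Re z > 1/2\<close>, to the left of the pole at \<open>z = 1\<close>.
\<close>

lemma norm_factor_minus_1:
  assumes "Re z \<ge> 0"
  shows "norm (factor_1 z p - 1) \<le> 5 * real p powr (- 2 * Re z)"
    and "norm (factor_2 z p - 1) \<le> 5 * real p powr (- 2 * Re z)"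
proof -
  define x where "x = npow z p"
  have x: "norm x \<le> 1" using assms norm_npow_le_1 by (simp add: x_def)
  have "norm (2 * x ^ 3 - 3 * x ^ 2) \<le> norm (2 * x ^ 3) + norm (3 * x ^ 2)" by (rule norm_triangle_ineq4)
  also have "\<dots> = 2 * (norm x ^ 2 * norm x) + 3 * norm x ^ 2"
    by (simp add: norm_mult norm_power power3_eq_cube power2_eq_square)
  also have "norm x ^ 2 * norm x \<le> norm x ^ 2 * 1" using x by (intro mult_left_mono) auto
  finally have 1: "norm (2 * x ^ 3 - 3 * x ^ 2) \<le> 5 * norm x ^ 2" by simp
  have x2: "norm x ^ 2 = real p powr (- 2 * Re z)" using norm_npow_square by (simp add: x_def)
  show "norm (factor_1 z p - 1) \<le> 5 * real p powr (- 2 * Re z)"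
  proof (cases "prime p \<and> p mod 3 = 1")
    case True
    then have "factor_1 z p - 1 = 2 * x ^ 3 - 3 * x ^ 2" by (simp add: factor_1_eq x_def)
    then show ?thesis using 1 x2 by simp
  qed (auto simp: factor_1_eq)
  show "norm (factor_2 z p - 1) \<le> 5 * real p powr (- 2 * Re z)"
  proof (cases "prime p \<and> p mod 3 = 2")
    case True
    then have "norm (factor_2 z p - 1) = norm x ^ 2" by (simp add: factor_2_eq x_def norm_power)
    then show ?thesis using x2 by simp
  qed (auto simp: factor_2_eq)
qed

lemma abs_convergent_factors:
  assumes "Re z > 1 / 2"
  shows "abs_convergent_prod (factor_1 z)" "abs_convergent_prod (factor_2 z)"
proof -
  have "summable (\<lambda>n. 5 * real n powr (- 2 * Re z))"
    using assms by (intro summable_mult) (simp add: summable_real_powr_iff)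
  then have "summable (\<lambda>n. norm (factor_1 z n - 1))" "summable (\<lambda>n. norm (factor_2 z n - 1))"
    by (rule summable_comparison_test'[where N = 0]; use norm_factor_minus_1[of z] assms in auto)+
  then show "abs_convergent_prod (factor_1 z)" "abs_convergent_prod (factor_2 z)"
    by (simp_all add: abs_convergent_prod_conv_summable)
qed

lemma finite_primes_le [simp]: "finite {p :: nat. prime p \<and> p \<le> N}"
  by (rule finite_subset[of _ "{..N}"]) auto

lemma prod_primes_LIMSEQ:
  fixes f :: "nat \<Rightarrow> complex"
  assumes "abs_convergent_prod f" "\<And>n. \<not> prime n \<Longrightarrow> f n = 1"
  shows "(\<lambda>N. \<Prod>p | prime p \<and> p \<le> N. f p) \<longlonglongrightarrow> prodinf f"
proof -
  have "(\<Prod>p | prime p \<and> p \<le> N. f p) = (\<Prod>p\<le>N. f p)" for N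
    using assms(2) by (intro prod.mono_neutral_left) auto
  then show ?thesis
    using convergent_prod_LIMSEQ[OF abs_convergent_prod_imp_convergent_prod[OF assms(1)]] by simp
qed

text \<open>
  The Euler factor of the height zeta function is the square of that of the Dedekind zeta function up to a
  correction. At \<open>p \<equiv> 1\<close> the reason is the identity \<open>1 - 3 x\<^sup>2 + 2 x\<^sup>3 = (1 - x)\<^sup>2 (1 + 2 x)\<close>; at \<open>p = 3\<close>, where
  there are no points to count, the correction removes the factor.
\<close>

lemma point_factor_eq:
  assumes p: "prime p" and x: "norm (npow z p) < 1"
  shows "point_factor p (npow z p) =
    (if p = 3 then (1 - npow z 3)\<^sup>2 else 1) * (ideal_factor p (npow z p))\<^sup>2 * factor_2 z p * factor_1 z p"
  using p
proof (cases rule: prime_mod_3_cases)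
  case 1
  then have "1 - npow z 3 \<noteq> 0" using x by auto
  then show ?thesis using 1 by (simp add: point_factor_def ideal_factor_def factor_1_eq factor_2_eq power_one_over)
next
  case 2
  define y where "y = npow z p"
  have y: "1 - y \<noteq> 0" using x by (auto simp: y_def)
  have "1 - 3 * y ^ 2 + 2 * y ^ 3 = (1 + 2 * y) * (1 - y)\<^sup>2"
    by (simp add: power2_eq_square power3_eq_cube algebra_simps)
  then have "(1 / (1 - y)\<^sup>2)\<^sup>2 * (1 - 3 * y ^ 2 + 2 * y ^ 3) = (1 + 2 * y) / (1 - y)\<^sup>2"
    using y by (simp add: power2_eq_square)
  then show ?thesis using 2 p by (simp add: point_factor_def ideal_factor_def factor_1_eq factor_2_eq y_def)
next
  case 3
  define y where "y = npow z p"
  have "norm (y\<^sup>2) < 1" using x by (simp add: y_def norm_power power_less_one_iff abs_square_less_1)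
  then have "1 - y\<^sup>2 \<noteq> 0" by auto
  then have "(1 / (1 - y\<^sup>2))\<^sup>2 * (1 - y\<^sup>2) = 1 / (1 - y\<^sup>2)" by (simp add: power2_eq_square)
  then show ?thesis using 3 p by (simp add: point_factor_def ideal_factor_def factor_1_eq factor_2_eq y_def)
qed

definition ideal_series :: "complex \<Rightarrow> complex" where
  "ideal_series z = (\<Sum>\<^sub>\<infinity>n. of_nat (eis_count n) * npow z n)"

definition point_series :: "complex \<Rightarrow> complex" where
  "point_series z = (\<Sum>\<^sub>\<infinity>n. of_nat (point_count n) * npow z n)"

definition zeta_series :: "complex \<Rightarrow> complex" where
  "zeta_series z = (\<Sum>\<^sub>\<infinity>n. npow z n)"

definition chi3_series :: "complex \<Rightarrow> complex" where
  "chi3_series z = (\<Sum>\<^sub>\<infinity>n. chi3 n * npow z n)"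

lemma summable_zeta_series: "Re z > 10 \<Longrightarrow> npow z summable_on UNIV"
  using summable_npow_bound[of "\<lambda>_. 1" 1 0 z] by simp

lemma summable_chi3_series: "Re z > 10 \<Longrightarrow> (\<lambda>n. chi3 n * npow z n) summable_on UNIV"
proof -
  assume z: "Re z > 10"
  have "(\<lambda>n. norm (npow z n)) summable_on UNIV"
    by (rule iffD1[OF summable_on_iff_abs_summable_on_complex summable_zeta_series[OF z]])
  then have "(\<lambda>n. norm (chi3 n * npow z n)) summable_on UNIV"
    by (rule Infinite_Sum.abs_summable_on_comparison_test')
       (use norm_chi3_le in \<open>auto simp: norm_mult intro: mult_left_le_one_le\<close>)
  then show ?thesis by (rule abs_summable_summable)
qed

lemma dirichlet_euler_product:
  fixes c :: "nat \<Rightarrow> complex"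
  assumes mult: "\<And>m n. coprime m n \<Longrightarrow> m > 0 \<Longrightarrow> n > 0 \<Longrightarrow> c (m * n) = c m * c n"
    and c1: "c 1 = 1" and summ: "(\<lambda>n. c n * npow z n) summable_on UNIV"
    and factor: "\<And>p. prime p \<Longrightarrow> (\<lambda>k. c (p ^ k) * npow z p ^ k) sums L p"
  shows "(\<lambda>N. \<Prod>p | prime p \<and> p \<le> N. L p) \<longlonglongrightarrow> (\<Sum>\<^sub>\<infinity>n. c n * npow z n)"
proof -
  have "(\<lambda>N. \<Prod>p | prime p \<and> p \<le> N. \<Sum>\<^sub>\<infinity>k. c (p ^ k) * npow z (p ^ k)) \<longlonglongrightarrow> (\<Sum>\<^sub>\<infinity>n. c n * npow z n)"
    using c1 by (intro euler_product[OF _ _ _ summ]) (simp_all add: mult npow_mult)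
  also have "(\<lambda>N. \<Prod>p | prime p \<and> p \<le> N. \<Sum>\<^sub>\<infinity>k. c (p ^ k) * npow z (p ^ k)) = (\<lambda>N. \<Prod>p | prime p \<and> p \<le> N. L p)"
    by (intro ext prod.cong refl infsum_prime_powers[OF summ]) (simp_all add: factor npow_power)
  finally show ?thesis .
qed

lemma ideal_series_euler:
  assumes z: "Re z > 10"
  shows "(\<lambda>N. \<Prod>p | prime p \<and> p \<le> N. ideal_factor p (npow z p)) \<longlonglongrightarrow> ideal_series z"
  unfolding ideal_series_def
proof (rule dirichlet_euler_product[OF _ _ summable_eis_count[OF z]])
  fix p :: nat assume "prime p"
  then show "(\<lambda>k. of_nat (eis_count (p ^ k)) * npow z p ^ k) sums ideal_factor p (npow z p)"
    using z by (intro sums_ideal_factor norm_npow_less_1) auto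
qed (simp_all add: eis_count_mult)

lemma point_series_euler:
  assumes z: "Re z > 10"
  shows "(\<lambda>N. \<Prod>p | prime p \<and> p \<le> N. point_factor p (npow z p)) \<longlonglongrightarrow> point_series z"
  unfolding point_series_def
proof (rule dirichlet_euler_product[OF _ _ summable_point_count[OF z]])
  fix p :: nat assume "prime p"
  then show "(\<lambda>k. of_nat (point_count (p ^ k)) * npow z p ^ k) sums point_factor p (npow z p)"
    using z by (intro sums_point_factor norm_npow_less_1) auto
qed (simp_all add: point_count_mult)

lemma zeta_series_euler:
  assumes z: "Re z > 10"
  shows "(\<lambda>N. \<Prod>p | prime p \<and> p \<le> N. 1 / (1 - npow z p)) \<longlonglongrightarrow> zeta_series z"
proof -
  have "(\<lambda>N. \<Prod>p | prime p \<and> p \<le> N. 1 / (1 - npow z p)) \<longlonglongrightarrow> (\<Sum>\<^sub>\<infinity>n. 1 * npow z n)"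
    by (rule dirichlet_euler_product) (use z summable_zeta_series in \<open>auto intro!: geometric_sums norm_npow_less_1\<close>)
  then show ?thesis by (simp add: zeta_series_def)
qed

lemma chi3_series_euler:
  assumes z: "Re z > 10"
  shows "(\<lambda>N. \<Prod>p | prime p \<and> p \<le> N. 1 / (1 - chi3 p * npow z p)) \<longlonglongrightarrow> chi3_series z"
  unfolding chi3_series_def
proof (rule dirichlet_euler_product[OF _ _ summable_chi3_series[OF z]])
  fix p :: nat assume p: "prime p"
  have "norm (chi3 p * npow z p) \<le> 1 * norm (npow z p)"
    unfolding norm_mult by (intro mult_right_mono norm_chi3_le) auto
  then have "norm (chi3 p * npow z p) < 1" using norm_npow_less_1[OF p, of z] z by simp
  then show "(\<lambda>k. chi3 (p ^ k) * npow z p ^ k) sums (1 / (1 - chi3 p * npow z p))"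
    unfolding chi3_power power_mult_distrib[symmetric] by (rule geometric_sums)
qed (simp_all add: chi3_mult)

lemma point_series_eq:
  assumes z: "Re z > 10"
  shows "point_series z = (1 - npow z 3)\<^sup>2 * (ideal_series z)\<^sup>2 * prodinf (factor_2 z) * prodinf (factor_1 z)"
proof -
  let ?P = "\<lambda>N. {p :: nat. prime p \<and> p \<le> N}"
  define R where "R N = (1 - npow z 3)\<^sup>2 * (\<Prod>p\<in>?P N. ideal_factor p (npow z p))\<^sup>2 * (\<Prod>p\<in>?P N. factor_2 z p) *
     (\<Prod>p\<in>?P N. factor_1 z p)" for N
  have conv: "abs_convergent_prod (factor_1 z)" "abs_convergent_prod (factor_2 z)"
    using abs_convergent_factors[of z] z by auto
  have lim: "(\<lambda>N. \<Prod>p\<in>?P N. factor_1 z p) \<longlonglongrightarrow> prodinf (factor_1 z)"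
    "(\<lambda>N. \<Prod>p\<in>?P N. factor_2 z p) \<longlonglongrightarrow> prodinf (factor_2 z)"
    by (rule prod_primes_LIMSEQ[OF conv(1)], simp add: factor_1_def)
       (rule prod_primes_LIMSEQ[OF conv(2)], simp add: factor_2_def)
  have "R \<longlonglongrightarrow> (1 - npow z 3)\<^sup>2 * (ideal_series z)\<^sup>2 * prodinf (factor_2 z) * prodinf (factor_1 z)"
    unfolding R_def by (intro tendsto_intros ideal_series_euler[OF z] lim)
  moreover have "(\<Prod>p\<in>?P N. point_factor p (npow z p)) = R N" if "N \<ge> 3" for N
  proof -
    have "(\<Prod>p\<in>?P N. point_factor p (npow z p)) =
        (\<Prod>p\<in>?P N. (if p = 3 then (1 - npow z 3)\<^sup>2 else 1) * (ideal_factor p (npow z p))\<^sup>2 * factor_2 z p * factor_1 z p)"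
      using z by (intro prod.cong refl point_factor_eq norm_npow_less_1) auto
    also have "\<dots> = (\<Prod>p\<in>?P N. if p = 3 then (1 - npow z 3)\<^sup>2 else 1) * (\<Prod>p\<in>?P N. ideal_factor p (npow z p))\<^sup>2 *
        (\<Prod>p\<in>?P N. factor_2 z p) * (\<Prod>p\<in>?P N. factor_1 z p)"
      by (simp only: prod.distrib prod_power_distrib)
    also have "(\<Prod>p\<in>?P N. if p = 3 then (1 - npow z 3)\<^sup>2 else 1) = (1 - npow z 3)\<^sup>2"
      using that by (simp add: prod.delta)
    finally show ?thesis by (simp add: R_def)
  qed
  then have "eventually (\<lambda>N. R N = (\<Prod>p\<in>?P N. point_factor p (npow z p))) sequentially"
    by (intro eventually_sequentiallyI[of 3]) simp
  ultimately have "(\<lambda>N. \<Prod>p\<in>?P N. point_factor p (npow z p)) \<longlonglongrightarrow>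
      (1 - npow z 3)\<^sup>2 * (ideal_series z)\<^sup>2 * prodinf (factor_2 z) * prodinf (factor_1 z)"
    by (rule Lim_transform_eventually)
  then show ?thesis using point_series_euler[OF z] LIMSEQ_unique by blast
qed

text \<open>
  At a split prime the factor of the Dedekind zeta function is \<open>1/(1 - x)\<^sup>2\<close>, at an inert one \<open>1/((1 - x) (1 + x))\<close>. In both
  cases this is the product of the factors of \<open>\<zeta>\<close> and of the \<open>L\<close>-series.
\<close>

lemma ideal_series_eq:
  assumes z: "Re z > 10"
  shows "ideal_series z = zeta_series z * chi3_series z"
proof -
  have factor: "1 / (1 - npow z p) * (1 / (1 - chi3 p * npow z p)) = ideal_factor p (npow z p)" if "prime p" for p
    using that
  proof (cases rule: prime_mod_3_cases)
    case 3
    have "1 - (npow z p)\<^sup>2 = (1 - npow z p) * (1 + npow z p)" by (simp add: power2_eq_square algebra_simps)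
    then show ?thesis using 3 by (simp add: ideal_factor_def chi3_def)
  qed (auto simp: ideal_factor_def chi3_def power2_eq_square)
  have "(\<lambda>N. \<Prod>p | prime p \<and> p \<le> N. 1 / (1 - npow z p) * (1 / (1 - chi3 p * npow z p))) \<longlonglongrightarrow>
      zeta_series z * chi3_series z"
    unfolding prod.distrib by (intro tendsto_mult zeta_series_euler chi3_series_euler z)
  also have "(\<lambda>N. \<Prod>p | prime p \<and> p \<le> N. 1 / (1 - npow z p) * (1 / (1 - chi3 p * npow z p))) =
      (\<lambda>N. \<Prod>p | prime p \<and> p \<le> N. ideal_factor p (npow z p))"
    by (intro ext prod.cong refl factor) simp
  finally show ?thesis by (rule LIMSEQ_unique[OF ideal_series_euler[OF z]])
qed

section \<open>Analytic continuation\<close>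

lemma holomorphic_on_suminf:
  fixes f :: "nat \<Rightarrow> complex \<Rightarrow> complex"
  assumes U: "open U" and hol: "\<And>n. f n holomorphic_on U"
    and bound: "\<And>x. x \<in> U \<Longrightarrow> \<exists>d>0. cball x d \<subseteq> U \<and> (\<exists>M. summable M \<and> (\<forall>n. \<forall>y\<in>cball x d. norm (f n y) \<le> M n))"
  shows "(\<lambda>x. \<Sum>n. f n x) holomorphic_on U"
proof (rule holomorphic_uniform_sequence[OF U])
  show "(\<lambda>x. \<Sum>n<N. f n x) holomorphic_on U" for N by (intro holomorphic_intros hol)
  fix x assume "x \<in> U"
  then obtain d M where "d > 0" "cball x d \<subseteq> U" "summable M" "\<And>n y. y \<in> cball x d \<Longrightarrow> norm (f n y) \<le> M n"
    using bound by meson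
  then show "\<exists>d>0. cball x d \<subseteq> U \<and> uniform_limit (cball x d) (\<lambda>N x. \<Sum>n<N. f n x) (\<lambda>x. \<Sum>n. f n x) sequentially"
    using Weierstrass_m_test[of "cball x d" f M] by blast
qed

lemma holomorphic_on_prodinf:
  fixes f :: "nat \<Rightarrow> complex \<Rightarrow> complex"
  assumes U: "open U" and hol: "\<And>n. f n holomorphic_on U"
    and bound: "\<And>x. x \<in> U \<Longrightarrow> \<exists>d>0. cball x d \<subseteq> U \<and> (\<exists>M. summable M \<and> (\<forall>n. \<forall>y\<in>cball x d. norm (f n y - 1) \<le> M n))"
  shows "(\<lambda>x. \<Prod>n. f n x) holomorphic_on U"
proof (rule holomorphic_uniform_sequence[OF U])
  show "(\<lambda>x. \<Prod>n<N. f n x) holomorphic_on U" for N by (intro holomorphic_intros hol)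
  fix x assume "x \<in> U"
  then obtain d M where d: "d > 0" "cball x d \<subseteq> U" and M: "summable M" "\<And>n y. y \<in> cball x d \<Longrightarrow> norm (f n y - 1) \<le> M n"
    using bound by meson
  have "uniformly_convergent_on (cball x d) (\<lambda>N x. \<Sum>n<N. norm (f n x - 1))"
    using Weierstrass_m_test[of "cball x d" "\<lambda>n y. norm (f n y - 1)" M] M
    by (auto simp: uniformly_convergent_on_def)
  moreover have "continuous_on (cball x d) (f n)" for n
    using hol d holomorphic_on_imp_continuous_on holomorphic_on_subset by blast
  ultimately have "uniformly_convergent_on (cball x d) (\<lambda>N x. \<Prod>n<N. f n x)"
    by (intro uniformly_convergent_on_prod') auto
  then obtain l where l: "uniform_limit (cball x d) (\<lambda>N x. \<Prod>n<N. f n x) l sequentially"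
    by (auto simp: uniformly_convergent_on_def)
  have "l y = (\<Prod>n. f n y)" if y: "y \<in> cball x d" for y
  proof -
    have "summable (\<lambda>n. norm (f n y - 1))" by (rule summable_comparison_test'[OF M(1), where N = 0]) (use M(2) y in auto)
    then have "convergent_prod (\<lambda>n. f n y)"
      by (intro abs_convergent_prod_imp_convergent_prod summable_imp_abs_convergent_prod)
    then have "(\<lambda>N. \<Prod>n\<le>N. f n y) \<longlonglongrightarrow> (\<Prod>n. f n y)" by (rule convergent_prod_LIMSEQ)
    moreover have "(\<lambda>N. \<Prod>n<N. f n y) \<longlonglongrightarrow> l y" using l y by (rule tendsto_uniform_limitI)
    then have "(\<lambda>N. \<Prod>n\<le>N. f n y) \<longlonglongrightarrow> l y" unfolding lessThan_Suc_atMost[symmetric] by (rule LIMSEQ_Suc)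
    ultimately show ?thesis by (rule LIMSEQ_unique[symmetric])
  qed
  then have "uniform_limit (cball x d) (\<lambda>N x. \<Prod>n<N. f n x) (\<lambda>x. \<Prod>n. f n x) sequentially"
    using l by (subst uniform_limit_cong'[where g = "\<lambda>N x. \<Prod>n<N. f n x" and i = l]) auto
  then show "\<exists>d>0. cball x d \<subseteq> U \<and> uniform_limit (cball x d) (\<lambda>N x. \<Prod>n<N. f n x) (\<lambda>x. \<Prod>n. f n x) sequentially"
    using d by blast
qed

lemma open_Re_gt: "open {z. Re z > c}"
  by (rule open_halfspace_Re_gt)

lemma cball_Re_bounds:
  assumes "y \<in> cball x d"
  shows "Re y \<ge> Re x - d" "norm y \<le> norm x + d"
proof -
  have "norm (x - y) \<le> d" using assms by (simp add: dist_norm)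
  then show "Re y \<ge> Re x - d" "norm y \<le> norm x + d"
    using abs_Re_le_cmod[of "x - y"] norm_triangle_ineq2[of y x] by (auto simp: norm_minus_commute)
qed

lemma holomorphic_factor_products:
  "(\<lambda>z. prodinf (factor_1 z)) holomorphic_on {z. Re z > 1 / 2}"
  "(\<lambda>z. prodinf (factor_2 z)) holomorphic_on {z. Re z > 1 / 2}"
proof -
  have bound: "\<exists>d>0. cball x d \<subseteq> {z. Re z > 1 / 2} \<and> (\<exists>M. summable M \<and> (\<forall>n. \<forall>y\<in>cball x d. norm (f y n - 1) \<le> M n))"
    if x: "x \<in> {z. Re z > 1 / 2}" and f: "\<And>z n. Re z \<ge> 0 \<Longrightarrow> norm (f z n - 1) \<le> 5 * real n powr (- 2 * Re z)"
    for x and f :: "complex \<Rightarrow> nat \<Rightarrow> complex"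
  proof -
    define d where "d = (Re x - 1 / 2) / 2"
    have d: "d > 0" using x by (simp add: d_def)
    have Re: "Re y \<ge> 1 / 2 + d" if "y \<in> cball x d" for y
      using cball_Re_bounds(1)[OF that] by (simp add: d_def field_simps)
    have "norm (f y n - 1) \<le> 5 * real n powr (- 2 * (1 / 2 + d))" if "y \<in> cball x d" for y n
    proof (cases "n = 0")
      case False
      have "norm (f y n - 1) \<le> 5 * real n powr (- 2 * Re y)" using f[of y n] Re[OF that] d by auto
      also have "\<dots> \<le> 5 * real n powr (- 2 * (1 / 2 + d))"
        by (rule mult_left_mono[OF powr_mono]) (use Re[OF that] False in auto)
      finally show ?thesis .
    qed (use f[of y n] Re[OF that] d in auto)
    moreover have "summable (\<lambda>n. 5 * real n powr (- 2 * (1 / 2 + d)))"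
      using d by (intro summable_mult) (simp add: summable_real_powr_iff)
    moreover have "cball x d \<subseteq> {z. Re z > 1 / 2}" using Re d by force
    ultimately show ?thesis using d by blast
  qed
  have np: "(\<lambda>z. npow z n) holomorphic_on A" for n A
    by (cases "n = 0") (auto simp: npow_def[abs_def] intro!: holomorphic_intros)
  show "(\<lambda>z. prodinf (factor_1 z)) holomorphic_on {z. Re z > 1 / 2}"
  proof (rule holomorphic_on_prodinf[of _ "\<lambda>n z. factor_1 z n", OF open_Re_gt])
    show "(\<lambda>z. factor_1 z n) holomorphic_on {z. Re z > 1 / 2}" for n
      unfolding factor_1_eq by (cases "prime n \<and> n mod 3 = 1") (auto intro!: holomorphic_intros np)
  qed (rule bound[of _ factor_1], assumption, rule norm_factor_minus_1(1))
  show "(\<lambda>z. prodinf (factor_2 z)) holomorphic_on {z. Re z > 1 / 2}"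
  proof (rule holomorphic_on_prodinf[of _ "\<lambda>n z. factor_2 z n", OF open_Re_gt])
    show "(\<lambda>z. factor_2 z n) holomorphic_on {z. Re z > 1 / 2}" for n
      unfolding factor_2_eq by (cases "prime n \<and> n mod 3 = 2") (auto intro!: holomorphic_intros np)
  qed (rule bound[of _ factor_2], assumption, rule norm_factor_minus_1(2))
qed


lemma segment_of_reals:
  assumes "t \<in> closed_segment (of_real a) (of_real (a + 1) :: complex)"
  obtains u where "t = of_real u" "u \<ge> a"
proof -
  obtain v where v: "0 \<le> v" "t = (1 - v) *\<^sub>R of_real a + v *\<^sub>R of_real (a + 1)"
    using assms by (auto simp: in_segment)
  then have t: "t = of_real (a + v)" by (simp add: scaleR_conv_of_real algebra_simps)
  show ?thesis by (rule that[OF t]) (use v in simp)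
qed

lemma powr_derivative_bound:
  assumes "a > 0" "Re z \<ge> 0" "t \<in> closed_segment (of_real a) (of_real (a + 1) :: complex)"
  shows "t \<notin> \<real>\<^sub>\<le>\<^sub>0" "norm (t powr (- z - 1)) \<le> a powr (- Re z - 1)"
proof -
  obtain u where u: "t = of_real u" "u \<ge> a" using assms(3) by (rule segment_of_reals)
  show "t \<notin> \<real>\<^sub>\<le>\<^sub>0" using u assms by auto
  have "norm (t powr (- z - 1)) = u powr (- Re z - 1)" using u assms by (simp add: norm_powr_real_powr)
  also have "\<dots> \<le> a powr (- Re z - 1)" using u assms by (intro powr_mono2') auto
  finally show "norm (t powr (- z - 1)) \<le> a powr (- Re z - 1)" .
qed

lemma norm_powr_diff_bound:
  assumes "a > 0" "Re z \<ge> 0"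
  shows "norm (of_real a powr (- z) - of_real (a + 1) powr (- z)) \<le> norm z * a powr (- Re z - 1)"
proof -
  let ?S = "closed_segment (of_real a) (of_real (a + 1) :: complex)"
  have "norm (of_real a powr (- z) - of_real (a + 1) powr (- z)) \<le>
      (norm z * a powr (- Re z - 1)) * norm (of_real a - of_real (a + 1) :: complex)"
  proof (rule field_differentiable_bound[where S = ?S and f = "\<lambda>t. t powr (- z)" and f' = "\<lambda>t. - z * t powr (- z - 1)"])
    fix t assume t: "t \<in> ?S"
    show "((\<lambda>t. t powr (- z)) has_field_derivative - z * t powr (- z - 1)) (at t within ?S)"
      by (rule has_field_derivative_at_within[OF has_field_derivative_powr[OF powr_derivative_bound(1)[OF assms t]]])
    show "norm (- z * t powr (- z - 1)) \<le> norm z * a powr (- Re z - 1)"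
      unfolding norm_mult norm_minus_cancel by (intro mult_left_mono powr_derivative_bound[OF assms t]) auto
  qed auto
  then show ?thesis by (simp flip: of_real_diff)
qed

lemma norm_powr_taylor_bound:
  assumes "a > 0" "Re z \<ge> 0"
  shows "norm (of_real (a + 1) powr (1 - z) - of_real a powr (1 - z) - (1 - z) * of_real a powr (- z)) \<le>
    norm (1 - z) * norm z * a powr (- Re z - 1)"
proof -
  let ?S = "closed_segment (of_real a) (of_real (a + 1) :: complex)"
  define f :: "nat \<Rightarrow> complex \<Rightarrow> complex" where
    "f i t = (if i = 0 then t powr (1 - z) else if i = 1 then (1 - z) * t powr (- z) else (1 - z) * (- z * t powr (- z - 1)))" for i t
  have "norm (f 0 (of_real (a + 1)) - (\<Sum>i\<le>1. f i (of_real a) * (of_real (a + 1) - of_real a) ^ i / fact i)) \<le>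
      (norm (1 - z) * norm z * a powr (- Re z - 1)) * norm (of_real (a + 1) - of_real a :: complex) ^ (Suc 1) / fact 1"
  proof (rule complex_Taylor[where S = ?S])
    fix i t assume t: "t \<in> ?S" and i: "i \<le> (1 :: nat)"
    have nt: "t \<notin> \<real>\<^sub>\<le>\<^sub>0" using powr_derivative_bound[OF assms t] by simp
    have 0: "((\<lambda>t. t powr (1 - z)) has_field_derivative (1 - z) * t powr (- z)) (at t within ?S)"
      using has_field_derivative_at_within[OF has_field_derivative_powr[OF nt, of "1 - z"]] by simp
    have 1: "((\<lambda>t. (1 - z) * t powr (- z)) has_field_derivative (1 - z) * (- z * t powr (- z - 1))) (at t within ?S)"
      by (rule DERIV_cmult[OF has_field_derivative_at_within[OF has_field_derivative_powr[OF nt]]])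
    have "i = 0 \<or> i = 1" using i by auto
    then show "(f i has_field_derivative f (Suc i) t) (at t within ?S)"
      using 0 1 by (auto simp: f_def[abs_def])
  next
    fix t assume t: "t \<in> ?S"
    have "norm (f (Suc 1) t) = norm (1 - z) * norm z * norm (t powr (- z - 1))" by (simp add: f_def norm_mult)
    also have "\<dots> \<le> norm (1 - z) * norm z * a powr (- Re z - 1)"
      by (intro mult_left_mono powr_derivative_bound[OF assms t]) auto
    finally show "norm (f (Suc 1) t) \<le> norm (1 - z) * norm z * a powr (- Re z - 1)" .
  qed auto
  then show ?thesis by (simp add: f_def algebra_simps flip: of_real_diff)
qed

lemma summable_Suc_powr: "d > 0 \<Longrightarrow> summable (\<lambda>n. real (Suc n) powr (- d - 1))"
  using summable_real_powr_iff[of "- d - 1"] by (subst summable_Suc_iff) simp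

text \<open>
  A bound \<open>O(n\<^bsup>-Re z-1\<^esup>)\<close> that is uniform on bounded sets suffices for convergence and holomorphy on \<open>Re z > 0\<close>.
\<close>

lemma power_bounded_series:
  fixes f :: "nat \<Rightarrow> complex \<Rightarrow> complex"
  assumes hol: "\<And>n. f n holomorphic_on {z. Re z > 0}"
    and bound: "\<And>n z. Re z > 0 \<Longrightarrow> norm (f n z) \<le> (1 + norm z) * norm z * real (Suc n) powr (- Re z - 1)"
  shows "(\<lambda>z. \<Sum>n. f n z) holomorphic_on {z. Re z > 0}"
    and "Re z > 0 \<Longrightarrow> summable (\<lambda>n. f n z)"
proof -
  show "(\<lambda>z. \<Sum>n. f n z) holomorphic_on {z. Re z > 0}"
  proof (rule holomorphic_on_suminf[OF open_Re_gt hol])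
    fix x assume "x \<in> {z. Re z > 0}"
    then have x: "Re x > 0" by simp
    define d where "d = Re x / 2"
    define R where "R = norm x + d"
    have d: "d > 0" and Rex: "Re x - d = d" using x by (simp_all add: d_def)
    have "norm (f n y) \<le> (1 + R) * R * real (Suc n) powr (- d - 1)" if y: "y \<in> cball x d" for n y
    proof -
      have Re: "Re y \<ge> d" and nm: "norm y \<le> R" using cball_Re_bounds[OF y] Rex by (simp_all add: R_def)
      have "norm (f n y) \<le> (1 + norm y) * norm y * real (Suc n) powr (- Re y - 1)" using bound Re d by simp
      also have "\<dots> \<le> (1 + R) * R * real (Suc n) powr (- d - 1)"
        using Re nm d order_trans[OF norm_ge_zero nm] by (intro mult_mono powr_mono mult_nonneg_nonneg) auto
      finally show ?thesis .
    qed
    moreover have "summable (\<lambda>n. (1 + R) * R * real (Suc n) powr (- d - 1))"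
      by (intro summable_mult summable_Suc_powr d)
    moreover have "cball x d \<subseteq> {z. Re z > 0}" using cball_Re_bounds(1)[of _ x d] Rex d by force
    ultimately show "\<exists>d>0. cball x d \<subseteq> {z. Re z > 0} \<and> (\<exists>M. summable M \<and> (\<forall>n. \<forall>y\<in>cball x d. norm (f n y) \<le> M n))"
      using d by blast
  qed
  show "summable (\<lambda>n. f n z)" if "Re z > 0"
    by (rule summable_comparison_test'[OF summable_mult[OF summable_Suc_powr[OF that]], of 0]) (rule bound[OF that])
qed

lemma npow_alt: "npow z n = of_nat n powr (- z)"
  by (simp add: npow_def powr_minus_divide)

lemma holomorphic_npow [holomorphic_intros]:
  "f holomorphic_on A \<Longrightarrow> (\<lambda>z. npow (f z) n) holomorphic_on A"
  unfolding npow_alt by (intro holomorphic_intros)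

text \<open>
  With \<open>f(t) = t\<^sup>1\<^sup>-\<^sup>z\<close>, the \<open>n\<close>-th term below is \<open>f(n + 1) - f(n) - f'(n)\<close>, hence \<open>O(n\<^sup>-\<^sup>z\<^sup>-\<^sup>1)\<close>: the series
  converges for \<open>Re z > 0\<close>, and it sums to \<open>(z - 1) \<zeta>(z)\<close> where the Dirichlet series converges.
\<close>

definition zeta_term :: "nat \<Rightarrow> complex \<Rightarrow> complex" where
  "zeta_term n z = of_nat (Suc (Suc n)) powr (1 - z) - of_nat (Suc n) powr (1 - z) - (1 - z) * npow z (Suc n)"

definition zeta_cont :: "complex \<Rightarrow> complex" where
  "zeta_cont z = 1 + (\<Sum>n. zeta_term n z)"

lemma zeta_term_bound:
  assumes "Re z > 0"
  shows "norm (zeta_term n z) \<le> (1 + norm z) * norm z * real (Suc n) powr (- Re z - 1)"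
proof -
  have "norm (zeta_term n z) \<le> norm (1 - z) * norm z * real (Suc n) powr (- Re z - 1)"
    using norm_powr_taylor_bound[of "real (Suc n)" z] assms by (simp add: zeta_term_def npow_alt algebra_simps)
  also have "\<dots> \<le> (1 + norm z) * norm z * real (Suc n) powr (- Re z - 1)"
    using norm_triangle_ineq4[of 1 z] by (intro mult_right_mono) auto
  finally show ?thesis .
qed

lemma holomorphic_zeta_term: "zeta_term n holomorphic_on A"
  unfolding zeta_term_def[abs_def] by (intro holomorphic_intros)

lemma holomorphic_zeta_cont: "zeta_cont holomorphic_on {z. Re z > 0}"
  unfolding zeta_cont_def[abs_def]
  by (intro holomorphic_intros power_bounded_series(1) holomorphic_zeta_term zeta_term_bound)

lemma zeta_cont_1: "zeta_cont 1 = 1"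
proof -
  have "zeta_term n 1 = 0" for n by (simp add: zeta_term_def del: of_nat_Suc)
  then show ?thesis by (simp add: zeta_cont_def)
qed

lemma sums_of_infsum_Suc:
  fixes f :: "nat \<Rightarrow> complex"
  assumes "f summable_on UNIV" "f 0 = 0"
  shows "(\<lambda>n. f (Suc n)) sums infsum f UNIV"
proof -
  have "f sums infsum f UNIV" using assms(1) by (intro has_sum_imp_sums has_sum_infsum)
  then show ?thesis using assms(2) by (simp add: sums_Suc_iff)
qed

lemma zeta_cont_eq:
  assumes z: "Re z > 10"
  shows "zeta_cont z = (z - 1) * zeta_series z"
proof -
  have "(\<lambda>n. npow z (Suc n)) sums zeta_series z"
    unfolding zeta_series_def by (intro sums_of_infsum_Suc summable_zeta_series z) simp
  then have 1: "(\<lambda>n. (z - 1) * npow z (Suc n)) sums ((z - 1) * zeta_series z)" by (rule sums_mult)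
  have "(\<lambda>n. of_nat (Suc n) powr (1 - z)) \<longlonglongrightarrow> 0"
    by (rule tendsto_neg_powr_complex_of_nat) (use z in \<open>auto simp: filterlim_Suc\<close>)
  then have 2: "(\<lambda>n. of_nat (Suc (Suc n)) powr (1 - z) - of_nat (Suc n) powr (1 - z)) sums (0 - of_nat (Suc 0) powr (1 - z))"
    by (rule telescope_sums)
  have "(\<lambda>n. of_nat (Suc (Suc n)) powr (1 - z) - of_nat (Suc n) powr (1 - z) + (z - 1) * npow z (Suc n)) sums
      (0 - of_nat (Suc 0) powr (1 - z) + (z - 1) * zeta_series z)"
    using 2 1 by (rule sums_add)
  also have "(\<lambda>n. of_nat (Suc (Suc n)) powr (1 - z) - of_nat (Suc n) powr (1 - z) + (z - 1) * npow z (Suc n)) = (\<lambda>n. zeta_term n z)"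
    by (simp add: zeta_term_def algebra_simps)
  finally show ?thesis by (simp add: zeta_cont_def sums_unique[symmetric])
qed

definition chi3_term :: "nat \<Rightarrow> complex \<Rightarrow> complex" where
  "chi3_term n z = npow z (3 * n + 1) - npow z (3 * n + 2)"

definition chi3_cont :: "complex \<Rightarrow> complex" where
  "chi3_cont z = (\<Sum>n. chi3_term n z)"

lemma chi3_term_bound:
  assumes "Re z > 0"
  shows "norm (chi3_term n z) \<le> (1 + norm z) * norm z * real (Suc n) powr (- Re z - 1)"
proof -
  have "norm (chi3_term n z) \<le> norm z * real (3 * n + 1) powr (- Re z - 1)"
    using norm_powr_diff_bound[of "real (3 * n + 1)" z] assms by (simp add: chi3_term_def npow_alt add.commute)
  also have "\<dots> \<le> norm z * real (Suc n) powr (- Re z - 1)"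
    by (rule mult_left_mono[OF powr_mono2']) (use assms in auto)
  also have "\<dots> \<le> (1 + norm z) * norm z * real (Suc n) powr (- Re z - 1)"
    by (intro mult_right_mono) (auto simp: algebra_simps)
  finally show ?thesis .
qed

lemma holomorphic_chi3_term: "chi3_term n holomorphic_on A"
  unfolding chi3_term_def[abs_def] by (intro holomorphic_intros)

lemma holomorphic_chi3_cont: "chi3_cont holomorphic_on {z. Re z > 0}"
  unfolding chi3_cont_def[abs_def]
  by (intro power_bounded_series(1) holomorphic_chi3_term chi3_term_bound)

lemma chi3_cont_eq:
  assumes z: "Re z > 10"
  shows "chi3_cont z = chi3_series z"
proof -
  let ?f = "\<lambda>n. chi3 n * npow z n"
  have "?f sums chi3_series z"
    unfolding chi3_series_def by (intro has_sum_imp_sums has_sum_infsum summable_chi3_series z)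
  then have "(\<lambda>n. sum ?f {n * 3..<n * 3 + 3}) sums chi3_series z" by (rule sums_group) simp
  also have "(\<lambda>n. sum ?f {n * 3..<n * 3 + 3}) = (\<lambda>n. chi3_term n z)"
  proof
    fix n :: nat
    have "{n * 3..<n * 3 + 3} = {3 * n, 3 * n + 1, 3 * n + 2}" by auto
    moreover have "(3 * n + 1) mod 3 = 1" "(3 * n + 2) mod 3 = 2" by presburger+
    ultimately show "sum ?f {n * 3..<n * 3 + 3} = chi3_term n z" by (simp add: chi3_def chi3_term_def)
  qed
  finally show ?thesis by (simp add: chi3_cont_def sums_unique[symmetric])
qed

text \<open>\<open>L(1, \<chi>) = (1 - 1/2) + (1/4 - 1/5) + \<dots>\<close> is a sum of positive terms.\<close>

lemma chi3_cont_1: "chi3_cont 1 \<noteq> 0"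
proof -
  define g where "g n = 1 / real (3 * n + 1) - 1 / real (3 * n + 2)" for n
  have eq: "chi3_term n 1 = of_real (g n)" for n by (simp add: chi3_term_def npow_def g_def)
  have "summable (\<lambda>n. chi3_term n 1)"
    by (rule power_bounded_series(2)[OF holomorphic_chi3_term chi3_term_bound]) auto
  then have s: "summable g" unfolding eq by (simp only: summable_of_real_iff)
  have "g n > 0" for n
  proof -
    have "1 / real (3 * n + 2) < 1 / real (3 * n + 1)" by (intro divide_strict_left_mono) auto
    then show ?thesis by (simp add: g_def)
  qed
  then have "suminf g > 0" using s by (intro suminf_pos)
  moreover have "chi3_cont 1 = of_real (suminf g)" unfolding chi3_cont_def eq using s by (rule suminf_of_real[symmetric])
  ultimately show ?thesis by simp
qed

lemma factor_products_1:
  "prodinf (factor_1 1) \<noteq> 0" "prodinf (factor_2 1) \<noteq> 0"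
proof -
  have x: "norm (npow 1 p) < 1" if "prime p" for p using norm_npow_less_1[OF that, of 1] by simp
  have "factor_1 1 p \<noteq> 0" for p
  proof (cases "prime p \<and> p mod 3 = 1")
    case True
    define y where "y = npow 1 p"
    have "norm y < 1" using x True by (simp add: y_def)
    then have "1 - y \<noteq> 0" by auto
    moreover have "1 + 2 * y \<noteq> 0"
    proof -
      have "1 + 2 * y = of_real (1 + 2 / real p)" by (simp add: y_def npow_def)
      moreover have "1 + 2 / real p > 0" by (intro add_pos_nonneg) auto
      ultimately show ?thesis by (metis less_irrefl of_real_eq_0_iff)
    qed
    moreover have "factor_1 1 p = (1 + 2 * y) * (1 - y)\<^sup>2"
      using True by (simp add: factor_1_eq y_def power2_eq_square power3_eq_cube algebra_simps)
    ultimately show ?thesis by simp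
  qed (auto simp: factor_1_eq)
  then show "prodinf (factor_1 1) \<noteq> 0"
    using abs_convergent_factors(1)[of 1] by (intro prodinf_nonzero abs_convergent_prod_imp_convergent_prod) auto
  have "factor_2 1 p \<noteq> 0" for p
  proof (cases "prime p \<and> p mod 3 = 2")
    case True
    have "norm (npow 1 p ^ 2) < 1" using x True by (simp add: norm_power power_less_one_iff abs_square_less_1)
    then have "1 - npow 1 p ^ 2 \<noteq> 0" by auto
    then show ?thesis using True by (simp add: factor_2_eq)
  qed (auto simp: factor_2_eq)
  then show "prodinf (factor_2 1) \<noteq> 0"
    using abs_convergent_factors(2)[of 1] by (intro prodinf_nonzero abs_convergent_prod_imp_convergent_prod) auto
qed

text \<open>
  In \<open>z = s/2\<close>, the factor \<open>(\<zeta>(z) L(z))\<^sup>2\<close> is a holomorphic function divided by \<open>(z - 1)\<^sup>2\<close>, and all other factors are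
  holomorphic for \<open>Re z > 1/2\<close>. None of these functions vanishes at \<open>z = 1\<close>, so the pole at \<open>s = 2\<close> has order exactly \<open>2\<close>.
\<close>

theorem point_series_continuation:
  obtains F where "F meromorphic_on {s. Re s > 1}" "\<And>s. Re s > 20 \<Longrightarrow> F s = point_series (s / 2)"
    "F holomorphic_on {s. Re s > 1} - {2}" "is_pole F 2" "zorder F 2 = - 2"
proof -
  define U where "U = {s :: complex. Re s > 1}"
  define g where "g s = 4 * ((1 - npow (s / 2) 3)\<^sup>2 * (zeta_cont (s / 2) * chi3_cont (s / 2))\<^sup>2 *
    prodinf (factor_2 (s / 2)) * prodinf (factor_1 (s / 2)))" for s
  define F where "F s = g s / (s - 2) ^ 2" for s
  have U: "open U" "2 \<in> U" unfolding U_def by (auto intro: open_Re_gt)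
  have half: "(\<lambda>s. h (s / 2)) holomorphic_on U" if "h holomorphic_on {z. Re z > 1 / 2}" for h
  proof -
    have "(\<lambda>s. s / 2) holomorphic_on U" by (intro holomorphic_intros) auto
    then have "h \<circ> (\<lambda>s. s / 2) holomorphic_on U"
      by (rule holomorphic_on_compose_gen[OF _ that]) (auto simp: U_def)
    then show ?thesis by (simp add: o_def)
  qed
  have "{z. Re z > 1 / 2} \<subseteq> {z. Re z > 0}" by auto
  then have hol: "zeta_cont holomorphic_on {z. Re z > 1 / 2}" "chi3_cont holomorphic_on {z. Re z > 1 / 2}"
    using holomorphic_zeta_cont holomorphic_chi3_cont holomorphic_on_subset by blast+
  have g: "g holomorphic_on U"
    unfolding g_def[abs_def] by (intro holomorphic_intros half hol holomorphic_factor_products) auto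
  have "npow 1 3 \<noteq> 1" by (simp add: npow_def)
  then have g2: "g 2 \<noteq> 0" by (simp add: g_def zeta_cont_1 chi3_cont_1 factor_products_1)
  show ?thesis
  proof
    have "g meromorphic_on U" using g U by (intro analytic_on_imp_meromorphic_on) (simp add: analytic_on_open)
    then show "F meromorphic_on {s. Re s > 1}" unfolding F_def[abs_def] U_def[symmetric]
      by (intro meromorphic_intros)
    show "F holomorphic_on {s. Re s > 1} - {2}"
      unfolding F_def[abs_def] U_def[symmetric]
      by (intro holomorphic_intros holomorphic_on_subset[OF g]) auto
    show "is_pole F 2" unfolding F_def[abs_def] by (rule is_pole_basic[OF g U g2]) simp
    show "zorder F 2 = - 2"
      by (rule zorder_eqI[OF U g g2]) (auto simp: F_def power_int_minus divide_inverse)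
    fix s :: complex assume "Re s > 20"
    then have z: "Re (s / 2) > 10" by simp
    have s2: "s / 2 - 1 \<noteq> 0" "s - 2 \<noteq> 0" using \<open>Re s > 20\<close> by auto
    have eq: "zeta_cont (s / 2) * chi3_cont (s / 2) = (s - 2) / 2 * ideal_series (s / 2)"
      unfolding zeta_cont_eq[OF z] chi3_cont_eq[OF z] ideal_series_eq[OF z]
      by (simp add: algebra_simps diff_divide_distrib)
    have "g s = (s - 2)\<^sup>2 * point_series (s / 2)"
      unfolding g_def point_series_eq[OF z] eq by (simp add: power_mult_distrib power_divide)
    then show "F s = point_series (s / 2)" using s2 by (simp add: F_def)
  qed
qed


section \<open>Rational points as evaluations of invariant polynomials\<close>

subsection \<open>Ring homomorphisms between polynomial rings\<close>

definition comm_hom :: "('a::comm_ring_1 \<Rightarrow> 'b::comm_ring_1) \<Rightarrow> bool" where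
  "comm_hom h \<longleftrightarrow> h 0 = 0 \<and> h 1 = 1 \<and> (\<forall>a b. h (a + b) = h a + h b \<and> h (a * b) = h a * h b)"

lemma comm_hom_simps:
  assumes "comm_hom h"
  shows "h 0 = 0" "h 1 = 1" "h (a + b) = h a + h b" "h (a * b) = h a * h b" "h (- a) = - h a"
    "h (a - b) = h a - h b" "h (a ^ n) = h a ^ n" "h (numeral k) = numeral k"
proof -
  show *: "h 0 = 0" "h 1 = 1" "h (a + b) = h a + h b" "h (a * b) = h a * h b" for a b
    using assms by (auto simp: comm_hom_def)
  show neg: "h (- a) = - h a" for a using *(1) *(3)[of "- a" a] by (simp add: eq_neg_iff_add_eq_0)
  show "h (a - b) = h a - h b" using *(3)[of a "- b"] neg[of b] by simp
  show "h (a ^ n) = h a ^ n" by (induction n) (simp_all add: *)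
  have "h (of_nat n) = of_nat n" for n by (induction n) (simp_all add: *)
  then show "h (numeral k) = numeral k" by (metis of_nat_numeral)
qed

lemma comm_hom_sum: "comm_hom h \<Longrightarrow> h (sum f A) = (\<Sum>i\<in>A. h (f i))"
  by (induction A rule: infinite_finite_induct) (simp_all add: comm_hom_simps)

lemma comm_hom_map_poly:
  assumes "comm_hom h"
  shows "comm_hom (map_poly h)"
proof -
  note h = comm_hom_simps[OF assms]
  have "map_poly h (p * q) = map_poly h p * map_poly h q" for p q
    by (rule poly_eqI) (simp add: coeff_map_poly h coeff_mult comm_hom_sum[OF assms])
  moreover have "map_poly h (p + q) = map_poly h p + map_poly h q" for p q
    by (rule poly_eqI) (simp add: coeff_map_poly h)
  ultimately show ?thesis by (simp add: comm_hom_def h)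
qed

lemma comm_hom_poly: "comm_hom (\<lambda>p. poly p x)"
  by (simp add: comm_hom_def)

lemma comm_hom_comp: "comm_hom g \<Longrightarrow> comm_hom h \<Longrightarrow> comm_hom (\<lambda>x. g (h x))"
  by (simp add: comm_hom_def)

lemma comm_hom_of_rat: "comm_hom (of_rat :: rat \<Rightarrow> complex)"
  by (simp add: comm_hom_def of_rat_add of_rat_mult)

lemma comm_hom_const2: "comm_hom const2"
  by (simp add: comm_hom_def const2_def one_pCons)

lemma comm_hom_subst2: "comm_hom (\<lambda>f. subst2 f u v)"
  unfolding subst2_def
  by (rule comm_hom_comp[OF comm_hom_poly, of "map_poly (\<lambda>c. poly (map_poly const2 c) u)" v])
    (intro comm_hom_map_poly comm_hom_comp[OF comm_hom_poly] comm_hom_const2)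

lemma comm_hom_sigma: "comm_hom sigma_act"
  unfolding sigma_act_def[abs_def] by (rule comm_hom_subst2)

lemma sigma_generators:
  fixes c :: "'a::comm_ring_1"
  shows "sigma_act (const2 c) = const2 c" "sigma_act xx = (yy :: 'a poly poly)"
    "sigma_act yy = (zz :: 'a poly poly)" "sigma_act zz = (xx :: 'a poly poly)"
proof -
  have 0: "const2 0 = (0 :: 'a poly poly)" "const2 1 = (1 :: 'a poly poly)" using comm_hom_simps[OF comm_hom_const2] by auto
  show c: "sigma_act (const2 c) = const2 c"
    by (simp add: sigma_act_def subst2_def const2_def[of c] map_poly_pCons 0)
  show x: "sigma_act xx = (yy :: 'a poly poly)"
    by (simp add: sigma_act_def subst2_def xx_def map_poly_pCons 0)
  show y: "sigma_act yy = (zz :: 'a poly poly)"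
    by (simp add: sigma_act_def subst2_def yy_def[where 'a='a] map_poly_pCons 0)
  have "sigma_act zz = 1 - yy - (zz :: 'a poly poly)"
    unfolding zz_def[where 'a='a] comm_hom_simps[OF comm_hom_sigma] x y by (simp add: zz_def)
  then show "sigma_act zz = (xx :: 'a poly poly)" by (simp add: zz_def)
qed

lemmas sigma_simps = comm_hom_simps[OF comm_hom_sigma] sigma_generators

definition evalc :: "complex \<Rightarrow> complex \<Rightarrow> complex poly poly \<Rightarrow> complex" where
  "evalc x y F = poly (poly F [:y:]) x"

definition rat_to_complex :: "rat poly poly \<Rightarrow> complex poly poly" where
  "rat_to_complex f = map_poly (map_poly of_rat) f"

definition evalr :: "complex \<Rightarrow> complex \<Rightarrow> rat poly poly \<Rightarrow> complex" where
  "evalr x y f = evalc x y (rat_to_complex f)"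

lemma comm_hom_evalc: "comm_hom (evalc x y)"
  by (simp add: comm_hom_def evalc_def)

lemma comm_hom_rat_to_complex: "comm_hom rat_to_complex"
  unfolding rat_to_complex_def[abs_def] by (intro comm_hom_map_poly comm_hom_of_rat)

lemma comm_hom_evalr: "comm_hom (evalr x y)"
  unfolding evalr_def[abs_def] by (intro comm_hom_comp[OF comm_hom_evalc] comm_hom_rat_to_complex)

lemma evalc_generators:
  "evalc x y (const2 c) = c" "evalc x y xx = x" "evalc x y yy = y" "evalc x y zz = 1 - x - y"
proof -
  show "evalc x y (const2 c) = c" "evalc x y xx = x" "evalc x y yy = y"
    by (simp_all add: evalc_def const2_def xx_def yy_def)
  then show "evalc x y zz = 1 - x - y" by (simp add: zz_def comm_hom_simps[OF comm_hom_evalc])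
qed

lemma rat_to_complex_generators:
  "rat_to_complex (const2 c) = const2 (of_rat c)" "rat_to_complex xx = xx" "rat_to_complex yy = yy"
  "rat_to_complex zz = zz"
proof -
  show "rat_to_complex (const2 c) = const2 (of_rat c)" "rat_to_complex xx = xx" "rat_to_complex yy = yy"
    by (simp_all add: rat_to_complex_def const2_def xx_def yy_def map_poly_pCons)
  then show "rat_to_complex zz = zz" by (simp add: zz_def comm_hom_simps[OF comm_hom_rat_to_complex])
qed

lemmas evalc_simps = comm_hom_simps[OF comm_hom_evalc] evalc_generators
lemmas rat_to_complex_simps = comm_hom_simps[OF comm_hom_rat_to_complex] rat_to_complex_generators

lemma evalr_generators:
  "evalr x y (const2 c) = of_rat c" "evalr x y xx = x" "evalr x y yy = y" "evalr x y zz = 1 - x - y"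
  by (simp_all add: evalr_def rat_to_complex_generators evalc_generators)

lemmas evalr_simps = comm_hom_simps[OF comm_hom_evalr] evalr_generators

subsection \<open>The ring of invariants\<close>

definition is_subring :: "'a::comm_ring_1 set \<Rightarrow> bool" where
  "is_subring D \<longleftrightarrow> 1 \<in> D \<and> (\<forall>a\<in>D. \<forall>b\<in>D. a - b \<in> D \<and> a * b \<in> D)"

lemma is_subring_closed:
  assumes "is_subring D"
  shows "1 \<in> D" "0 \<in> D" "a \<in> D \<Longrightarrow> b \<in> D \<Longrightarrow> a - b \<in> D" "a \<in> D \<Longrightarrow> b \<in> D \<Longrightarrow> a + b \<in> D"
    "a \<in> D \<Longrightarrow> b \<in> D \<Longrightarrow> a * b \<in> D" "a \<in> D \<Longrightarrow> a ^ n \<in> D" "numeral k \<in> D"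
proof -
  show *: "1 \<in> D" "\<And>a b. a \<in> D \<Longrightarrow> b \<in> D \<Longrightarrow> a - b \<in> D" "\<And>a b. a \<in> D \<Longrightarrow> b \<in> D \<Longrightarrow> a * b \<in> D"
    using assms by (auto simp: is_subring_def)
  show 0: "0 \<in> D" using *(2)[OF *(1) *(1)] by simp
  show add: "a + b \<in> D" if "a \<in> D" "b \<in> D" for a b
    using *(2)[OF that(1) *(2)[OF 0 that(2)]] by simp
  show "a ^ n \<in> D" if "a \<in> D" by (induction n) (simp_all add: * that)
  have "of_nat n \<in> D" for n by (induction n) (simp_all add: 0 add *)
  then show "numeral k \<in> D" by (metis of_nat_numeral)
qed

lemma is_subring_sum: "is_subring D \<Longrightarrow> (\<And>i. i \<in> A \<Longrightarrow> f i \<in> D) \<Longrightarrow> sum f A \<in> D"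
  by (induction A rule: infinite_finite_induct) (auto intro: is_subring_closed)

lemma is_subring_invariants: "is_subring invariants"
  by (simp add: is_subring_def invariants_def sigma_simps)

lemma const2_invariant: "const2 c \<in> invariants"
  by (simp add: invariants_def sigma_simps)

text \<open>
  The elementary symmetric functions \<open>e\<^sub>2\<close>, \<open>e\<^sub>3\<close> of \<open>x, y, 1 - x - y\<close> and the invariant
  \<open>x\<^sup>2 y + y\<^sup>2 z + z\<^sup>2 x\<close>, which together generate the ring of invariants.
\<close>

definition esym2 :: "'a::comm_ring_1 \<Rightarrow> 'a \<Rightarrow> 'a" where
  "esym2 x y = x * y + y * (1 - x - y) + (1 - x - y) * x"

definition esym3 :: "'a::comm_ring_1 \<Rightarrow> 'a \<Rightarrow> 'a" where
  "esym3 x y = x * y * (1 - x - y)"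

definition cyc :: "'a::comm_ring_1 \<Rightarrow> 'a \<Rightarrow> 'a" where
  "cyc x y = x\<^sup>2 * y + y\<^sup>2 * (1 - x - y) + (1 - x - y)\<^sup>2 * x"

definition orbit_sum :: "nat \<Rightarrow> nat \<Rightarrow> 'a::comm_ring_1 poly poly" where
  "orbit_sum i j = xx ^ i * yy ^ j + yy ^ i * zz ^ j + zz ^ i * xx ^ j"

lemma basic_invariants:
  "esym2 xx yy \<in> (invariants :: 'a::comm_ring_1 poly poly set)"
  "esym3 xx yy \<in> (invariants :: 'a::comm_ring_1 poly poly set)"
  "cyc xx yy \<in> (invariants :: 'a::comm_ring_1 poly poly set)"
proof -
  have z: "1 - xx - yy = (zz :: 'a poly poly)" by (simp add: zz_def)
  show "esym2 xx yy \<in> (invariants :: 'a poly poly set)" "esym3 xx yy \<in> (invariants :: 'a poly poly set)"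
    "cyc xx yy \<in> (invariants :: 'a poly poly set)"
    by (simp_all add: invariants_def esym2_def esym3_def cyc_def z sigma_simps)
qed

lemma cubic_relation:
  fixes x y :: "'a::comm_ring_1"
  shows "x ^ 3 = x ^ 2 - esym2 x y * x + esym3 x y" "y ^ 3 = y ^ 2 - esym2 x y * y + esym3 x y"
    "(1 - x - y) ^ 3 = (1 - x - y) ^ 2 - esym2 x y * (1 - x - y) + esym3 x y"
  by (simp_all add: esym2_def esym3_def power2_eq_square power3_eq_cube algebra_simps)

text \<open>
  Each of \<open>x, y, z\<close> is a root of \<open>t\<^sup>3 - t\<^sup>2 + e\<^sub>2 t - e\<^sub>3\<close>. This gives recursions that lower the exponents of
  an orbit sum \<open>x\<^sup>i y\<^sup>j + y\<^sup>i z\<^sup>j + z\<^sup>i x\<^sup>j\<close> to values below \<open>3\<close>.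
\<close>

lemma orbit_sum_rec:
  "orbit_sum (i + 3) j = orbit_sum (i + 2) j - esym2 xx yy * orbit_sum (i + 1) j + esym3 xx yy * orbit_sum i j"
  "orbit_sum i (j + 3) = orbit_sum i (j + 2) - esym2 xx yy * orbit_sum i (j + 1) + esym3 xx yy * orbit_sum i j"
proof -
  note c = cubic_relation[where x = xx and y = yy, folded zz_def]
  show "orbit_sum (i + 3) j = orbit_sum (i + 2) j - esym2 xx yy * orbit_sum (i + 1) j + esym3 xx yy * orbit_sum i j"
    unfolding orbit_sum_def power_add c by (simp add: algebra_simps power2_eq_square)
  show "orbit_sum i (j + 3) = orbit_sum i (j + 2) - esym2 xx yy * orbit_sum i (j + 1) + esym3 xx yy * orbit_sum i j"
    unfolding orbit_sum_def power_add c by (simp add: algebra_simps power2_eq_square)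
qed

lemma orbit_sum_small:
  "orbit_sum 0 0 = 3" "orbit_sum 1 0 = 1" "orbit_sum 0 1 = 1"
  "orbit_sum 2 0 = 1 - 2 * esym2 xx yy" "orbit_sum 0 2 = 1 - 2 * esym2 xx yy"
  "orbit_sum 1 1 = esym2 xx yy" "orbit_sum 2 1 = cyc xx yy"
  "orbit_sum 1 2 = esym2 xx yy - 3 * esym3 xx yy - cyc xx yy"
  "orbit_sum 2 2 = (esym2 xx yy)\<^sup>2 - 2 * esym3 xx yy"
  by (simp_all add: orbit_sum_def zz_def esym2_def esym3_def cyc_def power2_eq_square algebra_simps)

text \<open>
  By the recursions, nine orbit sums with exponents below \<open>3\<close> determine all others, and these nine are integral
  polynomials in the three generators.
\<close>

lemma orbit_sum_in_subring:
  assumes D: "is_subring D" and gen: "esym2 xx yy \<in> D" "esym3 xx yy \<in> D" "cyc xx yy \<in> D"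
  shows "orbit_sum i j \<in> D"
proof -
  note cl = is_subring_closed[OF D]
  have step: "f n \<in> D" if base: "f 0 \<in> D" "f 1 \<in> D" "f 2 \<in> D"
    and rec: "\<And>n. f (n + 3) = f (n + 2) - esym2 xx yy * f (n + 1) + esym3 xx yy * f n" for f :: "nat \<Rightarrow> 'a poly poly" and n
  proof (induction n rule: less_induct)
    case (less n)
    consider "n = 0" | "n = 1" | "n = 2" | m where "n = m + 3"
    proof -
      have "n = 0 \<or> n = 1 \<or> n = 2 \<or> n = (n - 3) + 3" by arith
      then show thesis using that by blast
    qed
    then show ?case
    proof cases
      case 4
      then have "f m \<in> D" "f (m + 1) \<in> D" "f (m + 2) \<in> D" using less by auto
      then show ?thesis unfolding 4 rec by (intro cl gen)
    qed (use base in auto)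
  qed
  have base: "orbit_sum 0 0 \<in> D" "orbit_sum 1 0 \<in> D" "orbit_sum 2 0 \<in> D"
    "orbit_sum 0 1 \<in> D" "orbit_sum 1 1 \<in> D" "orbit_sum 2 1 \<in> D"
    "orbit_sum 0 2 \<in> D" "orbit_sum 1 2 \<in> D" "orbit_sum 2 2 \<in> D"
    unfolding orbit_sum_small by (intro cl gen)+
  have row0: "orbit_sum i 0 \<in> D" for i
    by (rule step[of "\<lambda>i. orbit_sum i 0", OF base(1-3) orbit_sum_rec(1)])
  have row1: "orbit_sum i 1 \<in> D" for i
    by (rule step[of "\<lambda>i. orbit_sum i 1", OF base(4-6) orbit_sum_rec(1)])
  have row2: "orbit_sum i 2 \<in> D" for i
    by (rule step[of "\<lambda>i. orbit_sum i 2", OF base(7-9) orbit_sum_rec(1)])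
  show ?thesis by (rule step[of "orbit_sum i", OF row0 row1 row2 orbit_sum_rec(2)])
qed

lemma poly2_expand:
  fixes f :: "'a::comm_ring_1 poly poly"
  shows "f = (\<Sum>i\<le>degree f. \<Sum>j\<le>degree (Polynomial.coeff f i).
    const2 (Polynomial.coeff (Polynomial.coeff f i) j) * xx ^ j * yy ^ i)"
proof -
  have expand: "p = (\<Sum>i\<le>degree p. [:Polynomial.coeff p i:] * [:0, 1:] ^ i)" for p :: "'b::comm_ring_1 poly"
    using poly_as_sum_of_monoms[of p] by (simp add: monom_altdef)
  have pC: "comm_hom (\<lambda>c. [:c:])" by (simp add: comm_hom_def one_pCons)
  have inner: "[:p:] = (\<Sum>j\<le>degree p. const2 (Polynomial.coeff p j) * xx ^ j)" for p :: "'a poly"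
    by (subst expand) (simp only: comm_hom_sum[OF pC] comm_hom_simps[OF pC] const2_def xx_def)
  have "f = (\<Sum>i\<le>degree f. [:Polynomial.coeff f i:] * yy ^ i)" unfolding yy_def by (rule expand)
  then show ?thesis by (simp only: inner sum_distrib_right)
qed

text \<open>An invariant \<open>f\<close> satisfies \<open>3 f = f + \<sigma> f + \<sigma>\<^sup>2 f\<close>, which is a combination of orbit sums.\<close>

lemma three_invariant:
  assumes "f \<in> invariants"
  shows "3 * f = (\<Sum>i\<le>degree f. \<Sum>j\<le>degree (Polynomial.coeff f i).
    const2 (Polynomial.coeff (Polynomial.coeff f i) j) * orbit_sum j i)"
proof -
  let ?S = "\<lambda>g. \<Sum>i\<le>degree f. \<Sum>j\<le>degree (Polynomial.coeff f i). const2 (Polynomial.coeff (Polynomial.coeff f i) j) * g j i"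
  note hom = comm_hom_sum[OF comm_hom_sigma] sigma_simps
  have 0: "f = ?S (\<lambda>j i. xx ^ j * yy ^ i)" using poly2_expand[of f] by (simp only: mult.assoc)
  have "sigma_act f = ?S (\<lambda>j i. yy ^ j * zz ^ i)" by (subst 0) (simp only: hom)
  then have 1: "f = ?S (\<lambda>j i. yy ^ j * zz ^ i)" using assms by (simp add: invariants_def)
  have "sigma_act (?S (\<lambda>j i. yy ^ j * zz ^ i)) = ?S (\<lambda>j i. zz ^ j * xx ^ i)" by (simp only: hom)
  then have 2: "f = ?S (\<lambda>j i. zz ^ j * xx ^ i)" using assms 1 by (simp add: invariants_def)
  have "3 * f = f + f + f" by simp
  also have "\<dots> = ?S (\<lambda>j i. xx ^ j * yy ^ i) + ?S (\<lambda>j i. yy ^ j * zz ^ i) + ?S (\<lambda>j i. zz ^ j * xx ^ i)"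
    using 0 1 2 by (simp only: )
  also have "\<dots> = ?S orbit_sum"
    by (simp only: orbit_sum_def sum.distrib distrib_left)
  finally show ?thesis .
qed

lemma three_invariant_in_subring:
  assumes "is_subring D" "esym2 xx yy \<in> D" "esym3 xx yy \<in> D" "cyc xx yy \<in> D" "f \<in> invariants"
    and "\<And>i j. const2 (Polynomial.coeff (Polynomial.coeff f i) j) \<in> D"
  shows "3 * f \<in> D"
  unfolding three_invariant[OF assms(5)]
  by (intro is_subring_sum is_subring_closed(5) orbit_sum_in_subring assms)

lemma invariants_generated:
  fixes D :: "rat poly poly set"
  assumes D: "is_subring D" "esym2 xx yy \<in> D" "esym3 xx yy \<in> D" "cyc xx yy \<in> D" and const: "\<And>c. const2 c \<in> D"
    and f: "f \<in> invariants"
  shows "f \<in> D"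
proof -
  have "const2 (1 / 3) * (3 * f) \<in> D"
    by (intro is_subring_closed(5)[OF D(1)] const three_invariant_in_subring[OF D f])
  also have "const2 (1 / 3) * (3 * f) = const2 (1 / 3) * const2 3 * f"
    by (simp add: mult.assoc comm_hom_simps(8)[OF comm_hom_const2])
  also have "const2 (1 / 3) * const2 3 = (1 :: rat poly poly)"
    using comm_hom_simps(2,4)[OF comm_hom_const2] by (metis nonzero_eq_divide_eq zero_neq_numeral)
  finally show ?thesis by simp
qed

subsection \<open>Rational points\<close>

lemma point_hom:
  assumes P: "P \<in> points_S_minus_D0"
  shows "P (const2 c) = c" "a \<in> invariants \<Longrightarrow> b \<in> invariants \<Longrightarrow> P (a + b) = P a + P b"
    "a \<in> invariants \<Longrightarrow> b \<in> invariants \<Longrightarrow> P (a * b) = P a * P b"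
    "a \<in> invariants \<Longrightarrow> b \<in> invariants \<Longrightarrow> P (a - b) = P a - P b" "P 1 = 1" "P (numeral k) = numeral k"
    "a \<in> invariants \<Longrightarrow> P (a ^ n) = P a ^ n"
proof -
  note cl = is_subring_closed[OF is_subring_invariants]
  show *: "P (const2 c) = c" "a \<in> invariants \<Longrightarrow> b \<in> invariants \<Longrightarrow> P (a + b) = P a + P b"
    "a \<in> invariants \<Longrightarrow> b \<in> invariants \<Longrightarrow> P (a * b) = P a * P b" for a b c
    using P by (auto simp: points_S_minus_D0_def)
  show "P (a - b) = P a - P b" if "a \<in> invariants" "b \<in> invariants"
    using *(2)[OF cl(3)[OF that] that(2)] by simp
  show 1: "P 1 = 1" using *(1)[of 1] comm_hom_simps(2)[OF comm_hom_const2] by metis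
  show "P (numeral k) = numeral k" using *(1)[of "numeral k"] comm_hom_simps(8)[OF comm_hom_const2] by metis
  show "P (a ^ n) = P a ^ n" if "a \<in> invariants"
    by (induction n) (simp_all add: 1 * that cl(6))
qed

lemma evalr_basic:
  "evalr x y (esym2 xx yy) = esym2 x y" "evalr x y (esym3 xx yy) = esym3 x y" "evalr x y (cyc xx yy) = cyc x y"
  by (simp_all add: esym2_def esym3_def cyc_def evalr_simps)

text \<open>
  A rational point is a homomorphism, so it is known once its values on the generators are. Any complex
  point with the same values of the generators computes it.
\<close>

lemma point_eq_evaluation:
  assumes P: "P \<in> points_S_minus_D0"
    and "of_rat (P (esym2 xx yy)) = esym2 x y" "of_rat (P (esym3 xx yy)) = esym3 x y" "of_rat (P (cyc xx yy)) = cyc x y"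
    and f: "f \<in> invariants"
  shows "of_rat (P f) = evalr x y f"
proof -
  define D where "D = {f \<in> invariants. of_rat (P f) = evalr x y f}"
  have "f \<in> D"
  proof (rule invariants_generated[OF _ _ _ _ _ f])
    show "is_subring D"
      using is_subring_invariants
      by (auto simp: is_subring_def D_def point_hom[OF P] evalr_simps of_rat_diff of_rat_mult)
  qed (use assms in \<open>auto simp: D_def basic_invariants const2_invariant point_hom(1)[OF P] evalr_generators evalr_basic\<close>)
  then show ?thesis by (simp add: D_def)
qed

text \<open>
  Conversely, evaluation at a complex point takes rational values on all invariants as soon as it does so on the
  generators.
\<close>

lemma exists_point:
  fixes x y :: complex
  assumes "esym2 x y = of_rat a" "esym3 x y = of_rat b" "cyc x y = of_rat c"
  obtains P where "P \<in> points_S_minus_D0" "P (esym2 xx yy) = a" "P (esym3 xx yy) = b" "P (cyc xx yy) = c"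
proof -
  note cl = is_subring_closed[OF is_subring_invariants]
  have rat: "\<exists>r. evalr x y f = of_rat r" if f: "f \<in> invariants" for f
  proof -
    define D where "D = {f. \<exists>r. evalr x y f = of_rat r}"
    have "f \<in> D"
    proof (rule invariants_generated[OF _ _ _ _ _ f])
      show "is_subring D" unfolding is_subring_def D_def
        by (auto simp: evalr_simps intro: exI[of _ 1]) (metis of_rat_diff, metis of_rat_mult)
    qed (use assms in \<open>auto simp: D_def evalr_generators evalr_basic\<close>)
    then show ?thesis by (simp add: D_def)
  qed
  define P where "P = restrict (\<lambda>f. SOME r. evalr x y f = of_rat r) invariants"
  have P: "evalr x y f = of_rat (P f)" if "f \<in> invariants" for f
    using someI_ex[OF rat[OF that]] that by (simp add: P_def)
  have Peq: "P f = r" if "f \<in> invariants" "evalr x y f = of_rat r" for f r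
    using P[OF that(1)] that(2) by simp
  have "P \<in> points_S_minus_D0"
    unfolding points_S_minus_D0_def
  proof (intro CollectI conjI allI ballI)
    show "P \<in> extensional invariants" by (simp add: P_def)
    show "P (const2 c) = c" for c by (rule Peq) (simp_all add: const2_invariant evalr_simps)
    fix f g :: "rat poly poly" assume fg: "f \<in> invariants" "g \<in> invariants"
    show "P (f + g) = P f + P g" by (rule Peq) (simp_all add: fg cl evalr_simps P of_rat_add)
    show "P (f * g) = P f * P g" by (rule Peq) (simp_all add: fg cl evalr_simps P of_rat_mult)
  qed
  moreover have "P (esym2 xx yy) = a" "P (esym3 xx yy) = b" "P (cyc xx yy) = c"
    using assms by (auto intro!: Peq simp: basic_invariants evalr_basic)
  ultimately show ?thesis using that by blast
qed

text \<open>
  The integer \<open>3 c\<close> has the square \<open>3 (3 c\<^sup>2)\<close>, which is divisible by \<open>3\<close>.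
\<close>

lemma rat_int_if_square:
  fixes c :: rat
  assumes "3 * c \<in> \<int>" "3 * c\<^sup>2 \<in> \<int>"
  shows "c \<in> \<int>"
proof -
  obtain m where m: "3 * c = of_int m" using assms(1) by (auto elim: Ints_cases)
  obtain n where n: "3 * c\<^sup>2 = of_int n" using assms(2) by (auto elim: Ints_cases)
  have "of_int (m\<^sup>2) = (3 * c)\<^sup>2" using m by simp
  also have "\<dots> = 3 * (3 * c\<^sup>2)" by (simp add: power2_eq_square)
  also have "\<dots> = of_int (3 * n)" using n by simp
  finally have "m\<^sup>2 = 3 * n" by (simp only: of_int_eq_iff)
  then have "3 dvd m" using prime_dvd_power[of "3::int" m 2] by simp
  then obtain k where "m = 3 * k" by (rule dvdE)
  then have "c = of_int k" using m by simp
  then show ?thesis by simp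
qed

text \<open>
  An integral invariant \<open>f\<close> takes a value in \<open>\<int>/3\<close> by averaging, and so does its square. Hence the value
  of \<open>f\<close> is an integer.
\<close>

lemma D0_integral_iff:
  assumes P: "P \<in> points_S_minus_D0"
  shows "D0_integral P \<longleftrightarrow> P (esym2 xx yy) \<in> \<int> \<and> P (esym3 xx yy) \<in> \<int> \<and> P (cyc xx yy) \<in> \<int>"
proof -
  define I where "I = {f :: rat poly poly. \<forall>i j. Polynomial.coeff (Polynomial.coeff f i) j \<in> \<int>}"
  have I: "is_subring I"
  proof -
    have "1 \<in> I" by (simp add: I_def one_pCons coeff_pCons split: nat.split)
    moreover have "a * b \<in> I" if "a \<in> I" "b \<in> I" for a b
    proof -
      have "Polynomial.coeff (Polynomial.coeff (a * b) i) j \<in> \<int>" for i j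
        using that unfolding coeff_mult coeff_sum I_def by (intro Ints_sum Ints_mult) auto
      then show ?thesis by (simp add: I_def)
    qed
    ultimately show ?thesis by (auto simp: is_subring_def I_def)
  qed
  have xyI: "xx \<in> I" "yy \<in> I" by (auto simp: I_def xx_def yy_def coeff_pCons split: nat.split)
  note clI = is_subring_closed[OF I]
  have gen: "esym2 xx yy \<in> I" "esym3 xx yy \<in> I" "cyc xx yy \<in> I"
    unfolding esym2_def esym3_def cyc_def by (intro clI xyI)+
  show ?thesis
  proof
    assume "D0_integral P"
    then show "P (esym2 xx yy) \<in> \<int> \<and> P (esym3 xx yy) \<in> \<int> \<and> P (cyc xx yy) \<in> \<int>"
      using gen basic_invariants by (auto simp: D0_integral_def I_def)
  next
    assume *: "P (esym2 xx yy) \<in> \<int> \<and> P (esym3 xx yy) \<in> \<int> \<and> P (cyc xx yy) \<in> \<int>"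
    define D where "D = {f \<in> invariants. P f \<in> \<int>}"
    have D: "is_subring D" using is_subring_invariants by (auto simp: is_subring_def D_def point_hom[OF P])
    have three: "3 * P f \<in> \<int>" if f: "f \<in> invariants" "f \<in> I" for f
    proof -
      have "3 * f \<in> D"
        by (rule three_invariant_in_subring[OF D])
           (use * f in \<open>auto simp: D_def basic_invariants const2_invariant point_hom[OF P] I_def\<close>)
      moreover have "P (3 * f) = P 3 * P f"
        by (rule point_hom(3)[OF P is_subring_closed(7)[OF is_subring_invariants] f(1)])
      ultimately show ?thesis by (simp add: D_def point_hom(6)[OF P])
    qed
    show "D0_integral P"
      unfolding D0_integral_def
    proof (intro ballI impI)
      fix f :: "rat poly poly" assume f: "f \<in> invariants" and int: "\<forall>i j. Polynomial.coeff (Polynomial.coeff f i) j \<in> \<int>"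
      have fI: "f \<in> I" using int by (simp add: I_def)
      have "3 * P (f\<^sup>2) \<in> \<int>"
        by (rule three[OF is_subring_closed(6)[OF is_subring_invariants f] clI(6)[OF fI]])
      also have "P (f\<^sup>2) = (P f)\<^sup>2" by (rule point_hom(7)[OF P f])
      finally show "P f \<in> \<int>" by (rule rat_int_if_square[OF three[OF f fI]])
    qed
  qed
qed


subsection \<open>The cube of \<open>A\<close> as an Eisenstein integer\<close>

text \<open>
  With \<open>a, b, c\<close> the three generating invariants, \<open>A B/\<epsilon>\<^sup>2 = 1 - 3 a\<close>, and \<open>A\<^sup>3/\<epsilon>\<^sup>3 = p + q \<zeta>\<close> with the linear forms \<open>p\<close> and \<open>q\<close> below.
\<close>

definition n_form :: "'a::comm_ring_1 \<Rightarrow> 'a" where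
  "n_form a = 1 - 3 * a"

definition p_form :: "'a::comm_ring_1 \<Rightarrow> 'a \<Rightarrow> 'a \<Rightarrow> 'a" where
  "p_form a b c = 1 - 6 * a + 18 * b + 3 * c"

definition q_form :: "'a::comm_ring_1 \<Rightarrow> 'a \<Rightarrow> 'a \<Rightarrow> 'a" where
  "q_form a b c = 6 * c - 3 * a + 9 * b"

text \<open>
  Here \<open>u = x - z\<close> and \<open>v = y - z\<close>, so that \<open>A/\<epsilon> = u + \<zeta> v\<close>.
\<close>

lemma forms_uv:
  fixes x y :: "'a::comm_ring_1"
  defines "u \<equiv> 2 * x + y - 1" and "v \<equiv> x + 2 * y - 1"
  shows "n_form (esym2 x y) = u\<^sup>2 - u * v + v\<^sup>2"
    and "p_form (esym2 x y) (esym3 x y) (cyc x y) = u ^ 3 + v ^ 3 - 3 * u * v\<^sup>2"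
    and "q_form (esym2 x y) (esym3 x y) (cyc x y) = 3 * u\<^sup>2 * v - 3 * u * v\<^sup>2"
  by (simp_all add: n_form_def p_form_def q_form_def esym2_def esym3_def cyc_def u_def v_def
      power2_eq_square power3_eq_cube algebra_simps)

lemma norm_relation:
  fixes x y :: "'a::comm_ring_1"
  defines "p \<equiv> p_form (esym2 x y) (esym3 x y) (cyc x y)" and "q \<equiv> q_form (esym2 x y) (esym3 x y) (cyc x y)"
  shows "p\<^sup>2 - p * q + q\<^sup>2 = n_form (esym2 x y) ^ 3"
proof -
  have "(u ^ 3 + v ^ 3 - 3 * u * v\<^sup>2)\<^sup>2 - (u ^ 3 + v ^ 3 - 3 * u * v\<^sup>2) * (3 * u\<^sup>2 * v - 3 * u * v\<^sup>2)
      + (3 * u\<^sup>2 * v - 3 * u * v\<^sup>2)\<^sup>2 = (u\<^sup>2 - u * v + v\<^sup>2) ^ 3" for u v :: 'a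
    by (simp add: power2_eq_square power3_eq_cube algebra_simps)
  then show ?thesis unfolding p_def q_def forms_uv by this
qed

lemma eisenstein_cube:
  fixes u v w :: "'a::comm_ring_1"
  assumes w: "w * w = - 1 - w"
  shows "(u + w * v) ^ 3 = (u ^ 3 + v ^ 3 - 3 * u * v\<^sup>2) + w * (3 * u\<^sup>2 * v - 3 * u * v\<^sup>2)"
    and "(u + w * v) * (u - v - w * v) = u\<^sup>2 - u * v + v\<^sup>2"
    and "(u - v - w * v) ^ 3 = (u ^ 3 + v ^ 3 - 3 * u\<^sup>2 * v) - w * (3 * u\<^sup>2 * v - 3 * u * v\<^sup>2)"
proof -
  have w3: "w * (w * w) = 1" unfolding w by (simp add: algebra_simps w)
  have cube: "(u + w * v) ^ 3 = (u ^ 3 + v ^ 3 - 3 * u * v\<^sup>2) + w * (3 * u\<^sup>2 * v - 3 * u * v\<^sup>2)" for u v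
  proof -
    have "(u + w * v) ^ 3 = u ^ 3 + 3 * u\<^sup>2 * v * w + 3 * u * v\<^sup>2 * (w * w) + v ^ 3 * (w * (w * w))"
      by (simp add: power2_eq_square power3_eq_cube algebra_simps)
    then show ?thesis unfolding w3 unfolding w by (simp add: algebra_simps)
  qed
  show "(u + w * v) ^ 3 = (u ^ 3 + v ^ 3 - 3 * u * v\<^sup>2) + w * (3 * u\<^sup>2 * v - 3 * u * v\<^sup>2)" by (rule cube)
  have "(u + w * v) * (u - v - w * v) = u\<^sup>2 - u * v - v\<^sup>2 * w - v\<^sup>2 * (w * w)"
    by (simp add: power2_eq_square algebra_simps)
  then show "(u + w * v) * (u - v - w * v) = u\<^sup>2 - u * v + v\<^sup>2" unfolding w by (simp add: algebra_simps)
  have "(u - v - w * v) ^ 3 = ((u - v) + w * (- v)) ^ 3" by (simp add: algebra_simps)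
  also have "\<dots> = (u ^ 3 + v ^ 3 - 3 * u\<^sup>2 * v) - w * (3 * u\<^sup>2 * v - 3 * u * v\<^sup>2)"
    unfolding cube by (simp add: power2_eq_square power3_eq_cube algebra_simps)
  finally show "(u - v - w * v) ^ 3 = (u ^ 3 + v ^ 3 - 3 * u\<^sup>2 * v) - w * (3 * u\<^sup>2 * v - 3 * u * v\<^sup>2)" .
qed

lemma const2_zeta3: "const2 zeta3 * const2 zeta3 = - 1 - const2 zeta3" "const2 (zeta3\<^sup>2) = - 1 - const2 zeta3"
proof -
  note h = comm_hom_simps[OF comm_hom_const2]
  have "const2 (zeta3 * zeta3) = const2 (- 1 - zeta3)" by (simp only: zeta3_square)
  then show 1: "const2 zeta3 * const2 zeta3 = - 1 - const2 zeta3" by (simp only: h)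
  show "const2 (zeta3\<^sup>2) = - 1 - const2 zeta3" by (simp only: power2_eq_square h 1)
qed

lemma AA_BB_uv:
  "AA = (2 * xx + yy - 1) + const2 zeta3 * (xx + 2 * yy - 1)"
  "BB = (2 * xx + yy - 1) - (xx + 2 * yy - 1) - const2 zeta3 * (xx + 2 * yy - 1)"
  unfolding AA_def BB_def const2_zeta3 zz_def by (simp_all add: algebra_simps)

lemma AA_BB_forms:
  "AA * BB = n_form (esym2 xx yy)"
  "AA ^ 3 = p_form (esym2 xx yy) (esym3 xx yy) (cyc xx yy) + const2 zeta3 * q_form (esym2 xx yy) (esym3 xx yy) (cyc xx yy)"
  "BB ^ 3 = (p_form (esym2 xx yy) (esym3 xx yy) (cyc xx yy) - q_form (esym2 xx yy) (esym3 xx yy) (cyc xx yy))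
     + const2 zeta3 * (- q_form (esym2 xx yy) (esym3 xx yy) (cyc xx yy))"
  unfolding AA_BB_uv forms_uv eisenstein_cube[OF const2_zeta3(1)] by (simp_all add: algebra_simps)

lemma delta_eq: "delta = - n_form (esym2 xx yy)"
  by (simp add: delta_def n_form_def esym2_def zz_def power2_eq_square power3_eq_cube algebra_simps)

lemma form_invariants:
  "n_form (esym2 xx yy) \<in> (invariants :: rat poly poly set)"
  "p_form (esym2 xx yy) (esym3 xx yy) (cyc xx yy) \<in> (invariants :: rat poly poly set)"
  "q_form (esym2 xx yy) (esym3 xx yy) (cyc xx yy) \<in> (invariants :: rat poly poly set)"
  unfolding n_form_def p_form_def q_form_def
  by (intro is_subring_closed[OF is_subring_invariants] basic_invariants)+

lemma point_forms:
  assumes P: "P \<in> points_S_minus_D0"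
  shows "P (n_form (esym2 xx yy)) = n_form (P (esym2 xx yy))"
    and "P (p_form (esym2 xx yy) (esym3 xx yy) (cyc xx yy)) = p_form (P (esym2 xx yy)) (P (esym3 xx yy)) (P (cyc xx yy))"
    and "P (q_form (esym2 xx yy) (esym3 xx yy) (cyc xx yy)) = q_form (P (esym2 xx yy)) (P (esym3 xx yy)) (P (cyc xx yy))"
  by (simp_all add: n_form_def p_form_def q_form_def point_hom[OF P] basic_invariants
      is_subring_closed[OF is_subring_invariants])

lemma point_delta:
  assumes P: "P \<in> points_S_minus_D0"
  shows "P delta = - n_form (P (esym2 xx yy))"
proof -
  have "P (const2 (- 1) * n_form (esym2 xx yy)) = - n_form (P (esym2 xx yy))"
    by (simp add: point_hom[OF P] const2_invariant form_invariants point_forms[OF P])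
  also have "const2 (- 1) * n_form (esym2 xx yy) = delta"
    by (simp add: delta_eq comm_hom_simps(2,5)[OF comm_hom_const2])
  finally show ?thesis .
qed

lemma point_norm_relation:
  assumes P: "P \<in> points_S_minus_D0"
  defines "p \<equiv> p_form (P (esym2 xx yy)) (P (esym3 xx yy)) (P (cyc xx yy))"
    and "q \<equiv> q_form (P (esym2 xx yy)) (P (esym3 xx yy)) (P (cyc xx yy))"
  shows "p\<^sup>2 - p * q + q\<^sup>2 = n_form (P (esym2 xx yy)) ^ 3"
proof -
  let ?p = "p_form (esym2 xx yy) (esym3 xx yy) (cyc xx yy) :: rat poly poly"
  let ?q = "q_form (esym2 xx yy) (esym3 xx yy) (cyc xx yy) :: rat poly poly"
  note cl = is_subring_closed[OF is_subring_invariants]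
  have "P (?p\<^sup>2 - ?p * ?q + ?q\<^sup>2) = P (n_form (esym2 xx yy) ^ 3)" by (simp only: norm_relation)
  moreover have "P (?p\<^sup>2 - ?p * ?q + ?q\<^sup>2) = (P ?p)\<^sup>2 - P ?p * P ?q + (P ?q)\<^sup>2"
    by (simp add: point_hom[OF P] form_invariants cl)
  moreover have "P (n_form (esym2 xx yy) ^ 3) = P (n_form (esym2 xx yy)) ^ 3"
    by (rule point_hom(7)[OF P form_invariants(1)])
  ultimately show ?thesis by (simp add: point_forms[OF P] p_def q_def)
qed

text \<open>
  The Eisenstein integer \<open>\<alpha>\<close> is the value of \<open>A\<^sup>3/\<epsilon>\<^sup>3\<close> at the point, and \<open>n\<close> is that of \<open>A B/\<epsilon>\<^sup>2\<close>.
\<close>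

definition point_data :: "(rat poly poly \<Rightarrow> rat) \<Rightarrow> eis \<Rightarrow> nat \<Rightarrow> bool" where
  "point_data P \<alpha> n \<longleftrightarrow> P \<in> points_S_minus_D0 \<and> n \<ge> 1 \<and> eis_norm \<alpha> = int n ^ 3 \<and>
     n_form (P (esym2 xx yy)) = of_nat n \<and>
     p_form (P (esym2 xx yy)) (P (esym3 xx yy)) (P (cyc xx yy)) = of_int (eis_a \<alpha>) \<and>
     q_form (P (esym2 xx yy)) (P (esym3 xx yy)) (P (cyc xx yy)) = of_int (eis_b \<alpha>)"

text \<open>
  The three forms are linear with determinant \<open>-243\<close>, so \<open>\<alpha>\<close> and \<open>N\<close> determine the values of all invariants.
\<close>

lemma forms_inject:
  fixes a b c a' b' c' :: "'a::field_char_0"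
  assumes "n_form a = n_form a'" "p_form a b c = p_form a' b' c'" "q_form a b c = q_form a' b' c'"
  shows "a = a'" "b = b'" "c = c'"
proof -
  show a: "a = a'" using assms(1) by (simp add: n_form_def)
  have p: "18 * b + 3 * c = 18 * b' + 3 * c'" and q: "6 * c + 9 * b = 6 * c' + 9 * b'"
    using assms(2,3) by (simp_all add: p_form_def q_form_def a)
  have "27 * b = 2 * (18 * b + 3 * c) - (6 * c + 9 * b)" by simp
  also have "\<dots> = 27 * b'" unfolding p q by simp
  finally show b: "b = b'" by simp
  show "c = c'" using q by (simp add: b)
qed

lemma integral_point_data:
  assumes "P \<in> integral_points"
  obtains \<alpha> n where "point_data P \<alpha> n" "eis_primary \<alpha>"
proof -
  have P: "P \<in> points_S_minus_D0" and nz: "P delta \<noteq> 0" and int: "D0_integral P"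
    using assms by (auto simp: integral_points_def T_points_def)
  obtain a b c where abc: "P (esym2 xx yy) = of_int a" "P (esym3 xx yy) = of_int b" "P (cyc xx yy) = of_int c"
    using int unfolding D0_integral_iff[OF P] by (auto elim!: Ints_cases)
  define \<alpha> where "\<alpha> = Eis (p_form a b c) (q_form a b c)"
  have forms: "n_form (P (esym2 xx yy)) = of_int (n_form a)"
    "p_form (P (esym2 xx yy)) (P (esym3 xx yy)) (P (cyc xx yy)) = of_int (p_form a b c)"
    "q_form (P (esym2 xx yy)) (P (esym3 xx yy)) (P (cyc xx yy)) = of_int (q_form a b c)"
    by (simp_all add: abc n_form_def p_form_def q_form_def)
  have "(of_int (eis_norm \<alpha>) :: rat) = of_int (n_form a ^ 3)"
    using point_norm_relation[OF P] unfolding forms by (simp add: \<alpha>_def eis_norm_def)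
  then have norm: "eis_norm \<alpha> = n_form a ^ 3" by (simp only: of_int_eq_iff)
  have "n_form a \<noteq> 0" using nz forms(1) point_delta[OF P] by auto
  moreover have "n_form a ^ 3 \<ge> 0" using eis_norm_nonneg[of \<alpha>] norm by simp
  ultimately have pos: "n_form a > 0" by (simp add: zero_le_power_eq)
  define n where "n = nat (n_form a)"
  have n: "int n = n_form a" "n \<ge> 1" using pos by (auto simp: n_def)
  have "(of_nat n :: rat) = of_int (int n)" by simp
  then have "point_data P \<alpha> n" using P n norm forms by (simp add: point_data_def \<alpha>_def)
  moreover have "eis_primary \<alpha>"
    unfolding eis_primary_def \<alpha>_def eis.sel p_form_def q_form_def by presburger
  ultimately show ?thesis using that by blast
qed

subsection \<open>A complex point above a rational point\<close>

text \<open>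
  Take for \<open>A\<close> a complex cube root of \<open>\<alpha>\<close>. The equation for the norm gives \<open>|A|\<^sup>2 = n\<close>, and solving the linear
  system for \<open>x\<close> and \<open>y\<close> with \<open>B\<close> the conjugate of \<open>A\<close> gives real coordinates. As these are real, the values of
  the invariants can be read off from \<open>A\<^sup>3 = \<alpha>\<close>.
\<close>

lemma complex_point_exists:
  assumes norm: "eis_norm \<alpha> = int n ^ 3" and n: "n \<ge> 1"
  obtains x y A where "A \<noteq> 0" "A ^ 3 = ec \<alpha>" "A * cnj A = of_nat n"
    "(2 * x + y - 1) + zeta3 * (x + 2 * y - 1) = A"
    "(2 * x + y - 1) - (x + 2 * y - 1) - zeta3 * (x + 2 * y - 1) = cnj A"
    "n_form (esym2 x y) = of_nat n" "p_form (esym2 x y) (esym3 x y) (cyc x y) = of_int (eis_a \<alpha>)"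
    "q_form (esym2 x y) (esym3 x y) (cyc x y) = of_int (eis_b \<alpha>)"
proof -
  have \<alpha>0: "ec \<alpha> \<noteq> 0" using norm n by auto
  define A where "A = ec \<alpha> powr (1 / 3)"
  have A: "A ^ 3 = ec \<alpha>" using powr_of_nat_mult[OF \<alpha>0, of 3 "1 / 3"] by (simp add: A_def)
  have "((cmod A)\<^sup>2) ^ 3 = (cmod (ec \<alpha>))\<^sup>2" unfolding A[symmetric] by (simp add: norm_power flip: power_mult)
  also have "\<dots> = real n ^ 3" by (simp add: cmod_ec norm)
  finally have cA: "(cmod A)\<^sup>2 = real n" by (rule power_eq_imp_eq_base) auto
  have AA: "A * cnj A = of_nat n" using cA by (simp add: complex_norm_square[symmetric])
  have A0: "A \<noteq> 0" using cA n by auto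
  define x where "x = (1 + A + cnj A) / 3"
  define y where "y = (1 + (- 1 - zeta3) * A + zeta3 * cnj A) / 3"
  have real: "cnj x = x" "cnj y = y" by (simp_all add: x_def y_def cnj_zeta3 algebra_simps)
  have e1: "(2 * x + y - 1) + zeta3 * (x + 2 * y - 1) = A"
  proof -
    have "3 * ((2 * x + y - 1) + zeta3 * (x + 2 * y - 1)) =
        2 * (3 * x) + 3 * y - 3 + zeta3 * (3 * x + 2 * (3 * y) - 3)"
      by (simp add: algebra_simps)
    also have "3 * x = 1 + A + cnj A" by (simp add: x_def)
    also have "3 * y = 1 + (- 1 - zeta3) * A + zeta3 * cnj A" by (simp add: y_def)
    also have "2 * (1 + A + cnj A) + (1 + (- 1 - zeta3) * A + zeta3 * cnj A) - 3 +
        zeta3 * (1 + A + cnj A + 2 * (1 + (- 1 - zeta3) * A + zeta3 * cnj A) - 3) =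
      A * (1 - 2 * zeta3 - 2 * (zeta3 * zeta3)) + cnj A * (2 + 2 * zeta3 + 2 * (zeta3 * zeta3))"
      by (simp add: algebra_simps)
    also have "\<dots> = 3 * A" unfolding zeta3_square by (simp add: algebra_simps)
    finally show ?thesis by (simp only: mult_cancel_left) simp
  qed
  have e2: "(2 * x + y - 1) - (x + 2 * y - 1) - zeta3 * (x + 2 * y - 1) = cnj A"
  proof -
    have "cnj A = cnj ((2 * x + y - 1) + zeta3 * (x + 2 * y - 1))" by (simp only: e1)
    then show ?thesis by (simp add: real cnj_zeta3 algebra_simps)
  qed
  have nf: "n_form (esym2 x y) = of_nat n"
    using eisenstein_cube(2)[OF zeta3_square, of "2 * x + y - 1" "x + 2 * y - 1"]
    unfolding e1 e2 AA forms_uv by simp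
  define p q where "p = p_form (esym2 x y) (esym3 x y) (cyc x y)" and "q = q_form (esym2 x y) (esym3 x y) (cyc x y)"
  have "p + zeta3 * q = A ^ 3"
    using eisenstein_cube(1)[OF zeta3_square, of "2 * x + y - 1" "x + 2 * y - 1"]
    unfolding e1 p_def q_def forms_uv by simp
  then have pq: "p + zeta3 * q = of_int (eis_a \<alpha>) + of_int (eis_b \<alpha>) * zeta3" by (simp add: A ec_def)
  have "cnj p = p" "cnj q = q"
    by (simp_all add: p_def q_def p_form_def q_form_def esym2_def esym3_def cyc_def real)
  then have "Im p = 0" "Im q = 0" by (simp_all add: complex_eq_iff)
  have "Im (p + zeta3 * q) = sqrt 3 / 2 * Re q" using \<open>Im p = 0\<close> \<open>Im q = 0\<close> by (simp add: zeta3_eq)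
  moreover have "Im (of_int (eis_a \<alpha>) + of_int (eis_b \<alpha>) * zeta3) = of_int (eis_b \<alpha>) * (sqrt 3 / 2)" by (simp add: zeta3_eq)
  ultimately have "Re q = of_int (eis_b \<alpha>)" unfolding pq by simp
  then have q: "q = of_int (eis_b \<alpha>)" using \<open>Im q = 0\<close> by (simp add: complex_eq_iff)
  then have p: "p = of_int (eis_a \<alpha>)" using pq by (simp add: mult.commute)
  show ?thesis using that A0 A AA e1 e2 nf p q unfolding p_def q_def by blast
qed

lemma point_data_evaluation:
  assumes "point_data P \<alpha> n"
  obtains x y A where "A \<noteq> 0" "A ^ 3 = ec \<alpha>" "A * cnj A = of_nat n" "evalc x y AA = A" "evalc x y BB = cnj A"
    "\<And>f. f \<in> invariants \<Longrightarrow> of_rat (P f) = evalr x y f"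
proof -
  have d: "P \<in> points_S_minus_D0" "n \<ge> 1" "eis_norm \<alpha> = int n ^ 3"
    "n_form (P (esym2 xx yy)) = of_nat n"
    "p_form (P (esym2 xx yy)) (P (esym3 xx yy)) (P (cyc xx yy)) = of_int (eis_a \<alpha>)"
    "q_form (P (esym2 xx yy)) (P (esym3 xx yy)) (P (cyc xx yy)) = of_int (eis_b \<alpha>)"
    using assms by (auto simp: point_data_def)
  obtain x y A where A: "A \<noteq> 0" "A ^ 3 = ec \<alpha>" "A * cnj A = of_nat n"
    "(2 * x + y - 1) + zeta3 * (x + 2 * y - 1) = A"
    "(2 * x + y - 1) - (x + 2 * y - 1) - zeta3 * (x + 2 * y - 1) = cnj A"
    and f: "n_form (esym2 x y) = of_nat n" "p_form (esym2 x y) (esym3 x y) (cyc x y) = of_int (eis_a \<alpha>)"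
    "q_form (esym2 x y) (esym3 x y) (cyc x y) = of_int (eis_b \<alpha>)"
    by (rule complex_point_exists[OF d(3,2)]) (rule that)
  define a b c where "a = (of_rat (P (esym2 xx yy)) :: complex)" and "b = (of_rat (P (esym3 xx yy)) :: complex)"
    and "c = (of_rat (P (cyc xx yy)) :: complex)"
  have "n_form a = of_rat (n_form (P (esym2 xx yy)))"
    "p_form a b c = of_rat (p_form (P (esym2 xx yy)) (P (esym3 xx yy)) (P (cyc xx yy)))"
    "q_form a b c = of_rat (q_form (P (esym2 xx yy)) (P (esym3 xx yy)) (P (cyc xx yy)))"
    by (simp_all add: a_def b_def c_def n_form_def p_form_def q_form_def of_rat_add of_rat_diff of_rat_mult)
  then have "n_form a = n_form (esym2 x y)" "p_form a b c = p_form (esym2 x y) (esym3 x y) (cyc x y)"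
    "q_form a b c = q_form (esym2 x y) (esym3 x y) (cyc x y)"
    unfolding d f by simp_all
  note eq = forms_inject[OF this]
  have "of_rat (P g) = evalr x y g" if "g \<in> invariants" for g
    using point_eq_evaluation[OF d(1) _ _ _ that, of x y] eq by (simp add: a_def b_def c_def)
  moreover have "evalc x y AA = A" "evalc x y BB = cnj A"
    unfolding AA_BB_uv using A by (simp_all add: evalc_simps)
  ultimately show ?thesis using that A by blast
qed

text \<open>
  A point is determined by \<open>\<alpha>\<close> and \<open>n\<close>. Conversely, for \<open>\<alpha> = 1 + 3 (r + t \<zeta>)\<close> of norm \<open>n\<^sup>3\<close>, the values of the
  invariants, a priori rational numbers, turn out to be integers: the equation for the norm modulo \<open>9\<close> gives
  \<open>3 | 2 r - t\<close>, and modulo \<open>27\<close> it gives the remaining congruence.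
\<close>

lemma integral_points_fibre:
  assumes "n \<ge> 1"
  shows "bij_betw (\<lambda>P. THE \<alpha>. point_data P \<alpha> n) {P \<in> integral_points. \<exists>\<alpha>. point_data P \<alpha> n}
    {\<alpha>. eis_primary \<alpha> \<and> eis_norm \<alpha> = int n ^ 3}"
proof -
  have uniq: "\<alpha> = \<alpha>'" if "point_data P \<alpha> n" "point_data P \<alpha>' n'" for P \<alpha> \<alpha>' n'
    using that by (simp add: point_data_def eis_eq_iff)
  have The: "(THE \<alpha>. point_data P \<alpha> n) = \<alpha>" if "point_data P \<alpha> n" for P \<alpha>
    using that uniq by blast
  have inj: "P = P'" if P: "point_data P \<alpha> n" and P': "point_data P' \<alpha> n" for P P' \<alpha>
  proof
    fix f
    obtain x y where ev: "\<And>f. f \<in> invariants \<Longrightarrow> of_rat (P f) = evalr x y f" using point_data_evaluation[OF P] by blast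
    have eq: "P (esym2 xx yy) = P' (esym2 xx yy)" "P (esym3 xx yy) = P' (esym3 xx yy)" "P (cyc xx yy) = P' (cyc xx yy)"
      using P P' forms_inject[of "P (esym2 xx yy)" "P' (esym2 xx yy)" "P (esym3 xx yy)" "P (cyc xx yy)" "P' (esym3 xx yy)" "P' (cyc xx yy)"]
      by (auto simp: point_data_def)
    show "P f = P' f"
    proof (cases "f \<in> invariants")
      case True
      have "of_rat (P' f) = evalr x y f"
        using P' by (intro point_eq_evaluation) (auto simp: point_data_def ev eq[symmetric] basic_invariants evalr_basic True)
      then have "(of_rat (P f) :: complex) = of_rat (P' f)" using ev[OF True] by simp
      then show ?thesis by simp
    next
      case False
      have "P \<in> extensional invariants" "P' \<in> extensional invariants" using P P' by (auto simp: point_data_def points_S_minus_D0_def)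
      then show ?thesis using False by (simp add: extensional_def)
    qed
  qed
  have surj: "\<exists>P\<in>integral_points. point_data P \<alpha> n" if prim: "eis_primary \<alpha>" and norm: "eis_norm \<alpha> = int n ^ 3" for \<alpha>
  proof -
    define p q where "p = eis_a \<alpha>" and "q = eis_b \<alpha>"
    obtain r where r: "p = 3 * r + 1" using prim by (metis eis_primary_def p_def mult_div_mod_eq)
    obtain t where t: "q = 3 * t" using prim by (metis eis_primary_def q_def mult_div_mod_eq add.right_neutral)
    have N: "int n ^ 3 = 1 + 3 * (2 * r - t) + 9 * (r\<^sup>2 - r * t + t\<^sup>2)"
      unfolding norm[symmetric] eis_norm_def p_def[symmetric] q_def[symmetric] r t
      by (simp add: power2_eq_square algebra_simps)
    have n3: "int n mod 3 = 1"
    proof -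
      have "int n mod 3 = 0 \<or> int n mod 3 = 1 \<or> int n mod 3 = 2" by presburger
      moreover have "(int n ^ 3) mod 3 = 1" unfolding N by presburger
      moreover have "(int n ^ 3) mod 3 = ((int n mod 3) ^ 3) mod 3" by (simp add: power_mod)
      ultimately show ?thesis by auto
    qed
    obtain m where m: "int n = 3 * m + 1" using n3 by (metis mult_div_mod_eq)
    have "1 + 9 * (3 * m ^ 3 + 3 * m\<^sup>2 + m) = 1 + 3 * (2 * r - t) + 9 * (r\<^sup>2 - r * t + t\<^sup>2)"
      using N unfolding m by (simp add: power2_eq_square power3_eq_cube algebra_simps)
    then have rt: "2 * r - t = 3 * (3 * m ^ 3 + 3 * m\<^sup>2 + m - (r\<^sup>2 - r * t + t\<^sup>2))" by simp
    (* The norm equation modulo 9: t is congruent to 2 r modulo 3. *)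
    define h where "h = - (3 * m ^ 3 + 3 * m\<^sup>2 + m - (r\<^sup>2 - r * t + t\<^sup>2))"
    have h: "t = 2 * r + 3 * h" "3 * m ^ 3 + 3 * m\<^sup>2 + m - (r\<^sup>2 - r * t + t\<^sup>2) = - h"
      using rt unfolding h_def by linarith+
    (* The norm equation modulo 27. *)
    have "m + h = 3 * (r\<^sup>2 + 3 * (r * h) + 3 * h\<^sup>2 - m ^ 3 - m\<^sup>2)"
      using h(2) unfolding h(1) by (simp add: power2_eq_square power3_eq_cube algebra_simps)
    then obtain k where k: "m + h = 3 * k" by blast
    define a b c where "a = - m" and "b = - k" and "c = r + 2 * h"
    have forms: "n_form a = int n" "p_form a b c = p" "q_form a b c = q"
      using k by (simp_all add: n_form_def p_form_def q_form_def a_def b_def c_def m r t h(1))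
    obtain x y where f: "n_form (esym2 x y) = (of_nat n :: complex)" "p_form (esym2 x y) (esym3 x y) (cyc x y) = (of_int p :: complex)"
      "q_form (esym2 x y) (esym3 x y) (cyc x y) = (of_int q :: complex)"
      using complex_point_exists[OF norm assms] unfolding p_def q_def by blast
    have "n_form (of_int a) = (of_nat n :: complex)" "p_form (of_int a) (of_int b) (of_int c) = (of_int p :: complex)"
      "q_form (of_int a) (of_int b) (of_int c) = (of_int q :: complex)"
      unfolding forms[symmetric] using arg_cong[OF forms(1), of "of_int :: int \<Rightarrow> complex"]
      by (simp_all add: n_form_def p_form_def q_form_def)
    note xy = forms_inject[of "of_int a :: complex" "esym2 x y" "of_int b" "of_int c" "esym3 x y" "cyc x y", unfolded f this, OF refl refl refl]
    obtain P where P: "P \<in> points_S_minus_D0" "P (esym2 xx yy) = of_int a" "P (esym3 xx yy) = of_int b" "P (cyc xx yy) = of_int c"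
      using exists_point[of x y "of_int a" "of_int b" "of_int c"] xy by auto
    have Pn: "n_form (P (esym2 xx yy)) = of_nat n"
      using arg_cong[OF forms(1), of "of_int :: int \<Rightarrow> rat"] unfolding P by (simp add: n_form_def)
    have "point_data P \<alpha> n"
      using P(1) Pn norm assms arg_cong[OF forms(2), of "of_int :: int \<Rightarrow> rat"] arg_cong[OF forms(3), of "of_int :: int \<Rightarrow> rat"]
      by (simp add: point_data_def P p_form_def q_form_def p_def q_def)
    moreover have "P delta \<noteq> 0" unfolding point_delta[OF P(1)] Pn using assms by simp
    moreover have "D0_integral P" unfolding D0_integral_iff[OF P(1)] P by simp
    ultimately show ?thesis using P(1) by (auto simp: integral_points_def T_points_def)
  qed
  show ?thesis
  proof (rule bij_betwI')
    fix P P' assume "P \<in> {P \<in> integral_points. \<exists>\<alpha>. point_data P \<alpha> n}" "P' \<in> {P \<in> integral_points. \<exists>\<alpha>. point_data P \<alpha> n}"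
    then obtain \<alpha> \<alpha>' where "point_data P \<alpha> n" "point_data P' \<alpha>' n" by auto
    then show "(THE \<alpha>. point_data P \<alpha> n) = (THE \<alpha>. point_data P' \<alpha> n) \<longleftrightarrow> P = P'"
      using The[of P \<alpha>] The[of P' \<alpha>'] inj by auto
  next
    fix P assume P: "P \<in> {P \<in> integral_points. \<exists>\<alpha>. point_data P \<alpha> n}"
    then obtain \<alpha> where \<alpha>: "point_data P \<alpha> n" by auto
    obtain \<alpha>' n' where "point_data P \<alpha>' n'" "eis_primary \<alpha>'" using integral_point_data P by blast
    then have "eis_primary \<alpha>" using uniq[OF \<alpha>] by simp
    then show "(THE \<alpha>. point_data P \<alpha> n) \<in> {\<alpha>. eis_primary \<alpha> \<and> eis_norm \<alpha> = int n ^ 3}"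
      using The[OF \<alpha>] \<alpha> by (simp add: point_data_def)
  next
    fix \<alpha> assume "\<alpha> \<in> {\<alpha>. eis_primary \<alpha> \<and> eis_norm \<alpha> = int n ^ 3}"
    then obtain P where "P \<in> integral_points" "point_data P \<alpha> n" using surj by blast
    then show "\<exists>P\<in>{P \<in> integral_points. \<exists>\<alpha>. point_data P \<alpha> n}. \<alpha> = (THE \<alpha>. point_data P \<alpha> n)"
      using The by force
  qed
qed


section \<open>The toric height of a rational point\<close>

subsection \<open>Values of characters\<close>

text \<open>
  The domain on which the \<open>E\<close>-linear extension of a rational point is defined.
\<close>

definition complexified_invariants :: "complex poly poly set" where
  "complexified_invariants =
     {rat_to_complex f + const2 zeta3 * rat_to_complex g | f g. f \<in> invariants \<and> g \<in> invariants}"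

lemma is_subring_complexified_invariants: "is_subring complexified_invariants"
proof -
  note cl = is_subring_closed[OF is_subring_invariants]
  have mem: "rat_to_complex f + const2 zeta3 * rat_to_complex g \<in> complexified_invariants"
    if "f \<in> invariants" "g \<in> invariants" for f g
    using that by (auto simp: complexified_invariants_def)
  have "1 \<in> complexified_invariants" using mem[of 1 0] cl(1,2) by (simp add: rat_to_complex_simps)
  moreover have "a - b \<in> complexified_invariants \<and> a * b \<in> complexified_invariants"
    if ab: "a \<in> complexified_invariants" "b \<in> complexified_invariants" for a b
  proof -
    obtain f g where a: "a = rat_to_complex f + const2 zeta3 * rat_to_complex g" "f \<in> invariants" "g \<in> invariants"
      using ab(1) by (auto simp: complexified_invariants_def)
    obtain f' g' where b: "b = rat_to_complex f' + const2 zeta3 * rat_to_complex g'" "f' \<in> invariants" "g' \<in> invariants"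
      using ab(2) by (auto simp: complexified_invariants_def)
    have "a - b = rat_to_complex (f - f') + const2 zeta3 * rat_to_complex (g - g')"
      by (simp add: a b rat_to_complex_simps algebra_simps)
    moreover have "a * b = rat_to_complex (f * f' - g * g') + const2 zeta3 * rat_to_complex (f * g' + g * f' - g * g')"
    proof -
      have "a * b = rat_to_complex f * rat_to_complex f' + (const2 zeta3 * const2 zeta3) * (rat_to_complex g * rat_to_complex g')
          + const2 zeta3 * (rat_to_complex f * rat_to_complex g' + rat_to_complex g * rat_to_complex f')"
        by (simp add: a b algebra_simps)
      then show ?thesis unfolding const2_zeta3 by (simp add: rat_to_complex_simps algebra_simps)
    qed
    moreover have "f - f' \<in> invariants" "g - g' \<in> invariants" "f * f' - g * g' \<in> invariants"
      "f * g' + g * f' - g * g' \<in> invariants"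
      by (intro cl a b)+
    ultimately show ?thesis using mem by simp
  qed
  ultimately show ?thesis by (simp add: is_subring_def)
qed

text \<open>
  If a rational point is evaluation at a complex point, so is its \<open>E\<close>-linear extension. In particular the value does not
  depend on the decomposition of an invariant with coefficients in \<open>E\<close>.
\<close>

lemma eval_E_eq:
  assumes ev: "\<And>f. f \<in> invariants \<Longrightarrow> of_rat (P f) = evalr x y f" and F: "F \<in> complexified_invariants"
  shows "eval_E P F = evalc x y F"
proof -
  have val: "of_rat (P f) + zeta3 * of_rat (P g) = evalc x y (rat_to_complex f + const2 zeta3 * rat_to_complex g)"
    if "f \<in> invariants" "g \<in> invariants" for f g
    using that by (simp add: evalc_simps ev evalr_def)
  show ?thesis
    unfolding eval_E_def rat_to_complex_def[symmetric]
  proof (rule the_equality)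
    show "\<exists>f0\<in>invariants. \<exists>f1\<in>invariants. F = rat_to_complex f0 + const2 zeta3 * rat_to_complex f1 \<and>
        evalc x y F = of_rat (P f0) + zeta3 * of_rat (P f1)"
      using F val by (auto simp: complexified_invariants_def)
  next
    fix c assume "\<exists>f0\<in>invariants. \<exists>f1\<in>invariants. F = rat_to_complex f0 + const2 zeta3 * rat_to_complex f1 \<and>
        c = of_rat (P f0) + zeta3 * of_rat (P f1)"
    then show "c = evalc x y F" using val by auto
  qed
qed

lemma rat_to_complex_basic:
  "rat_to_complex (esym2 xx yy) = esym2 xx yy" "rat_to_complex (esym3 xx yy) = esym3 xx yy"
  "rat_to_complex (cyc xx yy) = cyc xx yy"
  by (simp_all add: esym2_def esym3_def cyc_def rat_to_complex_simps)

lemma rat_to_complex_forms: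
  "rat_to_complex (n_form a) = n_form (rat_to_complex a)"
  "rat_to_complex (p_form a b c) = p_form (rat_to_complex a) (rat_to_complex b) (rat_to_complex c)"
  "rat_to_complex (q_form a b c) = q_form (rat_to_complex a) (rat_to_complex b) (rat_to_complex c)"
  by (simp_all add: n_form_def p_form_def q_form_def rat_to_complex_simps)

lemma AA_BB_complexified:
  "AA * BB \<in> complexified_invariants" "AA ^ 3 \<in> complexified_invariants" "BB ^ 3 \<in> complexified_invariants"
proof -
  note cl = is_subring_closed[OF is_subring_invariants]
  let ?p = "p_form (esym2 xx yy) (esym3 xx yy) (cyc xx yy) :: rat poly poly"
  let ?q = "q_form (esym2 xx yy) (esym3 xx yy) (cyc xx yy) :: rat poly poly"
  have mem: "rat_to_complex f + const2 zeta3 * rat_to_complex g \<in> complexified_invariants"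
    if "f \<in> invariants" "g \<in> invariants" for f g
    using that by (auto simp: complexified_invariants_def)
  have "?p - ?q \<in> invariants" "0 - ?q \<in> invariants" by (intro cl form_invariants)+
  from mem[OF this] show "BB ^ 3 \<in> complexified_invariants"
    unfolding AA_BB_forms by (simp add: rat_to_complex_simps rat_to_complex_forms rat_to_complex_basic)
  from mem[OF form_invariants(2,3)] show "AA ^ 3 \<in> complexified_invariants"
    unfolding AA_BB_forms by (simp add: rat_to_complex_forms rat_to_complex_basic)
  from mem[OF form_invariants(1) cl(2)] show "AA * BB \<in> complexified_invariants"
    unfolding AA_BB_forms by (simp add: rat_to_complex_simps rat_to_complex_forms rat_to_complex_basic)
qed

text \<open>
  Such a monomial is a power of \<open>A B\<close> times a power of \<open>A\<^sup>3\<close> or of \<open>B\<^sup>3\<close>.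
\<close>

lemma monomial_complexified:
  assumes "int m mod 3 = int k mod 3"
  shows "AA ^ m * BB ^ k \<in> complexified_invariants"
proof -
  note cl = is_subring_closed[OF is_subring_complexified_invariants]
  have "m mod 3 = k mod 3" using assms by (metis of_nat_eq_iff of_nat_numeral zmod_int)
  then consider j where "m = k + 3 * j" | j where "k = m + 3 * j"
    by (metis le_add_diff_inverse mod_eq_dvd_iff_nat dvdE nat_le_linear)
  then show ?thesis
  proof cases
    case 1
    then have "AA ^ m * BB ^ k = AA ^ k * (AA ^ 3) ^ j * BB ^ k" by (simp only: power_add power_mult)
    also have "\<dots> = (AA * BB) ^ k * (AA ^ 3) ^ j" by (simp only: power_mult_distrib mult_ac)
    finally have "AA ^ m * BB ^ k = (AA * BB) ^ k * (AA ^ 3) ^ j" .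
    then show ?thesis using AA_BB_complexified by (auto intro: cl)
  next
    case 2
    then have "AA ^ m * BB ^ k = AA ^ m * (BB ^ m * (BB ^ 3) ^ j)" by (simp only: power_add power_mult)
    also have "\<dots> = (AA * BB) ^ m * (BB ^ 3) ^ j" by (simp only: power_mult_distrib mult_ac)
    finally have "AA ^ m * BB ^ k = (AA * BB) ^ m * (BB ^ 3) ^ j" .
    then show ?thesis using AA_BB_complexified by (auto intro: cl)
  qed
qed

lemma char_value_eq:
  assumes ev: "\<And>f. f \<in> invariants \<Longrightarrow> of_rat (P f) = evalr x y f"
    and AB: "evalc x y AA = A" "evalc x y BB = B" "A \<noteq> 0" "B \<noteq> 0"
  shows "char_value P (2 * r - t, 2 * t - r) = (A ^ 3 / (A * B)) powi r * (B ^ 3 / (A * B)) powi t"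
proof -
  define i j where "i = 2 * r - t" and "j = 2 * t - r"
  define k where "k = nat \<bar>i\<bar> + nat \<bar>j\<bar>"
  define m l where "m = nat (i + int k)" and "l = nat (j + int k)"
  have ml: "int m = i + int k" "int l = j + int k" by (auto simp: m_def l_def k_def)
  have "int m mod 3 = int l mod 3" unfolding ml i_def j_def mod_eq_dvd_iff by (simp add: algebra_simps)
  then have "eval_E P (AA ^ m * BB ^ l) = A ^ m * B ^ l"
    using eval_E_eq[OF ev monomial_complexified] AB by (simp add: evalc_simps)
  moreover have "eval_E P (AA * BB) = A * B"
    using eval_E_eq[OF ev AA_BB_complexified(1)] AB by (simp add: evalc_simps)
  ultimately have "char_value P (i, j) = A ^ m * B ^ l / (A * B) ^ k"
    by (simp add: char_value_def Let_def m_def l_def k_def)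
  also have "A ^ m = A powi i * A ^ k" using AB(3) by (simp add: ml power_int_add flip: power_int_of_nat)
  also have "B ^ l = B powi j * B ^ k" using AB(4) by (simp add: ml power_int_add flip: power_int_of_nat)
  also have "A powi i * A ^ k * (B powi j * B ^ k) / (A * B) ^ k = A powi i * B powi j"
    using AB by (simp add: power_mult_distrib)
  also have "A powi i = (A powi 2) powi r / A powi t"
    using AB by (simp add: i_def power_int_diff power_int_mult)
  also have "B powi j = (B powi 2) powi t / B powi r"
    using AB by (simp add: j_def power_int_diff power_int_mult)
  also have "(A powi 2) powi r / A powi t * ((B powi 2) powi t / B powi r) = (A powi 2 / B) powi r * (B powi 2 / A) powi t"
    by (simp add: power_int_divide_distrib)
  also have "A powi 2 / B = A ^ 3 / (A * B)" using AB by (simp add: power3_eq_cube power2_eq_square)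
  also have "B powi 2 / A = B ^ 3 / (A * B)" using AB by (simp add: power3_eq_cube power2_eq_square)
  finally show ?thesis by (simp add: i_def j_def)
qed

subsection \<open>The logarithms of a point\<close>

lemma abs_place_power_int:
  assumes "w \<in> places" "u \<in> E" "u \<noteq> 0"
  shows "u powi r \<in> E" "abs_place w (u powi r) = abs_place w u powi r"
proof -
  have one: "1 \<in> E" using ec_in_E[of 1] by simp
  have "abs_place w 1 * abs_place w 1 = abs_place w 1" using abs_place_mult[OF assms(1) one one] by simp
  moreover have "abs_place w 1 > 0" using abs_place_pos[OF assms(1) one] by simp
  ultimately have abs1: "abs_place w 1 = 1" by simp
  have nat: "u ^ n \<in> E \<and> abs_place w (u ^ n) = abs_place w u ^ n" if "u \<in> E" for n u
    by (induction n) (use that one abs1 abs_place_mult[OF assms(1)] in \<open>auto intro: E_mult\<close>)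
  have inv: "inverse u \<in> E" "abs_place w (inverse u) = inverse (abs_place w u)"
  proof -
    show "inverse u \<in> E" using assms(2) by (rule E_inverse)
    then have "abs_place w u * abs_place w (inverse u) = 1"
      using abs_place_mult[OF assms(1,2), of "inverse u"] assms(3) abs1 by simp
    then show "abs_place w (inverse u) = inverse (abs_place w u)" by (metis inverse_unique)
  qed
  have "u powi r = (if r \<ge> 0 then u ^ nat r else inverse u ^ nat (- r))" by (simp add: power_int_def)
  moreover have "abs_place w u powi r = (if r \<ge> 0 then abs_place w u ^ nat r else inverse (abs_place w u) ^ nat (- r))"
    by (simp add: power_int_def)
  ultimately show "u powi r \<in> E" "abs_place w (u powi r) = abs_place w u powi r"
    using nat[OF assms(2)] nat[OF inv(1)] inv(2) by auto
qed

text \<open>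
  The characters \<open>a'\<close> and \<open>b'\<close> take the values \<open>\<alpha>/n\<close> and \<open>\<alpha>'/n\<close>, where \<open>\<alpha>'\<close> is the conjugate of \<open>\<alpha>\<close>. Because of \<open>n\<^sup>3 = \<alpha> \<alpha>'\<close>,
  the solution of the linear system has the coordinates of one third of the logarithms of \<open>\<alpha>\<close> and \<open>\<alpha>'\<close>.
\<close>

lemma log_point_eq:
  assumes d: "point_data P \<alpha> n" and w: "w \<in> places"
  shows "log_point w P = (- ln (abs_place w (ec \<alpha>)) / 3, - ln (abs_place w (ec (eis_conj \<alpha>))) / 3)"
proof -
  obtain x y A where A: "A \<noteq> 0" "A ^ 3 = ec \<alpha>" "A * cnj A = of_nat n" "evalc x y AA = A" "evalc x y BB = cnj A"
    and ev: "\<And>f. f \<in> invariants \<Longrightarrow> of_rat (P f) = evalr x y f"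
    by (rule point_data_evaluation[OF d]) (rule that)
  define \<beta> where "\<beta> = eis_conj \<alpha>"
  have n1: "n \<ge> 1" and norm: "eis_norm \<alpha> = int n ^ 3" using d by (auto simp: point_data_def)
  have "eis_norm \<alpha> \<noteq> 0" "eis_norm \<beta> \<noteq> 0" using norm n1 by (simp_all add: \<beta>_def)
  then have nz: "\<alpha> \<noteq> 0" "\<beta> \<noteq> 0" by auto
  have B3: "cnj A ^ 3 = ec \<beta>" using A(2) by (simp add: \<beta>_def ec_conj flip: complex_cnj_power)
  define a b c where "a = ln (abs_place w (ec \<alpha>))" and "b = ln (abs_place w (ec \<beta>))" and "c = ln (abs_place w (of_nat n))"
  have En: "of_nat n \<in> E" "(of_nat n :: complex) \<noteq> 0" using ec_in_E[of "of_nat n"] n1 by auto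
  have lnmult: "ln (abs_place w (u * v)) = ln (abs_place w u) + ln (abs_place w v)"
    if "u \<in> E" "v \<in> E" "u \<noteq> 0" "v \<noteq> 0" for u v
    unfolding abs_place_mult[OF w that(1,2)] by (intro ln_mult_pos abs_place_pos[OF w] that)
  have "(of_nat n :: complex) * (of_nat n * of_nat n) = ec \<alpha> * ec \<beta>"
  proof -
    have "ec \<alpha> * ec \<beta> = (A * cnj A) ^ 3" by (simp add: A(2)[symmetric] B3[symmetric] power_mult_distrib)
    then show ?thesis using A(3) by (simp add: power3_eq_cube)
  qed
  then have "ln (abs_place w (of_nat n * (of_nat n * of_nat n))) = ln (abs_place w (ec \<alpha> * ec \<beta>))" by simp
  then have abc: "3 * c = a + b"
    using En nz by (simp add: lnmult ec_in_E E_mult a_def b_def c_def)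
  have div: "ec z / of_nat n \<in> E" "ec z / of_nat n \<noteq> 0" "ln (abs_place w (ec z / of_nat n)) = ln (abs_place w (ec z)) - c"
    if "z \<noteq> 0" for z
  proof -
    show E: "ec z / of_nat n \<in> E" using quotient_in_E[of z "of_nat n"] by simp
    show 0: "ec z / of_nat n \<noteq> 0" using that En by simp
    have "ln (abs_place w (ec z / of_nat n * of_nat n)) = ln (abs_place w (ec z / of_nat n)) + c"
      unfolding c_def by (rule lnmult[OF E En(1) 0 En(2)])
    then show "ln (abs_place w (ec z / of_nat n)) = ln (abs_place w (ec z)) - c" using En by simp
  qed
  have lnpow: "ln (abs_place w (u powi r)) = r * ln (abs_place w u)" if "u \<in> E" "u \<noteq> 0" for u r
    using abs_place_pos[OF w that]
    by (simp add: abs_place_power_int(2)[OF w that] powr_real_of_int' ln_powr flip: powr_real_of_int')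
  have char: "- ln (abs_place w (char_value P (2 * r - t, 2 * t - r))) = - (r * (a - c)) - t * (b - c)" for r t
  proof -
    have "char_value P (2 * r - t, 2 * t - r) = (ec \<alpha> / of_nat n) powi r * (ec \<beta> / of_nat n) powi t"
      using char_value_eq[OF ev A(4,5,1)] A B3 by simp
    moreover have "ln (abs_place w ((ec \<alpha> / of_nat n) powi r * (ec \<beta> / of_nat n) powi t)) = r * (a - c) + t * (b - c)"
      using div[OF nz(1)] div[OF nz(2)]
      by (subst lnmult) (auto simp: abs_place_power_int(1)[OF w] lnpow a_def b_def)
    ultimately show ?thesis by simp
  qed
  have "log_point w P = (- a / 3, - b / 3)"
    unfolding log_point_def
  proof (rule the_equality)
    show "\<forall>m\<in>M_E. pairing m (- a / 3, - b / 3) = - ln (abs_place w (char_value P m))"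
    proof
      fix m assume "m \<in> M_E"
      then obtain r t where m: "m = (2 * r - t, 2 * t - r)" by (auto simp: M_E_def)
      have c: "c = (a + b) / 3" using abc by simp
      show "pairing m (- a / 3, - b / 3) = - ln (abs_place w (char_value P m))"
        unfolding m char unfolding c by (simp add: pairing_def field_simps)
    qed
    fix l :: "real \<times> real" assume l: "\<forall>m\<in>M_E. pairing m l = - ln (abs_place w (char_value P m))"
    have "(2 * 1 - 0, 2 * 0 - 1) \<in> M_E" "(2 * 0 - 1, 2 * 1 - 0) \<in> M_E" unfolding M_E_def by blast+
    then have "pairing (2 * 1 - 0, 2 * 0 - 1) l = - (a - c)" "pairing (2 * 0 - 1, 2 * 1 - 0) l = - (b - c)"
      using l char[of 1 0] char[of 0 1] by (simp_all del: diff_0_right)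
    then have "2 * fst l - snd l = c - a" "2 * snd l - fst l = c - b" by (simp_all add: pairing_def)
    then show "l = (- a / 3, - b / 3)" using abc by (simp add: prod_eq_iff)
  qed
  then show ?thesis by (simp add: a_def b_def \<beta>_def)
qed

subsection \<open>The piecewise linear function\<close>

text \<open>
  The function \<open>min(0, l\<^sub>1, l\<^sub>2)\<close> is linear on each of the three cones. It is unique because the cones cover the
  plane and a linear function on a cone is determined by its values on two generators.
\<close>

lemma phi_eq: "phi s l = s * of_real (min 0 (min (fst l) (snd l)))"
proof -
  let ?f = "\<lambda>l :: real \<times> real. s * of_real (min 0 (min (fst l) (snd l)))"
  have cone: "\<alpha> *\<^sub>R u + \<beta> *\<^sub>R v \<in> convex_cone hull {u, v}" if "\<alpha> \<ge> 0" "\<beta> \<ge> 0" for \<alpha> \<beta> and u v :: "real \<times> real"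
    using that by (intro convex_cone_hull_add convex_cone_hull_mul hull_inc) auto
  have sub01: "convex_cone hull {v0, v1} \<subseteq> {l. snd l \<le> 0 \<and> snd l \<le> fst l}"
    by (rule hull_minimal) (auto simp: v0_def v1_def convex_cone_iff mult_left_mono mult_nonneg_nonpos)
  have sub12: "convex_cone hull {v1, v2} \<subseteq> {l. 0 \<le> fst l \<and> 0 \<le> snd l}"
    by (rule hull_minimal) (auto simp: v1_def v2_def convex_cone_iff)
  have sub20: "convex_cone hull {v2, v0} \<subseteq> {l. fst l \<le> 0 \<and> fst l \<le> snd l}"
    by (rule hull_minimal) (auto simp: v0_def v2_def convex_cone_iff mult_left_mono mult_nonneg_nonpos)
  have "phi s = ?f"
    unfolding phi_def
  proof (rule the_equality, intro conjI ballI)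
    show "continuous_on UNIV ?f" by (intro continuous_intros)
    show "?f v0 = - s" "?f v1 = 0" "?f v2 = 0" by (simp_all add: v0_def v1_def v2_def)
    fix C assume "C \<in> fan_max_cones"
    then consider "C = convex_cone hull {v0, v1}" | "C = convex_cone hull {v1, v2}" | "C = convex_cone hull {v2, v0}"
      by (auto simp: fan_max_cones_def)
    then show "\<exists>g. linear g \<and> (\<forall>l\<in>C. ?f l = g l)"
    proof cases
      case 1
      have "linear (\<lambda>l :: real \<times> real. s * of_real (snd l))"
        by (intro linearI) (auto simp: algebra_simps scaleR_conv_of_real)
      moreover have "\<forall>l\<in>C. ?f l = s * of_real (snd l)" using sub01 1 by (auto simp: min_def)
      ultimately show ?thesis by blast
    next
      case 2
      have "linear (\<lambda>l :: real \<times> real. 0 :: complex)" by (intro linearI) auto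
      moreover have "\<forall>l\<in>C. ?f l = 0" using sub12 2 by (auto simp: min_def)
      ultimately show ?thesis by blast
    next
      case 3
      have "linear (\<lambda>l :: real \<times> real. s * of_real (fst l))"
        by (intro linearI) (auto simp: algebra_simps scaleR_conv_of_real)
      moreover have "\<forall>l\<in>C. ?f l = s * of_real (fst l)" using sub20 3 by (auto simp: min_def)
      ultimately show ?thesis by blast
    qed
  next
    fix f assume f: "continuous_on UNIV f \<and> (\<forall>C\<in>fan_max_cones. \<exists>g. linear g \<and> (\<forall>l\<in>C. f l = g l)) \<and>
      f v0 = - s \<and> f v1 = 0 \<and> f v2 = 0"
    have lin: "f (\<alpha> *\<^sub>R u + \<beta> *\<^sub>R v) = \<alpha> *\<^sub>R f u + \<beta> *\<^sub>R f v"
      if "convex_cone hull {u, v} \<in> fan_max_cones" "\<alpha> \<ge> 0" "\<beta> \<ge> 0" for u v \<alpha> \<beta>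
    proof -
      have "\<forall>C\<in>fan_max_cones. \<exists>g. linear g \<and> (\<forall>l\<in>C. f l = g l)" using f by (elim conjE)
      from bspec[OF this that(1)]
      obtain g where g: "linear g" "\<And>l. l \<in> convex_cone hull {u, v} \<Longrightarrow> f l = g l" by (elim exE conjE) simp
      have "f u = g u" "f v = g v" by (auto intro!: g(2) hull_inc)
      moreover have "f (\<alpha> *\<^sub>R u + \<beta> *\<^sub>R v) = g (\<alpha> *\<^sub>R u + \<beta> *\<^sub>R v)" by (intro g(2) cone that)
      ultimately show ?thesis using g(1) by (simp add: linear_add linear_scale)
    qed
    have mem: "convex_cone hull {v0, v1} \<in> fan_max_cones" "convex_cone hull {v1, v2} \<in> fan_max_cones"
      "convex_cone hull {v2, v0} \<in> fan_max_cones" by (auto simp: fan_max_cones_def)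
    show "f = ?f"
    proof
      fix l :: "real \<times> real"
      obtain p q where l: "l = (p, q)" by (cases l)
      consider "p \<ge> 0" "q \<ge> 0" | "q \<le> 0" "q \<le> p" | "p \<le> 0" "p \<le> q" by linarith
      then show "f l = ?f l"
      proof cases
        case 1
        then have "f (p *\<^sub>R v1 + q *\<^sub>R v2) = 0" using f lin[OF mem(2), of p q] by simp
        moreover have "p *\<^sub>R v1 + q *\<^sub>R v2 = l" by (simp add: l v1_def v2_def)
        ultimately show ?thesis using 1 by (simp add: l min_def)
      next
        case 2
        then have "f ((- q) *\<^sub>R v0 + (p - q) *\<^sub>R v1) = (- q) *\<^sub>R (- s)" using f lin[OF mem(1), of "- q" "p - q"] by simp
        moreover have "(- q) *\<^sub>R v0 + (p - q) *\<^sub>R v1 = l" by (simp add: l v0_def v1_def)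
        ultimately show ?thesis using 2 by (simp add: l min_def scaleR_conv_of_real mult.commute)
      next
        case 3
        then have "f ((q - p) *\<^sub>R v2 + (- p) *\<^sub>R v0) = (- p) *\<^sub>R (- s)" using f lin[OF mem(3), of "q - p" "- p"] by simp
        moreover have "(q - p) *\<^sub>R v2 + (- p) *\<^sub>R v0 = l" by (simp add: l v0_def v2_def)
        ultimately show ?thesis using 3 by (simp add: l min_def scaleR_conv_of_real mult.commute)
      qed
    qed
  qed
  then show ?thesis by simp
qed

subsection \<open>The height\<close>

text \<open>
  Since \<open>\<alpha>\<close> and its conjugate are integers, the logarithms at a finite place are nonnegative, where \<open>\<phi>\<^sub>s\<close>
  vanishes. Only the infinite place contributes.
\<close>

lemma local_height_finite:
  assumes d: "point_data P \<alpha> n" and w: "w \<in> places" "w \<noteq> Infinite_Place"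
  shows "local_height w P s = 1"
proof -
  have le: "ln (abs_place w (ec \<beta>)) \<le> 0" for \<beta>
    using abs_place_integer_le_1[OF w, of \<beta>] abs_place_pos[OF w(1) ec_in_E, of \<beta>]
    by (cases "ec \<beta> = 0") (use abs_place_integer_le_1[OF w] w in \<open>cases w; auto simp: ln_le_zero_iff\<close>)+
  show ?thesis using le[of \<alpha>] le[of "eis_conj \<alpha>"]
    by (simp add: local_height_def phi_eq log_point_eq[OF d w(1)] min_def)
qed

lemma local_height_infinite:
  assumes d: "point_data P \<alpha> n"
  shows "local_height Infinite_Place P s = of_nat n powr (s / 2)"
proof -
  have n: "n \<ge> 1" and norm: "eis_norm \<alpha> = int n ^ 3" using d by (auto simp: point_data_def)
  have pl: "Infinite_Place \<in> places" by (simp add: places_def)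
  have "abs_place Infinite_Place (ec \<alpha>) = real n ^ 3" "abs_place Infinite_Place (ec (eis_conj \<alpha>)) = real n ^ 3"
    by (simp_all add: cmod_ec norm)
  then have l: "log_point Infinite_Place P = (- ln (real n), - ln (real n))"
    unfolding log_point_eq[OF d pl] using n by (simp add: ln_realpow)
  have "ln (real n) \<ge> 0" using n by simp
  then have "phi s (log_point Infinite_Place P) = - s * of_real (ln (real n))"
    unfolding l phi_eq by (simp add: min_def)
  then have "local_height Infinite_Place P s = exp (s / 2 * of_real (ln (real n)))"
    by (simp add: local_height_def)
  also have "\<dots> = of_nat n powr (s / 2)" using n by (simp add: powr_def Ln_of_nat)
  finally show ?thesis .
qed

lemma height_eq:
  assumes d: "point_data P \<alpha> n"
  shows "height P s = of_nat n powr (s / 2)"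
proof -
  let ?W = "{w \<in> places. local_height w P s \<noteq> 1}"
  have "?W \<subseteq> {Infinite_Place}" using local_height_finite[OF d] by blast
  then have "height P s = (\<Prod>w\<in>{Infinite_Place}. local_height w P s)"
    unfolding height_def by (intro prod.mono_neutral_left) (auto simp: places_def)
  then show ?thesis by (simp add: local_height_infinite[OF d])
qed


section \<open>Counting ideals and integral points\<close>

lemma ideal_series_eq_dedekind:
  assumes z: "Re z > 10"
  shows "(\<lambda>I. 1 / of_nat (ideal_norm E I) powr z) summable_on nonzero_ideals E"
    and "dedekind_zeta E z = ideal_series z"
proof -
  let ?S = "{g :: eis. normalize g = g \<and> g \<noteq> 0}"
  have fibre: "{g \<in> ?S. nat (eis_norm g) = n} = (if n = 0 then {} else eis_reps n)" for n
  proof (cases "n = 0")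
    case True
    then show ?thesis using eis_norm_pos by force
  next
    case False
    then show ?thesis by (auto simp: eis_reps_def nat_eq_iff)
  qed
  have weight: "of_nat (card {g \<in> ?S. nat (eis_norm g) = n}) * npow z n = of_nat (eis_count n) * npow z n" for n
    unfolding fibre by (simp add: eis_count_def)
  have fin: "finite {g \<in> ?S. nat (eis_norm g) = n}" for n
    unfolding fibre by (simp add: finite_eis_reps)
  have summ: "(\<lambda>n. of_nat (card {g \<in> ?S. nat (eis_norm g) = n}) * npow z n) summable_on UNIV"
    unfolding weight by (rule summable_eis_count[OF z])
  note fibres = infsum_fibres[OF fin summ]
  have eq: "npow z (nat (eis_norm g)) = 1 / of_nat (ideal_norm E (pid g)) powr z" if "g \<in> ?S" for g
    using that by (simp add: npow_def ideal_norm_pid)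
  have "(\<lambda>g. 1 / of_nat (ideal_norm E (pid g)) powr z) summable_on ?S"
    using fibres(1) by (rule summable_on_cong[THEN iffD1, rotated]) (rule eq)
  then show "(\<lambda>I. 1 / of_nat (ideal_norm E I) powr z) summable_on nonzero_ideals E"
    using summable_on_reindex_bij_betw[OF bij_betw_pid, of "\<lambda>I. 1 / of_nat (ideal_norm E I) powr z"] by simp
  have "dedekind_zeta E z = (\<Sum>\<^sub>\<infinity>g\<in>?S. 1 / of_nat (ideal_norm E (pid g)) powr z)"
    unfolding dedekind_zeta_def by (rule infsum_reindex_bij_betw[OF bij_betw_pid, symmetric])
  also have "\<dots> = (\<Sum>\<^sub>\<infinity>g\<in>?S. npow z (nat (eis_norm g)))"
    by (intro infsum_cong eq[symmetric])
  also have "\<dots> = ideal_series z" unfolding fibres(2) weight by (simp add: ideal_series_def)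
  finally show "dedekind_zeta E z = ideal_series z" .
qed

text \<open>
  The value of \<open>A B/\<epsilon>\<^sup>2\<close> at an integral point; it is the square of the height.
\<close>

definition point_norm :: "(rat poly poly \<Rightarrow> rat) \<Rightarrow> nat" where
  "point_norm P = (THE n. \<exists>\<alpha>. point_data P \<alpha> n)"

lemma point_norm_eq:
  assumes "point_data P \<alpha> n"
  shows "point_norm P = n"
  unfolding point_norm_def
proof (rule the_equality)
  fix m assume "\<exists>\<alpha>. point_data P \<alpha> m"
  then have "(of_nat m :: rat) = of_nat n" using assms by (auto simp: point_data_def)
  then show "m = n" by simp
qed (use assms in blast)

lemma point_norm_fibre:
  shows "finite {P \<in> integral_points. point_norm P = n}"
    and "card {P \<in> integral_points. point_norm P = n} = point_count n"
proof -
  have eq: "{P \<in> integral_points. point_norm P = n} = {P \<in> integral_points. \<exists>\<alpha>. point_data P \<alpha> n}"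
  proof (intro Collect_cong conj_cong refl)
    fix P assume "P \<in> integral_points"
    then obtain \<alpha> m where "point_data P \<alpha> m" using integral_point_data by blast
    then show "point_norm P = n \<longleftrightarrow> (\<exists>\<alpha>. point_data P \<alpha> n)" using point_norm_eq by metis
  qed
  have prim: "eis_norm \<alpha> mod 3 = 1" if "eis_primary \<alpha>" for \<alpha>
  proof -
    have gen: "(1 + 3 * c) mod 3 = 1" for c :: int by presburger
    define r t where "r = eis_a \<alpha> div 3" and "t = eis_b \<alpha> div 3"
    have "eis_a \<alpha> mod 3 = 1" "eis_b \<alpha> mod 3 = 0" using that by (auto simp: eis_primary_def)
    then have r: "eis_a \<alpha> = 3 * r + 1" and t: "eis_b \<alpha> = 3 * t" unfolding r_def t_def by presburger+
    have "eis_norm \<alpha> = 1 + 3 * (2 * r - t + 3 * (r\<^sup>2 - r * t + t\<^sup>2))"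
      by (simp add: eis_norm_def r t power2_eq_square algebra_simps)
    then show ?thesis by (simp only: gen)
  qed
  have "finite {P \<in> integral_points. point_norm P = n} \<and> card {P \<in> integral_points. point_norm P = n} = point_count n"
  proof (cases "n = 0")
    case True
    then have empty: "{P \<in> integral_points. point_norm P = n} = {}" unfolding eq by (auto simp: point_data_def)
    show ?thesis unfolding empty using True by (simp add: point_count_def)
  next
    case False
    let ?B = "{\<alpha>. eis_primary \<alpha> \<and> eis_norm \<alpha> = int n ^ 3}"
    have B: "?B = {\<alpha>. eis_primary \<alpha> \<and> eis_norm \<alpha> = int (n ^ 3)}" by simp
    have bij: "bij_betw (\<lambda>P. THE \<alpha>. point_data P \<alpha> n) {P \<in> integral_points. point_norm P = n} ?B"
      unfolding eq using False by (intro integral_points_fibre) simp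
    have "finite ?B" unfolding B by (rule finite_subset[OF _ finite_eis_norm_fibre[of "n ^ 3"]]) auto
    moreover have "card ?B = point_count n"
    proof (cases "3 dvd n")
      case True
      then have "int n ^ 3 mod 3 = 0" by (auto elim!: dvdE simp: power_mult_distrib)
      then have empty: "?B = {}" using prim by fastforce
      show ?thesis unfolding empty using True by (simp add: point_count_def)
    next
      case False
      then have "\<not> 3 dvd n ^ 3" using prime_dvd_power[of "3::nat" n 3] by auto
      then show ?thesis using False bij_betw_same_card[OF bij_betw_normalize_primary[of "n ^ 3"]]
        unfolding B by (simp add: point_count_def eis_count_def)
    qed
    ultimately show ?thesis using bij_betw_same_card[OF bij] bij_betw_finite[OF bij] by simp
  qed
  then show "finite {P \<in> integral_points. point_norm P = n}"
    "card {P \<in> integral_points. point_norm P = n} = point_count n" by auto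
qed

lemma height_point_norm:
  assumes "P \<in> integral_points"
  shows "height P s = of_nat (point_norm P) powr (s / 2)"
  using assms integral_point_data[of P] height_eq[of P] point_norm_eq[of P] by metis

lemma height_zeta_eq:
  assumes s: "Re s > 20"
  shows "(\<lambda>P. inverse (height P s)) summable_on integral_points"
    and "height_zeta s = point_series (s / 2)"
proof -
  have z: "Re (s / 2) > 10" using s by simp
  have eq: "npow (s / 2) (point_norm P) = inverse (height P s)" if "P \<in> integral_points" for P
    using height_point_norm[OF that] by (simp add: npow_def inverse_eq_divide)
  have "(\<lambda>n. of_nat (card {P \<in> integral_points. point_norm P = n}) * npow (s / 2) n) summable_on UNIV"
    unfolding point_norm_fibre(2) by (rule summable_point_count[OF z])
  note fibres = infsum_fibres[OF point_norm_fibre(1) this]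
  show "(\<lambda>P. inverse (height P s)) summable_on integral_points"
    using fibres(1) by (rule summable_on_cong[THEN iffD1, rotated]) (rule eq)
  have "height_zeta s = (\<Sum>\<^sub>\<infinity>P\<in>integral_points. npow (s / 2) (point_norm P))"
    unfolding height_zeta_def by (intro infsum_cong eq[symmetric])
  also have "\<dots> = point_series (s / 2)" unfolding fibres(2) point_norm_fibre(2) by (simp add: point_series_def)
  finally show "height_zeta s = point_series (s / 2)" .
qed

lemma height_1_eq_iff:
  assumes "P \<in> integral_points"
  shows "height P 1 = of_real (sqrt (real n)) \<longleftrightarrow> point_norm P = n"
proof -
  have "height P 1 = of_real (sqrt (real (point_norm P)))"
    using powr_of_real[of "real (point_norm P)" "1 / 2"] by (simp add: height_point_norm[OF assms] powr_half_sqrt)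
  then show ?thesis by simp
qed

subsection \<open>The number of integral points as a divisor sum\<close>

text \<open>
  The maximum defining the residue part is attained at the product of all prime factors in the residue class: this
  product is a multiple of every other candidate.
\<close>

lemma prime_factorization_residue_part:
  assumes "d > 0"
  shows "prime_factorization (residue_part j d) = filter_mset (\<lambda>p. p mod 3 = j) (prime_factorization d)"
proof -
  define M where "M = filter_mset (\<lambda>p. p mod 3 = j) (prime_factorization d)"
  define e0 where "e0 = prod_mset M"
  have pf: "prime_factorization e0 = M"
    unfolding e0_def by (rule prime_factorization_prod_mset_primes) (auto simp: M_def)
  have e0: "e0 > 0" using assms by (auto simp: e0_def M_def prod_mset_zero_iff intro!: gr0I)
  have "e0 dvd d" using e0 assms by (subst prime_factorization_subset_iff_dvd[symmetric]) (auto simp: pf M_def)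
  have "residue_part j d = e0"
    unfolding residue_part_def
  proof (rule Max_eqI)
    show "finite {e. e dvd d \<and> (\<forall>p. prime p \<longrightarrow> p dvd e \<longrightarrow> p mod 3 = j)}"
      using assms by (auto intro: finite_subset[OF _ finite_divisors_nat])
    have "p mod 3 = j" if "prime p" "p dvd e0" for p
    proof -
      have "p \<in># prime_factorization e0" using that e0 by (simp add: in_prime_factors_iff)
      then show ?thesis by (simp add: pf M_def)
    qed
    then show "e0 \<in> {e. e dvd d \<and> (\<forall>p. prime p \<longrightarrow> p dvd e \<longrightarrow> p mod 3 = j)}" using \<open>e0 dvd d\<close> by simp
    fix e assume "e \<in> {e. e dvd d \<and> (\<forall>p. prime p \<longrightarrow> p dvd e \<longrightarrow> p mod 3 = j)}"
    then have e: "e dvd d" "\<And>p. prime p \<Longrightarrow> p dvd e \<Longrightarrow> p mod 3 = j" by auto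
    have "e > 0" using e(1) assms by (auto intro!: gr0I)
    have "prime_factorization e = filter_mset (\<lambda>p. p mod 3 = j) (prime_factorization e)"
      using e(2) by (intro filter_mset_eq_conv[THEN iffD2, symmetric]) (auto simp: in_prime_factors_iff)
    also have "\<dots> \<subseteq># M"
      unfolding M_def using e(1) \<open>e > 0\<close> assms
      by (intro multiset_filter_mono) (simp add: prime_factorization_subset_iff_dvd)
    finally have "prime_factorization e \<subseteq># prime_factorization e0" by (simp add: pf)
    then have "e dvd e0" using \<open>e > 0\<close> e0 by (simp add: prime_factorization_subset_iff_dvd)
    then show "e \<le> e0" using e0 by (rule dvd_imp_le)
  qed
  then show ?thesis by (simp add: pf M_def)
qed

definition divisor_weight :: "nat \<Rightarrow> int" where
  "divisor_weight d = 3 ^ little_omega (residue_part 1 d) * (- 1) ^ big_omega (residue_part 2 d)"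

lemma divisor_weight_eq:
  assumes "d > 0"
  shows "divisor_weight d = 3 ^ card {p \<in> prime_factors d. p mod 3 = 1} *
    (- 1) ^ size (filter_mset (\<lambda>p. p mod 3 = 2) (prime_factorization d))"
  by (simp add: divisor_weight_def little_omega_def big_omega_def prime_factorization_residue_part[OF assms])

lemma divisor_weight_mult:
  assumes "coprime a b" "a > 0" "b > 0"
  shows "divisor_weight (a * b) = divisor_weight a * divisor_weight b"
proof -
  have pf: "prime_factorization (a * b) = prime_factorization a + prime_factorization b"
    using assms by (simp add: prime_factorization_mult)
  have "prime_factors a \<inter> prime_factors b = {}"
    using assms(1) by (auto simp: in_prime_factors_iff dest: coprime_common_divisor)
  then have "{p \<in> prime_factors a. p mod 3 = 1} \<inter> {p \<in> prime_factors b. p mod 3 = 1} = {}" by auto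
  moreover have "{p \<in> prime_factors (a * b). p mod 3 = 1} =
      {p \<in> prime_factors a. p mod 3 = 1} \<union> {p \<in> prime_factors b. p mod 3 = 1}" by (auto simp: pf)
  ultimately have "card {p \<in> prime_factors (a * b). p mod 3 = 1} =
      card {p \<in> prime_factors a. p mod 3 = 1} + card {p \<in> prime_factors b. p mod 3 = 1}"
    by (simp add: card_Un_disjoint)
  then show ?thesis using assms by (simp add: divisor_weight_eq pf power_add)
qed

lemma divisor_weight_prime_power:
  assumes "prime p"
  shows "divisor_weight (p ^ k) = (if p mod 3 = 1 \<and> k > 0 then 3 else 1) * (if p mod 3 = 2 then (- 1) ^ k else 1)"
proof -
  have pf: "prime_factorization (p ^ k) = replicate_mset k p"
    using assms by (simp add: prime_factorization_prime_power)
  have "filter_mset Q (replicate_mset k p) = (if Q p then replicate_mset k p else {#})" for Q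
    by (induction k) auto
  moreover have "{q \<in> set_mset (replicate_mset k p). q mod 3 = 1} = (if p mod 3 = 1 \<and> k > 0 then {p} else {})"
    by auto
  moreover have "p ^ k > 0" using assms by (simp add: prime_gt_0_nat)
  ultimately show ?thesis unfolding divisor_weight_eq[OF \<open>p ^ k > 0\<close>] pf by (simp only:) simp
qed

lemma sum_divisors_mult:
  fixes h :: "nat \<Rightarrow> int"
  assumes cop: "coprime a b" and pos: "a > 0" "b > 0"
    and h: "\<And>x y. coprime x y \<Longrightarrow> x > 0 \<Longrightarrow> y > 0 \<Longrightarrow> h (x * y) = h x * h y"
  shows "(\<Sum>d | d dvd a * b. h d) = (\<Sum>d | d dvd a. h d) * (\<Sum>d | d dvd b. h d)"
proof -
  have gcd1: "gcd (x * y) a = x" if "x dvd a" "y dvd b" for x y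
  proof -
    have "coprime y a" using that cop by (metis coprime_commute coprime_divisors dvd_refl)
    then have "gcd (x * y) a = gcd x a" by (simp add: gcd_mult_left_right_cancel coprime_commute)
    then show ?thesis using that(1) by (simp add: gcd_proj1_iff)
  qed
  have "inj_on (\<lambda>(x, y). x * y) ({x. x dvd a} \<times> {y. y dvd b})"
  proof (rule inj_onI, clarify)
    fix x y x' y' assume d: "x dvd a" "y dvd b" "x' dvd a" "y' dvd b" and eq: "x * y = x' * y'"
    then have "x = x'" using gcd1[of x y] gcd1[of x' y'] by simp
    moreover have "x > 0" using d pos by (auto intro!: gr0I)
    ultimately show "x = x' \<and> y = y'" using eq by simp
  qed
  moreover have "(\<lambda>(x, y). x * y) ` ({x. x dvd a} \<times> {y. y dvd b}) = {d. d dvd a * b}"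
  proof (intro equalityI subsetI)
    fix d assume "d \<in> {d. d dvd a * b}"
    then obtain x y where "d = x * y" "x dvd a" "y dvd b" using division_decomp by blast
    then show "d \<in> (\<lambda>(x, y). x * y) ` ({x. x dvd a} \<times> {y. y dvd b})" by (intro image_eqI[of _ _ "(x, y)"]) auto
  qed (auto simp: mult_dvd_mono)
  ultimately have bij: "bij_betw (\<lambda>(x, y). x * y) ({x. x dvd a} \<times> {y. y dvd b}) {d. d dvd a * b}"
    by (simp add: bij_betw_def)
  have "(\<Sum>d | d dvd a * b. h d) = (\<Sum>(x, y)\<in>{x. x dvd a} \<times> {y. y dvd b}. h (x * y))"
    by (subst sum.reindex_bij_betw[OF bij, symmetric]) (simp add: case_prod_unfold)
  also have "\<dots> = (\<Sum>(x, y)\<in>{x. x dvd a} \<times> {y. y dvd b}. h x * h y)"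
  proof (rule sum.cong[OF refl], clarify)
    fix x y assume d: "x dvd a" "y dvd b"
    have "x > 0" "y > 0" using d pos by (auto intro!: gr0I)
    then show "h (x * y) = h x * h y" using d cop by (intro h) (auto intro: coprime_divisors)
  qed
  also have "\<dots> = (\<Sum>d | d dvd a. h d) * (\<Sum>d | d dvd b. h d)"
    by (simp add: sum_product sum.cartesian_product)
  finally show ?thesis .
qed

text \<open>
  The sums are \<open>1 + 3 + \<dots> + 3\<close> and \<open>1 - 1 + 1 - \<dots>\<close>, and the numbers of ideals of norm \<open>p\<^sup>3\<^sup>k\<close> are \<open>3 k + 1\<close>, respectively \<open>1\<close> or \<open>0\<close>.
\<close>

lemma sum_divisor_weight_prime_power:
  assumes "prime p" "p \<noteq> 3"
  shows "(\<Sum>d | d dvd p ^ k. divisor_weight d) = int (eis_count (p ^ (3 * k)))"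
proof -
  have p1: "p > 1" using assms(1) by (rule prime_gt_1_nat)
  have "{d. d dvd p ^ k} = (\<lambda>i. p ^ i) ` {..k}"
    using divides_primepow_nat[OF assms(1), of _ k] by auto
  moreover have "inj_on (\<lambda>i. p ^ i) {..k}" using p1 by (auto simp: inj_on_def)
  ultimately have *: "(\<Sum>d | d dvd p ^ k. divisor_weight d) = (\<Sum>i\<le>k. divisor_weight (p ^ i))"
    by (simp add: sum.reindex)
  show ?thesis using assms(1)
  proof (cases rule: prime_mod_3_cases)
    case 2
    have w: "divisor_weight (p ^ i) = (if i > 0 then 3 else 1)" for i
      unfolding divisor_weight_prime_power[OF assms(1)] using 2 by simp
    have "(\<Sum>i\<le>k. divisor_weight (p ^ i)) = 1 + 3 * int k"
      unfolding w by (induction k) simp_all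
    then show ?thesis using * eis_count_power_split[OF assms(1) 2(1), of "3 * k"] by simp
  next
    case 3
    have w: "divisor_weight (p ^ i) = (- 1) ^ i" for i
      unfolding divisor_weight_prime_power[OF assms(1)] using 3 by simp
    have "(\<Sum>i\<le>k. divisor_weight (p ^ i)) = (if even k then 1 else 0)"
      unfolding w by (induction k) simp_all
    then show ?thesis using * eis_count_power_inert[OF assms(1) 3(1), of "3 * k"] by simp
  qed (use assms in simp)
qed

lemma eis_count_cube_divisor_sum:
  assumes "n \<ge> 1" "\<not> 3 dvd n"
  shows "int (eis_count (n ^ 3)) = (\<Sum>d | d dvd n. divisor_weight d)"
  using assms
proof (induction n rule: less_induct)
  case (less n)
  show ?case
  proof (cases "n = 1")
    case True
    have "divisor_weight 1 = 1" by (simp add: divisor_weight_eq)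
    then show ?thesis using True by simp
  next
    case False
    then obtain p where p: "prime p" "p dvd n" using prime_factor_nat by blast
    define k where "k = multiplicity p n"
    have n0: "n \<noteq> 0" using less.prems by simp
    obtain m where m: "n = p ^ k * m" "\<not> p dvd m"
      using multiplicity_decompose'[of n p] n0 p(1) unfolding k_def by (metis not_prime_unit)
    have p3: "p \<noteq> 3" using p less.prems by auto
    have m1: "m \<ge> 1" using m n0 by (cases m) auto
    have k0: "k > 0" unfolding k_def using p n0 by (simp add: prime_multiplicity_gt_zero_iff)
    have "p ^ k > 1" using k0 p(1) prime_gt_1_nat by (intro one_less_power) auto
    then have "m < n" using m(1) m1 by simp
    moreover have m3: "\<not> 3 dvd m" using less.prems m(1) by auto
    ultimately have IH: "int (eis_count (m ^ 3)) = (\<Sum>d | d dvd m. divisor_weight d)" using less.IH m1 by simp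
    have cop: "coprime p m" using p(1) m(2) by (simp add: prime_imp_coprime)
    have "eis_count (n ^ 3) = eis_count (p ^ (3 * k) * m ^ 3)"
      by (simp add: m(1) power_mult_distrib mult.commute flip: power_mult)
    also have "\<dots> = eis_count (p ^ (3 * k)) * eis_count (m ^ 3)"
      using cop m1 p(1) by (intro eis_count_mult) (auto simp: prime_gt_0_nat)
    finally have "int (eis_count (n ^ 3)) = (\<Sum>d | d dvd p ^ k. divisor_weight d) * (\<Sum>d | d dvd m. divisor_weight d)"
      by (simp add: IH sum_divisor_weight_prime_power[OF p(1) p3])
    also have "\<dots> = (\<Sum>d | d dvd n. divisor_weight d)"
      unfolding m(1) using cop m1 p(1)
      by (intro sum_divisors_mult[symmetric] divisor_weight_mult) (auto simp: prime_gt_0_nat)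
    finally show ?thesis .
  qed
qed


theorem theorem3:
  shows "(\<exists>\<sigma>::real.
            (\<forall>s. Re s > \<sigma> \<longrightarrow>
              (let z = s / 2 in
                (\<lambda>P. inverse (height P s)) summable_on integral_points \<and>
                (\<lambda>I. 1 / of_nat (ideal_norm E I) powr z :: complex) summable_on nonzero_ideals E \<and>
                abs_convergent_prod (factor_2 z) \<and>
                abs_convergent_prod (factor_1 z) \<and>
                height_zeta s =
                  (1 - 1 / 3 powr z)\<^sup>2 * (dedekind_zeta E z)\<^sup>2
                    * (\<Prod>q. factor_2 z q) * (\<Prod>p. factor_1 z p))) \<and>
            (\<exists>F. F meromorphic_on {s. Re s > 1} \<and>
                 (\<forall>s. Re s > \<sigma> \<and> Re s > 1 \<longrightarrow> F s = height_zeta s) \<and>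
                 F holomorphic_on {s. Re s > 1} - {2} \<and>
                 is_pole F 2 \<and> zorder F 2 = - 2))
       \<and> (\<forall>n::nat. n \<ge> 1 \<and> \<not> 3 dvd n \<longrightarrow>
            finite {P \<in> integral_points. height P 1 = of_real (sqrt (real n))} \<and>
            int (card {P \<in> integral_points. height P 1 = of_real (sqrt (real n))}) =
              (\<Sum>d | d dvd n. 3 ^ little_omega (residue_part 1 d)
                             * (- 1) ^ big_omega (residue_part 2 d)))"
proof -
  have formula: "let z = s / 2 in
      (\<lambda>P. inverse (height P s)) summable_on integral_points \<and>
      (\<lambda>I. 1 / of_nat (ideal_norm E I) powr z :: complex) summable_on nonzero_ideals E \<and>
      abs_convergent_prod (factor_2 z) \<and> abs_convergent_prod (factor_1 z) \<and>
      height_zeta s = (1 - 1 / 3 powr z)\<^sup>2 * (dedekind_zeta E z)\<^sup>2 * (\<Prod>q. factor_2 z q) * (\<Prod>p. factor_1 z p)"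
    if s: "Re s > 20" for s
  proof -
    have z: "Re (s / 2) > 10" using s by simp
    have "abs_convergent_prod (factor_2 (s / 2))" "abs_convergent_prod (factor_1 (s / 2))"
      using z by (intro abs_convergent_factors; simp)+
    then show ?thesis
      using height_zeta_eq[OF s] ideal_series_eq_dedekind[OF z] point_series_eq[OF z]
      by (simp add: Let_def npow_def)
  qed
  obtain F where "F meromorphic_on {s. Re s > 1}" "\<And>s. Re s > 20 \<Longrightarrow> F s = point_series (s / 2)"
    "F holomorphic_on {s. Re s > 1} - {2}" "is_pole F 2" "zorder F 2 = - 2"
    using point_series_continuation by blast
  then have continuation: "\<exists>F. F meromorphic_on {s. Re s > 1} \<and>
      (\<forall>s. Re s > 20 \<and> Re s > 1 \<longrightarrow> F s = height_zeta s) \<and>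
      F holomorphic_on {s. Re s > 1} - {2} \<and> is_pole F 2 \<and> zorder F 2 = - 2"
    using height_zeta_eq(2) by auto
  have count: "finite {P \<in> integral_points. height P 1 = of_real (sqrt (real n))} \<and>
      int (card {P \<in> integral_points. height P 1 = of_real (sqrt (real n))}) =
        (\<Sum>d | d dvd n. 3 ^ little_omega (residue_part 1 d) * (- 1) ^ big_omega (residue_part 2 d))"
    if n: "n \<ge> 1" "\<not> 3 dvd n" for n
  proof -
    have "{P \<in> integral_points. height P 1 = of_real (sqrt (real n))} = {P \<in> integral_points. point_norm P = n}"
      using height_1_eq_iff by auto
    then show ?thesis
      using point_norm_fibre[of n] eis_count_cube_divisor_sum[OF n] n(2)
      by (simp add: point_count_def divisor_weight_def)
  qed
  show ?thesis using formula continuation count by blast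
qed


end
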